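(* Let $\alpha>0$, $\alpha+1\le\beta\le\alpha+2$, let $F$ satisfy the structural assumptions described in the context, and let $b$ be continuous on $B_1$, and Hölder continuous when $\beta=\alpha+2$. Let $f,g$ be continuous and bounded on $B_1$. Suppose $u$ is an upper semicontinuous, bounded from above, viscosity subsolution of $-F(\nabla u,D^2u)+b(x)|\nabla u|^\beta\le g$ in $B_1$, and $v$ is a lower semicontinuous, bounded from below, viscosity supersolution of $-F(\nabla v,D^2v)+b(x)|\nabla v|^\beta\ge f$ in $B_1$. Then for all $r<1$ there exists $c_r$ such that for all $(x,y)\in B_r^2$, $$u(x)-v(y)\le\sup_{B_1}(u-v)+c_r|x-y|.$$
   Context: $B_r$ is the open ball of radius $r$ centered at $0$ in $\mathbb{R}^N$. $S$ is the space of real symmetric $N\times N$ matrices. $F:S\to\mathbb{R}$ satisfies: there are $0<a<A$ with $a\,\mathrm{tr}(N)\le F(M+N)-F(M)\le A\,\mathrm{tr}(N)$ for all $M,N\in S$, $N\ge0$; and $F(tM)=tF(M)$ for $t>0$. For $p\in\mathbb{R}^N$, $\Theta_\alpha(p)=\mathrm{Diag}(|p_i|^{\alpha/2})$ and $F(p,M):=F(\Theta_\alpha(p)M\Theta_\alpha(p))$. $|\cdot|$ is the Euclidean norm. *)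

theory Defs
  imports "HOL-Analysis.Analysis"
begin

definition sym_mat :: "real^'n^'n \<Rightarrow> bool" where
  "sym_mat M \<longleftrightarrow> transpose M = M"

definition psd_mat :: "real^'n^'n \<Rightarrow> bool" where
  "psd_mat M \<longleftrightarrow> sym_mat M \<and> (\<forall>\<xi>. 0 \<le> \<xi> \<bullet> (M *v \<xi>))"

definition structural_F :: "(real^'n^'n \<Rightarrow> real) \<Rightarrow> real \<Rightarrow> real \<Rightarrow> bool" where
  "structural_F F a A \<longleftrightarrow> 0 < a \<and> a < A \<and>
     (\<forall>M N. sym_mat M \<longrightarrow> psd_mat N \<longrightarrow>
        a * trace N \<le> F (M + N) - F M \<and> F (M + N) - F M \<le> A * trace N) \<and>
     (\<forall>M t. sym_mat M \<longrightarrow> t > 0 \<longrightarrow> F (t *\<^sub>R M) = t * F M)"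

definition Theta :: "real \<Rightarrow> real^'n \<Rightarrow> real^'n^'n" where
  "Theta \<alpha> p = (\<chi> i j. if i = j then \<bar>p $ i\<bar> powr (\<alpha> / 2) else 0)"

definition Fp :: "(real^'n^'n \<Rightarrow> real) \<Rightarrow> real \<Rightarrow> real^'n \<Rightarrow> real^'n^'n \<Rightarrow> real" where
  "Fp F \<alpha> p M = F (Theta \<alpha> p ** M ** Theta \<alpha> p)"

definition usc_on :: "(real^'n) set \<Rightarrow> (real^'n \<Rightarrow> real) \<Rightarrow> bool" where
  "usc_on S u \<longleftrightarrow> (\<forall>x\<in>S. \<forall>e>0. \<forall>\<^sub>F y in at x within S. u y < u x + e)"

definition lsc_on :: "(real^'n) set \<Rightarrow> (real^'n \<Rightarrow> real) \<Rightarrow> bool" where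
  "lsc_on S v \<longleftrightarrow> (\<forall>x\<in>S. \<forall>e>0. \<forall>\<^sub>F y in at x within S. v x - e < v y)"

definition C2_on :: "(real^'n) set \<Rightarrow> (real^'n \<Rightarrow> real) \<Rightarrow> (real^'n \<Rightarrow> real^'n)
                      \<Rightarrow> (real^'n \<Rightarrow> real^'n^'n) \<Rightarrow> bool" where
  "C2_on U \<phi> D\<phi> H\<phi> \<longleftrightarrow> open U \<and>
     (\<forall>x\<in>U. (\<phi> has_derivative (\<lambda>h. D\<phi> x \<bullet> h)) (at x)) \<and>
     (\<forall>x\<in>U. (D\<phi> has_derivative (\<lambda>h. H\<phi> x *v h)) (at x)) \<and>
     continuous_on U H\<phi>"

definition visc_sub ::
  "(real^'n^'n \<Rightarrow> real) \<Rightarrow> real \<Rightarrow> real \<Rightarrow> (real^'n \<Rightarrow> real) \<Rightarrow> (real^'n \<Rightarrow> real)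
    \<Rightarrow> (real^'n) set \<Rightarrow> (real^'n \<Rightarrow> real) \<Rightarrow> bool" where
  "visc_sub F \<alpha> \<beta> b g S u \<longleftrightarrow>
     (\<forall>x0\<in>S. \<forall>U \<phi> D\<phi> H\<phi>. x0 \<in> U \<longrightarrow> U \<subseteq> S \<longrightarrow> C2_on U \<phi> D\<phi> H\<phi> \<longrightarrow>
        (\<forall>x\<in>U. u x - \<phi> x \<le> u x0 - \<phi> x0) \<longrightarrow>
        - Fp F \<alpha> (D\<phi> x0) (H\<phi> x0) + b x0 * norm (D\<phi> x0) powr \<beta> \<le> g x0)"

definition visc_super ::
  "(real^'n^'n \<Rightarrow> real) \<Rightarrow> real \<Rightarrow> real \<Rightarrow> (real^'n \<Rightarrow> real) \<Rightarrow> (real^'n \<Rightarrow> real)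
    \<Rightarrow> (real^'n) set \<Rightarrow> (real^'n \<Rightarrow> real) \<Rightarrow> bool" where
  "visc_super F \<alpha> \<beta> b f S v \<longleftrightarrow>
     (\<forall>x0\<in>S. \<forall>U \<phi> D\<phi> H\<phi>. x0 \<in> U \<longrightarrow> U \<subseteq> S \<longrightarrow> C2_on U \<phi> D\<phi> H\<phi> \<longrightarrow>
        (\<forall>x\<in>U. v x - \<phi> x \<ge> v x0 - \<phi> x0) \<longrightarrow>
        - Fp F \<alpha> (D\<phi> x0) (H\<phi> x0) + b x0 * norm (D\<phi> x0) powr \<beta> \<ge> f x0)"

definition holder_on :: "(real^'n) set \<Rightarrow> (real^'n \<Rightarrow> real) \<Rightarrow> bool" where
  "holder_on S b \<longleftrightarrow> (\<exists>\<gamma> C. 0 < \<gamma> \<and> \<gamma> \<le> 1 \<and>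
      (\<forall>x\<in>S. \<forall>y\<in>S. \<bar>b x - b y\<bar> \<le> C * dist x y powr \<gamma>))"

end

theory Submission
  imports Defs
begin

text \<open>
  The proof follows Ishii and Lions. If the estimate fails, then
  \<open>u x - v y - \<sigma> - M \<omega>(|x - y|) - L |x - x0|\<^sup>2 - L |y - x0|\<^sup>2\<close> has a positive maximum off the diagonal.
  Second-order jets \<open>X\<close>, \<open>Y\<close> there satisfy a matrix inequality in which the concavity of \<open>\<omega>\<close> makes
  \<open>X - Y\<close> very negative in the direction \<open>x - y\<close>; ellipticity then contradicts the two equations for
  large \<open>M\<close>. This is done first for \<open>\<omega> t = sqrt t\<close>. The resulting Hoelder estimate keeps the maximum
  close to \<open>x0\<close>, which allows a second round with \<open>\<omega> t = t - t\<^sup>1\<^sup>+\<^sup>\<tau> / 4\<close>.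

  The jets come from a theorem on sums that avoids the theorems of Alexandrov and Rademacher. For a
  Lipschitz function the dyadic difference quotients have monotone bounded energy, so second
  differences are small in measure at small scales and the function is almost affine at one such
  scale around most points. Applied to the gradient of a Lasry-Lions regularisation, and combined with
  Jensen's observation that its contact set has positive measure, this yields an almost quadratic
  contact point, which suffices to touch with a quadratic function nearby.
\<close>

section \<open>Second-order expansion at a single scale\<close>

text \<open>Let \<open>s\<close> be the distance of the two points at the maximum,
  \<open>P = M * \<omega>1 s\<close> the size of the gradients and
  \<open>\<kappa> = - \<omega>2 s * s / \<omega>1 s\<close>. Normalised by
  \<open>P powr (\<alpha> + 1) / s\<close>, the equations bound a multiple of
  \<open>\<kappa> powr (1 + \<alpha> / 2)\<close> by errors; the extra exponent
  \<open>\<alpha> / 2\<close> is the price of the weights, which may degenerate along coordinates in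
  which \<open>x - y\<close> is small. For the square root \<kappa> is 1/2, so errors that are
  merely small for large \<open>M\<close> suffice, and uniform continuity of \<open>b\<close> is
  enough. For the nearly linear \<omega>, \<kappa> decays like \<open>s powr \<tau>\<close>, so each
  error must carry a power of \<open>s\<close>. The localising terms perturb the gradients by
  \<open>2 * L * norm (x - x0)\<close>, a priori only bounded; the Hoelder estimate makes it of
  order \<open>s powr (1 / 4)\<close>. The error from \<open>b\<close> is
  \<open>|b x - b y| * s * P powr (\<beta> - \<alpha> - 1)\<close> with \<open>s * P\<close>
  bounded: for \<beta> < \<alpha> + 2 this is already a power of \<open>s\<close>, and in the
  borderline case the Hoelder exponent of \<open>b\<close> supplies one.\<close>

lemma integrable_continuous_bounded_support:
  fixes f :: "'a::euclidean_space \<Rightarrow> real"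
  assumes "continuous_on UNIV f" "\<And>x. norm x > R \<Longrightarrow> f x = 0"
  shows "integrable lborel f"
proof -
  have "integrable lborel (\<lambda>x. indicator (cball 0 R) x *\<^sub>R f x)"
    by (rule borel_integrable_compact) (use assms in \<open>auto intro: continuous_on_subset\<close>)
  moreover have "(\<lambda>x. indicator (cball 0 R) x *\<^sub>R f x) = f"
    using assms(2) by (fastforce simp: indicator_def fun_eq_iff not_le)
  ultimately show ?thesis by simp
qed

lemma integral_lborel_translation:
  fixes f :: "'a::euclidean_space \<Rightarrow> real"
  assumes [measurable]: "f \<in> borel_measurable borel"
  shows "(\<integral>x. f (x + v) \<partial>lborel) = (\<integral>x. f x \<partial>lborel)"
proof -
  have "(\<integral>x. f x \<partial>lborel) = (\<integral>x. f x \<partial>(distr lborel borel ((+) v)))"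
    by (simp add: lborel_distr_plus)
  also have "\<dots> = (\<integral>x. f (v + x) \<partial>lborel)"
    by (rule integral_distr) auto
  finally show ?thesis by (simp add: add.commute)
qed

text \<open>The energies of the dyadic difference quotients increase as the scale decreases, and the
  increments are the energies of the second differences.\<close>

lemma integral_second_difference_tendsto:
  fixes g :: "'a::euclidean_space \<Rightarrow> real"
  assumes lip: "\<And>x y. \<bar>g x - g y\<bar> \<le> L * norm (x - y)"
    and supp: "\<And>x. norm x > R \<Longrightarrow> g x = 0"
  defines "h \<equiv> \<lambda>k::nat. (1/2::real)^k"
  shows "(\<lambda>k. (\<integral>x. (g (x + (2 * h k) *\<^sub>R v) - 2 * g (x + h k *\<^sub>R v) + g x)\<^sup>2 \<partial>lborel) / (h k)\<^sup>2)
    \<longlonglongrightarrow> 0"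
proof -
  have "L-lipschitz_on UNIV g" if "L \<ge> 0"
    using that lip by (intro lipschitz_onI) (auto simp: dist_norm)
  moreover have "L \<ge> 0"
  proof -
    obtain b :: 'a where "b \<in> Basis" using nonempty_Basis by blast
    then show ?thesis using lip[of b 0] by (auto intro: order_trans[OF abs_ge_zero])
  qed
  ultimately have cont: "continuous_on UNIV g" and L0: "L \<ge> 0"
    by (auto intro: lipschitz_on_continuous_on)
  have cont': "continuous_on UNIV (\<lambda>x. g (x + w))" for w
    by (rule continuous_on_compose2[OF cont]) (auto intro!: continuous_intros)
  define I where "I w = (\<integral>x. (g (x + w) - g x)\<^sup>2 \<partial>lborel)" for w
  define J where "J w = (\<integral>x. (g (x + 2 *\<^sub>R w) - 2 * g (x + w) + g x)\<^sup>2 \<partial>lborel)" for w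
  have far: "g (x + w) = 0" if "norm x > R + norm w" for x w
    using that norm_triangle_ineq2[of x "-w"] by (intro supp) auto
  have far0: "g x = 0" if "norm x > R + norm w" for x w
    using that norm_ge_zero[of w] by (intro supp) linarith
  have far3: "g (x + 2 *\<^sub>R w) = 0" "g (x + w) = 0" "g x = 0" if "norm x > R + 3 * norm w" for x w
  proof -
    have n: "norm x > R + norm (2 *\<^sub>R w)" "norm x > R + norm w"
      using that norm_ge_zero[of w] norm_scaleR[of 2 w] unfolding abs_numeral by linarith+
    show "g (x + 2 *\<^sub>R w) = 0" "g (x + w) = 0" "g x = 0"
      by (rule far[OF n(1)] far[OF n(2)] far0[OF n(2)])+
  qed
  have D: "integrable lborel (\<lambda>x. (g (x + w) - g x)\<^sup>2)" for w
    by (rule integrable_continuous_bounded_support[where R = "R + norm w"])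
       (auto intro!: continuous_intros cont' cont simp: far0 far)
  have D': "integrable lborel (\<lambda>x. (g (x + 2 *\<^sub>R w) - g (x + w))\<^sup>2)" for w
    by (rule integrable_continuous_bounded_support[where R = "R + 3 * norm w"])
       (auto intro!: continuous_intros cont' cont simp: far3)
  have D2: "integrable lborel (\<lambda>x. (g (x + 2 *\<^sub>R w) - 2 * g (x + w) + g x)\<^sup>2)" for w
    by (rule integrable_continuous_bounded_support[where R = "R + 3 * norm w"])
       (auto intro!: continuous_intros cont' cont simp: far3)
  \<comment> \<open>With \<open>A\<close> and \<open>B\<close> the two consecutive differences along
    \<open>w\<close>, this is \<open>(A + B)^2 = 2 A^2 + 2 B^2 - (A - B)^2\<close>, integrated. Both
    squares have the same integral by translation invariance.\<close>
  have rec: "I (2 *\<^sub>R w) = 4 * I w - J w" for w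
  proof -
    have "(\<integral>x. (g ((x + w) + w) - g (x + w))\<^sup>2 \<partial>lborel) = I w"
      unfolding I_def
      by (rule integral_lborel_translation[where f = "\<lambda>x. (g (x + w) - g x)\<^sup>2"])
         (intro borel_measurable_continuous_onI continuous_intros cont cont')
    then have tr: "(\<integral>x. (g (x + 2 *\<^sub>R w) - g (x + w))\<^sup>2 \<partial>lborel) = I w"
      by (simp add: scaleR_2 add.assoc)
    have "I (2 *\<^sub>R w) = (\<integral>x. 2 * (g (x + 2 *\<^sub>R w) - g (x + w))\<^sup>2 + 2 * (g (x + w) - g x)\<^sup>2
        - (g (x + 2 *\<^sub>R w) - 2 * g (x + w) + g x)\<^sup>2 \<partial>lborel)"
      unfolding I_def by (rule arg_cong[where f = "integral\<^sup>L lborel"])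
        (auto simp: fun_eq_iff power2_eq_square algebra_simps)
    also have "\<dots> = 2 * I w + 2 * I w - J w"
      using D[of w] D'[of w] D2[of w] by (simp add: tr I_def[symmetric] J_def[symmetric])
    finally show ?thesis by simp
  qed
  define a where "a k = I (h k *\<^sub>R v) / (h k)\<^sup>2" for k
  have hs: "h k = 2 * h (Suc k)" "h k > 0" "h k \<le> 1" for k
    by (auto simp: h_def power_le_one)
  have step: "a k = a (Suc k) - J (h (Suc k) *\<^sub>R v) / (4 * (h (Suc k))\<^sup>2)" for k
    using rec[of "h (Suc k) *\<^sub>R v"] hs(1)[of k] hs(2)[of "Suc k"]
    by (simp add: a_def field_simps power2_eq_square)
  have Jnn: "J w \<ge> 0" for w by (simp add: J_def)
  have "incseq a"
  proof (rule incseq_SucI)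
    fix k
    have "J (h (Suc k) *\<^sub>R v) / (4 * (h (Suc k))\<^sup>2) \<ge> 0" using Jnn by simp
    then show "a k \<le> a (Suc k)" using step[of k] by linarith
  qed
  \<comment> \<open>The bound is uniform in \<open>k\<close>: the difference quotient is at most
    \<open>L * norm v\<close> and vanishes off a fixed ball. Hence \<open>a\<close> converges and
    its increments tend to 0.\<close>
  moreover have "a k \<le> L\<^sup>2 * (norm v)\<^sup>2 * measure lborel (cball (0::'a) (R + norm v))" for k
  proof -
    have "I (h k *\<^sub>R v) \<le> (\<integral>x. L\<^sup>2 * (h k)\<^sup>2 * (norm v)\<^sup>2 * indicator (cball (0::'a) (R + norm v)) x \<partial>lborel)"
      unfolding I_def
    proof (rule Bochner_Integration.integral_mono)
      show "integrable lborel (\<lambda>x. (g (x + h k *\<^sub>R v) - g x)\<^sup>2)" by (rule D)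
      show "integrable lborel (\<lambda>x. L\<^sup>2 * (h k)\<^sup>2 * (norm v)\<^sup>2 * indicator (cball (0::'a) (R + norm v)) x :: real)"
        by (intro integrable_mult_right integrable_real_indicator) (use emeasure_lborel_cball_finite[of "0::'a"] in auto)
      fix x :: 'a
      show "(g (x + h k *\<^sub>R v) - g x)\<^sup>2 \<le> L\<^sup>2 * (h k)\<^sup>2 * (norm v)\<^sup>2 * indicator (cball 0 (R + norm v)) x"
      proof (cases "norm x \<le> R + norm v")
        case True
        have "\<bar>g (x + h k *\<^sub>R v) - g x\<bar> \<le> L * (h k * norm v)"
          using lip[of "x + h k *\<^sub>R v" x] hs(2)[of k] by (simp add: abs_mult)
        then have "\<bar>g (x + h k *\<^sub>R v) - g x\<bar>\<^sup>2 \<le> (L * (h k * norm v))\<^sup>2"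
          by (rule power_mono) auto
        with True show ?thesis by (simp add: power_mult_distrib mult.assoc)
      next
        case False
        have "h k * norm v \<le> norm v"
          using hs(2,3)[of k] by (intro mult_left_le_one_le) auto
        then have "norm x > R + norm (h k *\<^sub>R v)" "norm x > R"
          using False hs(2)[of k] norm_ge_zero[of v] by (auto simp del: norm_ge_zero)
        then show ?thesis using False by (simp add: far supp)
      qed
    qed
    also have "\<dots> = (h k)\<^sup>2 * (L\<^sup>2 * (norm v)\<^sup>2 * measure lborel (cball (0::'a) (R + norm v)))"
      by (simp add: mult_ac)
    finally show ?thesis
      using hs(2)[of k] by (simp add: a_def divide_le_eq mult_ac)
  qed
  ultimately obtain l where l: "a \<longlonglongrightarrow> l"
    using incseq_convergent[of a] by blast
  have "(\<lambda>k. 4 * (a (Suc k) - a k)) \<longlonglongrightarrow> 4 * (l - l)"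
    by (intro tendsto_intros LIMSEQ_Suc l)
  moreover have "4 * (a (Suc k) - a k) = J (h (Suc k) *\<^sub>R v) / (h (Suc k))\<^sup>2" for k
    using step[of k] by simp
  ultimately have "(\<lambda>k. J (h (Suc k) *\<^sub>R v) / (h (Suc k))\<^sup>2) \<longlonglongrightarrow> 0" by simp
  then have "(\<lambda>k. J (h k *\<^sub>R v) / (h k)\<^sup>2) \<longlonglongrightarrow> 0"
    by (rule LIMSEQ_imp_Suc)
  then show ?thesis by (simp add: J_def)
qed

text \<open>Stability of Jensen's functional equation in the manner of Hyers and Ulam. The linear
  map is read off from the values of \<open>G\<close> on the basis. Each basis direction contributes
  \<open>2 * \<epsilon>\<close> for homogeneity along the axis and \<open>2 * \<epsilon>\<close> for
  splitting off one summand, hence the factor 4 times the dimension.\<close>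

lemma approx_jensen_imp_approx_linear:
  fixes G :: "'a::euclidean_space \<Rightarrow> real" and \<epsilon> :: real
  assumes J: "\<And>v w. norm v \<le> 1 \<Longrightarrow> norm w \<le> 1 \<Longrightarrow> \<bar>G (w + v) - 2 * G w + G (w - v)\<bar> \<le> \<epsilon>"
    and G0: "G 0 = 0" and cont: "continuous_on UNIV G"
  shows "\<exists>q. \<forall>y\<in>cball 0 1. \<bar>G y - q \<bullet> y\<bar> \<le> 4 * DIM('a) * \<epsilon>"
proof -
  have add: "\<bar>G (a + b) - G a - G b\<bar> \<le> 2 * \<epsilon>" if "norm a \<le> 1" "norm b \<le> 1" for a b
  proof -
    define w v where "w = (a + b) /\<^sub>R 2" and "v = (a - b) /\<^sub>R 2"
    have n: "norm w \<le> 1" "norm v \<le> 1"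
      using that norm_triangle_ineq[of a b] norm_triangle_ineq4[of a b] by (auto simp: w_def v_def)
    have e: "w + v = a" "w - v = b" "w + w = a + b"
      by (auto simp: w_def v_def algebra_simps scaleR_2[symmetric])
    show ?thesis using J[OF n(2,1)] J[OF n(1,1)] e G0 by auto
  qed
  have one: "\<bar>G (t *\<^sub>R b) - t * G b\<bar> \<le> \<epsilon>" if b: "norm b = 1" and t: "t \<in> {0..1}" for t b
  proof -
    define \<phi> where "\<phi> t = G (t *\<^sub>R b) - t * G b" for t
    have "continuous_on {0..1} (\<lambda>t. \<bar>\<phi> t\<bar>)"
      unfolding \<phi>_def by (intro continuous_intros continuous_on_compose2[OF cont]) auto
    then obtain t0 where t0: "t0 \<in> {0..1}" "\<And>t. t \<in> {0..1} \<Longrightarrow> \<bar>\<phi> t\<bar> \<le> \<bar>\<phi> t0\<bar>"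
      using continuous_attains_sup[of "{0..1::real}" "\<lambda>t. \<bar>\<phi> t\<bar>"] by auto
    have \<phi>01: "\<phi> 0 = 0" "\<phi> 1 = 0" by (auto simp: \<phi>_def G0)
    \<comment> \<open>A maximum principle for the homogeneity defect. Reflecting the nearer end
      point of the interval, where the defect vanishes, in \<open>t0\<close> gives a point
      \<open>t\<close> with \<open>2 * |\<phi> t0| \<le> |\<phi> t| + \<epsilon>\<close>, and
      \<open>|\<phi> t| \<le> |\<phi> t0|\<close> by the choice of \<open>t0\<close>.\<close>
    have "\<bar>\<phi> t0\<bar> \<le> \<epsilon>"
    proof (cases "t0 \<le> 1/2")
      case True
      have "\<bar>G (t0 *\<^sub>R b + t0 *\<^sub>R b) - 2 * G (t0 *\<^sub>R b) + G (t0 *\<^sub>R b - t0 *\<^sub>R b)\<bar> \<le> \<epsilon>"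
        by (rule J) (use t0 b in auto)
      then have "\<bar>\<phi> (2 * t0) - 2 * \<phi> t0\<bar> \<le> \<epsilon>"
        by (simp add: \<phi>_def G0 algebra_simps scaleR_2[symmetric])
      moreover have "\<bar>\<phi> (2 * t0)\<bar> \<le> \<bar>\<phi> t0\<bar>" using True t0 by auto
      ultimately show ?thesis by linarith
    next
      case False
      have "\<bar>G (t0 *\<^sub>R b + (1 - t0) *\<^sub>R b) - 2 * G (t0 *\<^sub>R b) + G (t0 *\<^sub>R b - (1 - t0) *\<^sub>R b)\<bar> \<le> \<epsilon>"
        by (rule J) (use t0 b in auto)
      moreover have "t0 *\<^sub>R b + (1 - t0) *\<^sub>R b = b" "t0 *\<^sub>R b - (1 - t0) *\<^sub>R b = (2 * t0 - 1) *\<^sub>R b"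
        by (auto simp flip: scaleR_left_distrib scaleR_left_diff_distrib)
      ultimately have "\<bar>\<phi> (2 * t0 - 1) - 2 * \<phi> t0\<bar> \<le> \<epsilon>"
        by (simp add: \<phi>_def algebra_simps)
      moreover have "\<bar>\<phi> (2 * t0 - 1)\<bar> \<le> \<bar>\<phi> t0\<bar>" using False t0 by auto
      ultimately show ?thesis by linarith
    qed
    then show ?thesis using t0(2)[OF t] by (simp add: \<phi>_def)
  qed
  have eps: "\<epsilon> \<ge> 0" using J[of 0 0] by auto
  have one': "\<bar>G (t *\<^sub>R b) - t * G b\<bar> \<le> 2 * \<epsilon>" if b: "norm b = 1" and t: "\<bar>t\<bar> \<le> 1" for t b
  proof (cases "t \<ge> 0")
    case True
    then show ?thesis using one[OF b, of t] t eps by auto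
  next
    case False
    have "\<bar>G (0 + t *\<^sub>R b) - 2 * G 0 + G (0 - t *\<^sub>R b)\<bar> \<le> \<epsilon>"
      by (rule J) (use t b in auto)
    then show ?thesis using one[OF b, of "-t"] False t G0 by (auto simp: abs_if split: if_splits)
  qed
  define q where "q = (\<Sum>b\<in>Basis. G b *\<^sub>R b)"
  have "\<bar>G y - q \<bullet> y\<bar> \<le> 4 * DIM('a) * \<epsilon>" if y: "y \<in> cball 0 1" for y
  proof -
    have part: "norm (\<Sum>b\<in>B. (y \<bullet> b) *\<^sub>R b) \<le> 1" if "B \<subseteq> Basis" for B
    proof -
      have "finite B" using that finite_Basis finite_subset by blast
      then have "norm (\<Sum>b\<in>B. (y \<bullet> b) *\<^sub>R b) \<le> norm y"
        using that by (intro norm_le_componentwise)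
          (auto simp: inner_sum_left inner_Basis subset_iff if_distrib sum.delta' cong: if_cong sum.cong)
      then show ?thesis using y by simp
    qed
    have "\<bar>G (\<Sum>b\<in>B. (y \<bullet> b) *\<^sub>R b) - (\<Sum>b\<in>B. (y \<bullet> b) * G b)\<bar> \<le> 4 * card B * \<epsilon>"
      if "finite B" "B \<subseteq> Basis" for B
      using that
    proof (induction B rule: finite_induct)
      case empty
      then show ?case by (simp add: G0)
    next
      case (insert b B)
      have yb: "\<bar>y \<bullet> b\<bar> \<le> 1" using y insert.prems Basis_le_norm[of b y] by auto
      have nb: "norm b = 1" using insert.prems by auto
      have "\<bar>G ((y \<bullet> b) *\<^sub>R b + (\<Sum>b\<in>B. (y \<bullet> b) *\<^sub>R b)) - G ((y \<bullet> b) *\<^sub>R b) - G (\<Sum>b\<in>B. (y \<bullet> b) *\<^sub>R b)\<bar> \<le> 2 * \<epsilon>"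
        by (rule add) (use yb nb part[of B] insert.prems in auto)
      moreover have "\<bar>G ((y \<bullet> b) *\<^sub>R b) - (y \<bullet> b) * G b\<bar> \<le> 2 * \<epsilon>"
        by (rule one'[OF nb yb])
      moreover have "\<bar>G (\<Sum>b\<in>B. (y \<bullet> b) *\<^sub>R b) - (\<Sum>b\<in>B. (y \<bullet> b) * G b)\<bar> \<le> 4 * card B * \<epsilon>"
        using insert by auto
      ultimately show ?case
        using insert.hyps by (simp add: algebra_simps)
    qed
    from this[of Basis] show ?thesis
      unfolding euclidean_representation[of y] by (simp add: q_def inner_sum_left inner_commute[of y] mult.commute)
  qed
  then show ?thesis by blast
qed

text \<open>Takes the place of Rademacher's theorem. Markov's inequality makes the set of large
  second differences small in measure, and since all rescaled functions are
  \<open>L\<close>-Lipschitz, a finite net of directions controls every direction. The exceptional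
  set may change with the scale, so nothing is claimed about a limit of the slopes
  \<open>q\<close>.\<close>

lemma lipschitz_affine_at_dyadic_scales:
  fixes g :: "'a::euclidean_space \<Rightarrow> real"
  assumes lip: "\<And>x y. \<bar>g x - g y\<bar> \<le> L * norm (x - y)"
    and supp: "\<And>x. norm x > R \<Longrightarrow> g x = 0"
    and \<eta>: "\<eta> > 0" and \<epsilon>: "\<epsilon> > 0"
  shows "\<forall>\<^sub>F k in sequentially. \<exists>E\<in>sets lborel. emeasure lborel E \<le> ennreal \<epsilon> \<and>
    (\<forall>x. x \<notin> E \<longrightarrow> (\<exists>q. norm q \<le> L + \<eta> \<and>
      (\<forall>y\<in>cball 0 1. \<bar>g (x + (1/2)^k *\<^sub>R y) - g x - (1/2)^k * (q \<bullet> y)\<bar> \<le> \<eta> * (1/2)^k)))"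
proof -
  define h :: "nat \<Rightarrow> real" where "h k = (1/2)^k" for k
  have hpos: "h k > 0" for k by (simp add: h_def)
  have L0: "L \<ge> 0"
  proof -
    obtain b :: 'a where "b \<in> Basis" using nonempty_Basis by blast
    then show ?thesis using lip[of b 0] by (auto intro: order_trans[OF abs_ge_zero])
  qed
  have "L-lipschitz_on UNIV g"
    using L0 lip by (intro lipschitz_onI) (auto simp: dist_norm)
  then have cont: "continuous_on UNIV g" by (rule lipschitz_on_continuous_on)
  have cont': "continuous_on UNIV (\<lambda>x. g (x + w))" for w
    by (rule continuous_on_compose2[OF cont]) (auto intro!: continuous_intros)
  \<comment> \<open>With this value the stability bound for Jensen's equation becomes \<eta>. Half
    of \<open>\<epsilon>1\<close> is allowed on the net; the other half pays for replacing
    \<open>v\<close> and \<open>w\<close> by net points, which costs \<open>6 * (L * r)\<close> and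
    explains the 12 in \<open>r\<close>.\<close>
  define \<epsilon>1 where "\<epsilon>1 = \<eta> / (4 * DIM('a))"
  have \<epsilon>1: "\<epsilon>1 > 0" using \<eta> by (simp add: \<epsilon>1_def)
  define r where "r = \<epsilon>1 / (12 * (L + 1))"
  have r: "r > 0" using \<epsilon>1 L0 by (simp add: r_def)
  obtain V :: "'a set" where V: "finite V" "V \<subseteq> cball 0 1" "cball 0 1 \<subseteq> (\<Union>v\<in>V. ball v r)"
  proof (rule compactE_image[OF compact_cball, of "cball (0::'a) 1" "\<lambda>v. ball v r" 0 1])
    show "cball 0 1 \<subseteq> (\<Union>v\<in>cball (0::'a) 1. ball v r)" using r by force
  qed auto
  define S where "S k v w = {x. \<epsilon>1 / 2 * h k \<le> \<bar>g (x + h k *\<^sub>R (w + v)) - 2 * g (x + h k *\<^sub>R w) + g (x + h k *\<^sub>R (w - v))\<bar>}"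
    for k v w
  have Sm: "S k v w \<in> sets lborel" for k v w
  proof -
    have "closed (S k v w)"
      unfolding S_def by (intro closed_Collect_le continuous_intros cont')
    then show ?thesis by simp
  qed
  have small: "\<forall>\<^sub>F k in sequentially. emeasure lborel (S k v w) \<le> ennreal \<epsilon>'" if "\<epsilon>' > 0" for v w \<epsilon>'
  proof -
    define f where "f k x = (g (x + (2 * h k) *\<^sub>R v) - 2 * g (x + h k *\<^sub>R v) + g x)\<^sup>2" for k x
    have fc: "continuous_on UNIV (f k)" for k
      unfolding f_def by (intro continuous_intros cont cont')
    have fint: "integrable lborel (f k)" for k
    proof (rule integrable_continuous_bounded_support[OF fc])
      fix x :: 'a
      assume x: "norm x > R + norm ((2 * h k) *\<^sub>R v)"
      have "norm (h k *\<^sub>R v) \<le> norm ((2 * h k) *\<^sub>R v)" using hpos[of k] by simp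
      then have "norm (x + (2 * h k) *\<^sub>R v) > R" "norm (x + h k *\<^sub>R v) > R" "norm x > R"
        using x norm_triangle_ineq2[of x "-((2 * h k) *\<^sub>R v)"] norm_triangle_ineq2[of x "-(h k *\<^sub>R v)"]
          norm_ge_zero[of "(2 * h k) *\<^sub>R v"] unfolding norm_minus_cancel diff_minus_eq_add by linarith+
      then show "f k x = 0" by (simp add: f_def supp)
    qed
    have "(\<lambda>k. (\<integral>x. f k x \<partial>lborel) / (h k)\<^sup>2) \<longlonglongrightarrow> 0"
      unfolding f_def h_def by (rule integral_second_difference_tendsto[OF lip supp])
    then have "\<forall>\<^sub>F k in sequentially. (\<integral>x. f k x \<partial>lborel) / (h k)\<^sup>2 < \<epsilon>' * (\<epsilon>1/2)\<^sup>2"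
      by (rule order_tendstoD) (use that \<epsilon>1 in simp)
    then show ?thesis
    proof eventually_elim
      case (elim k)
      have fint': "integrable lborel (\<lambda>x. f k (x + h k *\<^sub>R (w - v)))"
      proof (rule integrable_continuous_bounded_support)
        show "continuous_on UNIV (\<lambda>x. f k (x + h k *\<^sub>R (w - v)))"
          by (intro continuous_on_compose2[OF fc] continuous_intros) auto
        fix x :: 'a
        assume x: "norm x > R + norm ((2 * h k) *\<^sub>R v) + norm (h k *\<^sub>R (w - v))"
        define x' where "x' = x + h k *\<^sub>R (w - v)"
        have x: "norm x' > R + norm ((2 * h k) *\<^sub>R v)"
          using x norm_triangle_ineq2[of x "-(h k *\<^sub>R (w - v))"]
          unfolding x'_def norm_minus_cancel diff_minus_eq_add by linarith
        have "norm (h k *\<^sub>R v) \<le> norm ((2 * h k) *\<^sub>R v)" using hpos[of k] by simp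
        then have "norm (x' + (2 * h k) *\<^sub>R v) > R" "norm (x' + h k *\<^sub>R v) > R" "norm x' > R"
          using x norm_triangle_ineq2[of x' "-((2 * h k) *\<^sub>R v)"] norm_triangle_ineq2[of x' "-(h k *\<^sub>R v)"]
            norm_ge_zero[of "(2 * h k) *\<^sub>R v"] unfolding norm_minus_cancel diff_minus_eq_add by linarith+
        then show "f k (x + h k *\<^sub>R (w - v)) = 0" by (simp add: f_def supp x'_def[symmetric])
      qed
      \<comment> \<open>Moving the base point by \<open>h k *\<^sub>R (w - v)\<close> turns the
        centred second difference at \<open>w\<close> into a forward one, so the bound on the
        measure does not depend on \<open>w\<close>.\<close>
      have S_eq: "S k v w = {x \<in> space lborel. (\<epsilon>1/2 * h k)\<^sup>2 \<le> f k (x + h k *\<^sub>R (w - v))}"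
      proof -
        have e: "x + h k *\<^sub>R (w - v) + (2 * h k) *\<^sub>R v = x + h k *\<^sub>R (w + v)"
          "x + h k *\<^sub>R (w - v) + h k *\<^sub>R v = x + h k *\<^sub>R w" for x
          by (simp_all add: algebra_simps mult_2 scaleR_add_left scaleR_2 flip: scaleR_scaleR)
        then show ?thesis
          using \<epsilon>1 hpos[of k] unfolding S_def f_def e by (auto simp: abs_le_square_iff[symmetric] abs_mult)
      qed
      have "emeasure lborel (S k v w) \<le> ennreal ((1 / (\<epsilon>1/2 * h k)\<^sup>2) * (\<integral>x. f k (x + h k *\<^sub>R (w - v)) \<partial>lborel))"
        unfolding S_eq
        by (rule integral_Markov_inequality) (use fint' \<epsilon>1 hpos[of k] in \<open>auto simp: f_def\<close>)
      also have "(\<integral>x. f k (x + h k *\<^sub>R (w - v)) \<partial>lborel) = (\<integral>x. f k x \<partial>lborel)"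
        by (rule integral_lborel_translation) (intro borel_measurable_continuous_onI fc)
      also have "(1 / (\<epsilon>1/2 * h k)\<^sup>2) * (\<integral>x. f k x \<partial>lborel) \<le> \<epsilon>'"
        using elim \<epsilon>1 hpos[of k] by (simp add: field_simps power_mult_distrib)
      finally show ?case by (meson ennreal_leI order_trans)
    qed
  qed
  define \<epsilon>' where "\<epsilon>' = \<epsilon> / (card (V \<times> V) + 1)"
  have "\<epsilon>' > 0" using \<epsilon> by (simp add: \<epsilon>'_def add_pos_nonneg)
  then have "\<forall>\<^sub>F k in sequentially. \<forall>p\<in>V \<times> V. emeasure lborel (S k (fst p) (snd p)) \<le> ennreal \<epsilon>'"
    using V(1) small by (intro eventually_ball_finite) auto
  then show ?thesis
  proof eventually_elim
    case (elim k)
    define E where "E = (\<Union>p\<in>V \<times> V. S k (fst p) (snd p))"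
    have "emeasure lborel E \<le> (\<Sum>p\<in>V \<times> V. emeasure lborel (S k (fst p) (snd p)))"
      unfolding E_def by (rule emeasure_subadditive_finite) (use V(1) Sm in auto)
    also have "\<dots> \<le> (\<Sum>p\<in>V \<times> V. ennreal \<epsilon>')"
      by (rule sum_mono) (use elim in auto)
    also have "\<dots> = ennreal (card (V \<times> V) * \<epsilon>')"
      using \<open>\<epsilon>' > 0\<close> by (simp add: ennreal_mult ennreal_of_nat_eq_real_of_nat)
    also have "card (V \<times> V) * \<epsilon>' \<le> \<epsilon>"
      using \<epsilon> by (simp add: \<epsilon>'_def field_simps)
    finally have E: "emeasure lborel E \<le> ennreal \<epsilon>" by (simp add: ennreal_leI)
    have "\<exists>q. norm q \<le> L + \<eta> \<and>
      (\<forall>y\<in>cball 0 1. \<bar>g (x + h k *\<^sub>R y) - g x - h k * (q \<bullet> y)\<bar> \<le> \<eta> * h k)" if x: "x \<notin> E" for x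
    proof -
      define G where "G y = (g (x + h k *\<^sub>R y) - g x) / h k" for y
      have Glip: "\<bar>G y - G z\<bar> \<le> L * norm (y - z)" for y z
        using lip[of "x + h k *\<^sub>R y" "x + h k *\<^sub>R z"] hpos[of k]
        by (simp add: G_def diff_divide_distrib[symmetric] pos_divide_le_eq mult_ac
            flip: scaleR_right_diff_distrib)
      have "\<exists>q. \<forall>y\<in>cball 0 1. \<bar>G y - q \<bullet> y\<bar> \<le> 4 * DIM('a) * \<epsilon>1"
      proof (rule approx_jensen_imp_approx_linear)
        show "G 0 = 0" by (simp add: G_def)
        show "continuous_on UNIV G"
          using L0 Glip
          by (intro lipschitz_on_continuous_on[of L] lipschitz_onI) (auto simp: dist_norm)
        fix v w :: 'a
        assume "norm v \<le> 1" "norm w \<le> 1"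
        then have "v \<in> (\<Union>v\<in>V. ball v r)" "w \<in> (\<Union>v\<in>V. ball v r)"
          using V(3) by (auto simp: subset_iff)
        then obtain v' w' where v': "v' \<in> V" "norm (v - v') \<le> r" and w': "w' \<in> V" "norm (w - w') \<le> r"
          by (auto simp: dist_norm norm_minus_commute intro: less_imp_le)
        have "x \<notin> S k v' w'" using x v' w' by (auto simp: E_def)
        then have 1: "\<bar>G (w' + v') - 2 * G w' + G (w' - v')\<bar> \<le> \<epsilon>1 / 2"
          using hpos[of k]
          by (simp add: S_def G_def not_le abs_divide pos_divide_le_eq flip: diff_divide_distrib add_divide_distrib)
            (simp add: field_simps)
        have n: "norm ((w + v) - (w' + v')) \<le> 2 * r" "norm ((w - v) - (w' - v')) \<le> 2 * r"
          using norm_triangle_ineq[of "w - w'" "v - v'"] norm_triangle_ineq4[of "w - w'" "v - v'"] v' w'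
          by (auto simp: algebra_simps)
        have "\<bar>G (w + v) - G (w' + v')\<bar> \<le> L * (2 * r)" "\<bar>G (w - v) - G (w' - v')\<bar> \<le> L * (2 * r)"
          "\<bar>G w - G w'\<bar> \<le> L * r"
          by (rule order_trans[OF Glip] mult_left_mono n w' L0)+
        then have "\<bar>G (w + v) - 2 * G w + G (w - v)\<bar> \<le> \<epsilon>1 / 2 + 6 * (L * r)"
          using 1 by linarith
        also have "6 * (L * r) \<le> \<epsilon>1 / 2"
          using L0 \<epsilon>1 by (simp add: r_def field_simps)
        finally show "\<bar>G (w + v) - 2 * G w + G (w - v)\<bar> \<le> \<epsilon>1" by simp
      qed
      then obtain q where q: "\<And>y. norm y \<le> 1 \<Longrightarrow> \<bar>G y - q \<bullet> y\<bar> \<le> \<eta>"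
        unfolding \<epsilon>1_def by fastforce
      have "norm q \<le> L + \<eta>"
      proof (cases "q = 0")
        case False
        have "\<bar>G (q /\<^sub>R norm q) - norm q\<bar> \<le> \<eta>"
          using q[of "q /\<^sub>R norm q"] False by (simp add: dot_square_norm power2_eq_square field_simps)
        moreover have "\<bar>G (q /\<^sub>R norm q)\<bar> \<le> L"
          using Glip[of "q /\<^sub>R norm q" 0] False by (simp add: G_def)
        ultimately show ?thesis by linarith
      qed (use L0 \<eta> in auto)
      moreover have "\<bar>g (x + h k *\<^sub>R y) - g x - h k * (q \<bullet> y)\<bar> \<le> \<eta> * h k" if "norm y \<le> 1" for y
      proof -
        have "g (x + h k *\<^sub>R y) - g x - h k * (q \<bullet> y) = h k * (G y - q \<bullet> y)"
          using hpos[of k] by (simp add: G_def field_simps)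
        also have "\<bar>\<dots>\<bar> \<le> h k * \<eta>"
          using q[OF that] hpos[of k] by (simp add: abs_mult)
        finally show ?thesis by (simp add: mult.commute)
      qed
      ultimately show ?thesis by auto
    qed
    moreover have "E \<in> sets lborel" unfolding E_def using V(1) Sm by (intro sets.finite_UN) auto
    ultimately show ?case using E unfolding h_def by blast
  qed
qed

section \<open>Functions squeezed between paraboloids at every point\<close>

definition C11 :: "real \<Rightarrow> ('a::euclidean_space \<Rightarrow> real) \<Rightarrow> ('a \<Rightarrow> 'a) \<Rightarrow> bool" where
  "C11 C w G \<longleftrightarrow> (\<forall>x y. \<bar>w y - w x - G x \<bullet> (y - x)\<bar> \<le> C * (norm (y - x))\<^sup>2)"

lemma C11D: "C11 C w G \<Longrightarrow> \<bar>w y - w x - G x \<bullet> (y - x)\<bar> \<le> C * (norm (y - x))\<^sup>2"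
  by (auto simp: C11_def)

lemma C11_nonneg:
  assumes "C11 C w (G :: 'a::euclidean_space \<Rightarrow> 'a)"
  shows "C \<ge> 0"
proof -
  obtain b :: 'a where "b \<in> Basis" using nonempty_Basis by blast
  then show ?thesis using C11D[OF assms, of b 0] by (auto intro: order_trans[OF abs_ge_zero])
qed

text \<open>The expansions at \<open>x\<close> and at \<open>y\<close> are compared at a third
  point, at distance \<open>d = norm (x - y)\<close> from \<open>y\<close> in the direction of the
  gradient difference. The three errors involve distances \<open>d\<close>, at most
  \<open>2 * d\<close>, and \<open>d\<close>; hence 1 + 4 + 1 = 6.\<close>

lemma C11_gradient_lipschitz:
  assumes "C11 C w G"
  shows "norm (G x - G y) \<le> 6 * C * norm (x - y)"
proof (cases "G x = G y")
  case True
  then show ?thesis using C11_nonneg[OF assms] by simp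
next
  case False
  define d where "d = norm (x - y)"
  define n where "n = (G y - G x) /\<^sub>R norm (G y - G x)"
  define h where "h = d *\<^sub>R n"
  have nn: "norm n = 1" using False by (simp add: n_def)
  have nh: "norm h = d" by (simp add: h_def nn d_def)
  have C: "C \<ge> 0" by (rule C11_nonneg[OF assms])
  have d: "d > 0" using False by (auto simp: d_def)
  have "norm (y + h - x) \<le> 2 * d"
    using norm_triangle_ineq[of "y - x" h] by (simp add: nh d_def norm_minus_commute algebra_simps)
  then have "(norm (y + h - x))\<^sup>2 \<le> (2 * d)\<^sup>2" by (rule power_mono) simp
  then have s: "C * (norm (y + h - x))\<^sup>2 \<le> C * (2 * d)\<^sup>2" by (rule mult_left_mono) (rule C)
  have "(G y - G x) \<bullet> h = norm (G y - G x) * d"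
    using False by (simp add: h_def n_def dot_square_norm power2_eq_square)
  moreover have "(G y - G x) \<bullet> h \<le> C * d\<^sup>2 + C * (norm (y + h - x))\<^sup>2 + C * d\<^sup>2"
    using C11D[OF assms, of "y + h" y] C11D[OF assms, of "y + h" x] C11D[OF assms, of y x]
    by (simp add: nh d_def norm_minus_commute inner_diff_left inner_diff_right inner_add_right abs_le_iff)
  ultimately have "norm (G y - G x) * d \<le> (6 * C * d) * d"
    using s by (simp add: power2_eq_square)
  then show ?thesis using d by (simp add: d_def norm_minus_commute)
qed

lemma C11_has_derivative:
  assumes "C11 C w G"
  shows "(w has_derivative (\<lambda>h. G x \<bullet> h)) (at x)"
  unfolding has_derivative_iff_norm
proof
  show "bounded_linear (\<lambda>h. G x \<bullet> h)" by (rule bounded_linear_inner_right)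
  have C: "C \<ge> 0" by (rule C11_nonneg[OF assms])
  have "((\<lambda>y. C * norm (y - x)) \<longlongrightarrow> C * norm (x - x)) (at x)"
    by (intro tendsto_intros)
  then have lim: "((\<lambda>y. C * norm (y - x)) \<longlongrightarrow> 0) (at x)" by simp
  have "norm (w y - w x - G x \<bullet> (y - x)) / norm (y - x) \<le> C * norm (y - x)" if "y \<noteq> x" for y
    using C11D[OF assms, of y x] that
    by (simp add: divide_le_eq power2_eq_square mult.assoc)
  then show "((\<lambda>y. norm (w y - w x - G x \<bullet> (y - x)) / norm (y - x)) \<longlongrightarrow> 0) (at x)"
    by (intro Lim_null_comparison[OF _ lim]) (auto simp: eventually_at_filter)
qed

lemma C11_add:
  assumes "C11 C w G" "C11 C' w' G'"
  shows "C11 (C + C') (\<lambda>x. w x + w' x) (\<lambda>x. G x + G' x)"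
  unfolding C11_def
proof (intro allI)
  fix x y
  show "\<bar>w y + w' y - (w x + w' x) - (G x + G' x) \<bullet> (y - x)\<bar> \<le> (C + C') * (norm (y - x))\<^sup>2"
    using C11D[OF assms(1), of y x] C11D[OF assms(2), of y x]
    by (simp add: inner_add_left distrib_right abs_le_iff)
qed

definition selfadjoint :: "('a::real_inner \<Rightarrow> 'a) \<Rightarrow> bool" where
  "selfadjoint T \<longleftrightarrow> linear T \<and> (\<forall>x y. x \<bullet> T y = T x \<bullet> y)"

text \<open>A weak quantitative substitute for Alexandrov's theorem: the expansion holds at a single small
  scale instead of infinitesimally, which suffices to touch by quadratics.\<close>

lemma C11_second_order_expansion:
  fixes w :: "'a::euclidean_space \<Rightarrow> real"
  assumes C11: "C11 C w G" and \<eta>: "\<eta> > 0" and \<epsilon>: "\<epsilon> > 0"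
  shows "\<exists>B\<ge>0. \<forall>\<^sub>F k in sequentially. \<exists>E\<in>sets lborel. emeasure lborel E \<le> ennreal \<epsilon> \<and>
    (\<forall>x\<in>cball 0 1 - E. \<exists>H. selfadjoint H \<and> (\<forall>h. norm (H h) \<le> B * norm h) \<and>
      (\<forall>h. norm h \<le> (1/2)^k \<longrightarrow>
        \<bar>w (x + h) - w x - G x \<bullet> h - (h \<bullet> H h) / 2\<bar> \<le> \<eta> * ((1/2)^k)\<^sup>2))"
proof -
  define n where "n = DIM('a)"
  have n: "n > 0" by (simp add: n_def)
  \<comment> \<open>A Lipschitz cutoff, equal to 1 on the ball of radius 2 and to 0 beyond radius 3.
    It gives the components of \<open>G\<close> the bounded support that the dyadic energy argument
    requires, and leaves them unchanged at \<open>x + t *\<^sub>R h\<close> for \<open>x\<close> in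
    the unit ball and \<open>h\<close> of length at most 1.\<close>
  define \<theta> where "\<theta> x = max 0 (min 1 (3 - norm x))" for x :: 'a
  have \<theta>: "0 \<le> \<theta> x" "\<theta> x \<le> 1" for x by (auto simp: \<theta>_def)
  have \<theta>lip: "\<bar>\<theta> x - \<theta> y\<bar> \<le> norm (x - y)" for x y
    using norm_triangle_ineq2[of x y] norm_triangle_ineq2[of y x]
    by (auto simp: \<theta>_def max_def min_def norm_minus_commute)
  have C: "C \<ge> 0" by (rule C11_nonneg[OF C11])
  define M where "M = norm (G 0) + 18 * C"
  define L where "L = 6 * C + M"
  have GM: "norm (G x) \<le> M" if "norm x \<le> 3" for x
  proof -
    have "norm (G x) \<le> norm (G 0) + norm (G x - G 0)" by (metis add.commute norm_triangle_sub)
    also have "norm (G x - G 0) \<le> 6 * C * norm x"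
      using C11_gradient_lipschitz[OF C11, of x 0] by simp
    also have "\<dots> \<le> 6 * C * 3" using C that by (intro mult_left_mono) auto
    finally show ?thesis by (simp add: M_def)
  qed
  define g where "g i x = \<theta> x * (G x \<bullet> i)" for i x
  have glip1: "\<bar>g i x - g i y\<bar> \<le> L * norm (x - y)" if i: "i \<in> Basis" and y: "norm y \<le> 3" for i x y
  proof -
    have "g i x - g i y = \<theta> x * ((G x - G y) \<bullet> i) + (\<theta> x - \<theta> y) * (G y \<bullet> i)"
      by (simp add: g_def algebra_simps)
    also have "\<bar>\<dots>\<bar> \<le> \<theta> x * \<bar>(G x - G y) \<bullet> i\<bar> + \<bar>\<theta> x - \<theta> y\<bar> * \<bar>G y \<bullet> i\<bar>"
      using \<theta>(1)[of x] by (intro order_trans[OF abs_triangle_ineq]) (simp add: abs_mult)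
    also have "\<dots> \<le> 1 * (6 * C * norm (x - y)) + norm (x - y) * M"
      using \<theta>[of x] \<theta>lip[of x y] Basis_le_norm[OF i] GM[OF y] C11_gradient_lipschitz[OF C11, of x y]
      by (intro add_mono mult_mono) (auto intro: order_trans)
    finally show ?thesis by (simp add: L_def algebra_simps)
  qed
  have far: "g i x = 0" if "norm x > 3" for i x
    using that by (simp add: g_def \<theta>_def)
  have glip: "\<bar>g i x - g i y\<bar> \<le> L * norm (x - y)" if i: "i \<in> Basis" for i x y
  proof (cases "norm y \<le> 3")
    case True
    then show ?thesis by (rule glip1[OF i])
  next
    case False
    show ?thesis
    proof (cases "norm x \<le> 3")
      case True
      then show ?thesis using glip1[OF i True, of y] by (simp add: abs_minus_commute norm_minus_commute)
    next
      case False
      have "L \<ge> 0" using C by (simp add: L_def M_def)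
      then show ?thesis using False \<open>\<not> norm y \<le> 3\<close> by (simp add: far)
    qed
  qed
  define \<eta>' where "\<eta>' = \<eta> / n"
  define \<epsilon>' where "\<epsilon>' = \<epsilon> / n"
  have pos: "\<eta>' > 0" "\<epsilon>' > 0" using \<eta> \<epsilon> n by (auto simp: \<eta>'_def \<epsilon>'_def)
  define B where "B = n * (L + \<eta>')"
  have L0: "L \<ge> 0" using C by (simp add: L_def M_def)
  then have B0: "B \<ge> 0" using pos by (simp add: B_def)
  define P where "P k i E \<longleftrightarrow> E \<in> sets lborel \<and> emeasure lborel E \<le> ennreal \<epsilon>' \<and>
    (\<forall>x. x \<notin> E \<longrightarrow> (\<exists>q. norm q \<le> L + \<eta>' \<and>
      (\<forall>y\<in>cball 0 1. \<bar>g i (x + (1/2)^k *\<^sub>R y) - g i x - (1/2)^k * (q \<bullet> y)\<bar> \<le> \<eta>' * (1/2)^k)))" for k i E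
  have "\<forall>\<^sub>F k in sequentially. \<forall>i\<in>Basis. \<exists>E. P k i E"
    using lipschitz_affine_at_dyadic_scales[OF glip far pos]
    by (intro eventually_ball_finite) (auto simp: P_def Bex_def)
  then have "\<forall>\<^sub>F k in sequentially. \<exists>E\<in>sets lborel. emeasure lborel E \<le> ennreal \<epsilon> \<and>
    (\<forall>x\<in>cball 0 1 - E. \<exists>H. selfadjoint H \<and> (\<forall>h. norm (H h) \<le> B * norm h) \<and>
      (\<forall>h. norm h \<le> (1/2)^k \<longrightarrow>
        \<bar>w (x + h) - w x - G x \<bullet> h - (h \<bullet> H h) / 2\<bar> \<le> \<eta> * ((1/2)^k)\<^sup>2))"
  proof eventually_elim
    case (elim k)
    define \<rho> :: real where "\<rho> = (1/2)^k"
    have \<rho>: "\<rho> > 0" "\<rho> \<le> 1" by (auto simp: \<rho>_def power_le_one)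
    from elim obtain E where E: "\<And>i. i \<in> Basis \<Longrightarrow> P k i (E i)" by metis
    define E' where "E' = (\<Union>i\<in>Basis. E i)"
    have "emeasure lborel E' \<le> (\<Sum>i\<in>Basis. emeasure lborel (E i))"
      unfolding E'_def by (rule emeasure_subadditive_finite) (use E in \<open>auto simp: P_def\<close>)
    also have "\<dots> \<le> (\<Sum>i\<in>(Basis::'a set). ennreal \<epsilon>')"
      by (rule sum_mono) (use E in \<open>auto simp: P_def\<close>)
    also have "\<dots> = ennreal (n * \<epsilon>')"
      using pos by (simp add: n_def ennreal_mult ennreal_of_nat_eq_real_of_nat)
    also have "n * \<epsilon>' = \<epsilon>" using n by (simp add: \<epsilon>'_def)
    finally have Em: "emeasure lborel E' \<le> ennreal \<epsilon>" .
    have Es: "E' \<in> sets lborel" unfolding E'_def using E by (intro sets.finite_UN) (auto simp: P_def)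
    have "\<exists>H. selfadjoint H \<and> (\<forall>h. norm (H h) \<le> B * norm h) \<and>
      (\<forall>h. norm h \<le> \<rho> \<longrightarrow> \<bar>w (x + h) - w x - G x \<bullet> h - (h \<bullet> H h) / 2\<bar> \<le> \<eta> * \<rho>\<^sup>2)"
      if x: "x \<in> cball 0 1 - E'" for x
    proof -
      have "\<forall>i\<in>Basis. \<exists>q. norm q \<le> L + \<eta>' \<and>
        (\<forall>y\<in>cball 0 1. \<bar>g i (x + \<rho> *\<^sub>R y) - g i x - \<rho> * (q \<bullet> y)\<bar> \<le> \<eta>' * \<rho>)"
        using E x by (auto simp: P_def E'_def \<rho>_def)
      then obtain q where q: "\<And>i. i \<in> Basis \<Longrightarrow> norm (q i) \<le> L + \<eta>'"
        "\<And>i y. i \<in> Basis \<Longrightarrow> norm y \<le> 1 \<Longrightarrow> \<bar>g i (x + \<rho> *\<^sub>R y) - g i x - \<rho> * (q i \<bullet> y)\<bar> \<le> \<eta>' * \<rho>"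
        by (metis mem_cball_0)
      \<comment> \<open>The \<open>q i\<close> are the rows of an approximate derivative of
        \<open>G\<close>. At a single scale this matrix need not be symmetric, but only its
        quadratic form enters the expansion of \<open>w\<close>, so it may be symmetrised.\<close>
      define H where "H h = (1/2) *\<^sub>R (\<Sum>i\<in>Basis. (q i \<bullet> h) *\<^sub>R i + (h \<bullet> i) *\<^sub>R q i)" for h
      have "linear H"
        unfolding H_def by (intro linearI)
          (simp_all add: inner_add inner_scaleR_left scaleR_add_left scaleR_add_right sum.distrib
             scaleR_sum_right algebra_simps)
      moreover have "a \<bullet> H b = H a \<bullet> b" for a b
        by (simp add: H_def inner_sum_left inner_sum_right inner_add inner_commute mult.commute add.commute)
      ultimately have sa: "selfadjoint H" by (simp add: selfadjoint_def)
      have bd: "norm (H h) \<le> B * norm h" for h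
      proof -
        have "norm (H h) \<le> (1/2) * (\<Sum>i\<in>(Basis::'a set). 2 * (L + \<eta>') * norm h)"
          unfolding H_def norm_scaleR
        proof (intro mult_mono sum_norm_le)
          fix i :: 'a assume i: "i \<in> Basis"
          have "norm ((q i \<bullet> h) *\<^sub>R i + (h \<bullet> i) *\<^sub>R q i) \<le> \<bar>q i \<bullet> h\<bar> + \<bar>h \<bullet> i\<bar> * norm (q i)"
            using norm_triangle_ineq[of "(q i \<bullet> h) *\<^sub>R i" "(h \<bullet> i) *\<^sub>R q i"] i by simp
          also have "\<dots> \<le> norm (q i) * norm h + norm h * norm (q i)"
            using Cauchy_Schwarz_ineq2[of "q i" h] Basis_le_norm[OF i, of h]
            by (intro add_mono mult_right_mono) auto
          also have "\<dots> = 2 * norm (q i) * norm h" by simp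
          also have "\<dots> \<le> 2 * (L + \<eta>') * norm h"
            using q(1)[OF i] by (intro mult_right_mono) auto
          finally show "norm ((q i \<bullet> h) *\<^sub>R i + (h \<bullet> i) *\<^sub>R q i) \<le> 2 * (L + \<eta>') * norm h" .
        qed auto
        then show ?thesis by (simp add: B_def n_def algebra_simps)
      qed
      have Hh: "h \<bullet> H h = (\<Sum>i\<in>Basis. (h \<bullet> i) * (q i \<bullet> h))" for h
        by (simp add: H_def inner_sum_right inner_add_right inner_commute mult.commute
            sum.distrib[symmetric] flip: sum_distrib_left)
      have "\<bar>w (x + h) - w x - G x \<bullet> h - (h \<bullet> H h) / 2\<bar> \<le> \<eta> * \<rho>\<^sup>2" if h: "norm h \<le> \<rho>" for h
      proof -
        define F where "F t = w (x + t *\<^sub>R h) - t * (G x \<bullet> h) - t\<^sup>2 / 2 * (h \<bullet> H h)" for t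
        have F': "(F has_real_derivative (G (x + t *\<^sub>R h) \<bullet> h - G x \<bullet> h - t * (h \<bullet> H h))) (at t)" for t
        proof -
          have "((\<lambda>t. w (x + t *\<^sub>R h)) has_derivative (\<lambda>s. G (x + t *\<^sub>R h) \<bullet> (s *\<^sub>R h))) (at t)"
            by (rule has_derivative_compose[where f = "\<lambda>t. x + t *\<^sub>R h" and g = w, OF _ C11_has_derivative[OF C11]])
               (auto intro!: derivative_eq_intros)
          then have "((\<lambda>t. w (x + t *\<^sub>R h)) has_real_derivative (G (x + t *\<^sub>R h) \<bullet> h)) (at t)"
            by (simp add: has_field_derivative_def mult_commute_abs)
          then show ?thesis unfolding F_def by (auto intro!: derivative_eq_intros)
        qed
        have "\<exists>t. 0 < t \<and> t < 1 \<and> F 1 - F 0 = (1 - 0) * (G (x + t *\<^sub>R h) \<bullet> h - G x \<bullet> h - t * (h \<bullet> H h))"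
          by (rule MVT2) (use F' in auto)
        then obtain t where t: "0 < t" "t < 1"
          "F 1 - F 0 = G (x + t *\<^sub>R h) \<bullet> h - G x \<bullet> h - t * (h \<bullet> H h)" by auto
        define y where "y = (t / \<rho>) *\<^sub>R h"
        have y: "norm y \<le> 1" "\<rho> *\<^sub>R y = t *\<^sub>R h"
        proof -
          have "t * norm h \<le> 1 * \<rho>" using t h by (intro mult_mono) auto
          then show "norm y \<le> 1" using t \<rho> by (simp add: y_def)
        qed (use \<rho> in \<open>simp add: y_def\<close>)
        have nx: "norm x \<le> 1" using x by simp
        moreover have "norm (t *\<^sub>R h) \<le> 1"
          using y \<rho> by (metis abs_of_pos mult_le_one norm_ge_zero norm_scaleR)
        ultimately have "norm (x + t *\<^sub>R h) \<le> 2"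
          using norm_triangle_ineq[of x "t *\<^sub>R h"] by linarith
        then have \<theta>1: "\<theta> (x + t *\<^sub>R h) = 1" "\<theta> x = 1" using nx by (auto simp: \<theta>_def)
        have "F 1 - F 0 = (\<Sum>i\<in>Basis. (h \<bullet> i) * (g i (x + \<rho> *\<^sub>R y) - g i x - \<rho> * (q i \<bullet> y)))"
        proof -
          have "G z \<bullet> h = (\<Sum>i\<in>Basis. (h \<bullet> i) * (G z \<bullet> i))" for z
            by (subst euclidean_inner) (simp add: mult.commute)
          moreover have "\<rho> * (q i \<bullet> y) = t * (q i \<bullet> h)" for i
            using y(2) by (metis inner_scaleR_right)
          ultimately show ?thesis
            unfolding t(3) Hh
            by (simp add: g_def y(2) \<theta>1 right_diff_distrib sum_subtractf sum_distrib_left mult_ac)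
        qed
        also have "\<bar>\<dots>\<bar> \<le> (\<Sum>i\<in>(Basis::'a set). \<rho> * (\<eta>' * \<rho>))"
        proof (rule order_trans[OF sum_abs], rule sum_mono)
          fix i :: 'a assume i: "i \<in> Basis"
          show "\<bar>(h \<bullet> i) * (g i (x + \<rho> *\<^sub>R y) - g i x - \<rho> * (q i \<bullet> y))\<bar> \<le> \<rho> * (\<eta>' * \<rho>)"
            unfolding abs_mult using q(2)[OF i y(1)] Basis_le_norm[OF i, of h] h \<rho>
            by (intro mult_mono) auto
        qed
        also have "\<dots> = \<eta> * \<rho>\<^sup>2" using n by (simp add: \<eta>'_def n_def power2_eq_square)
        finally show ?thesis by (simp add: F_def)
      qed
      with sa bd show ?thesis by blast
    qed
    with Es Em show ?case unfolding \<rho>_def by blast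
  qed
  with B0 show ?thesis by blast
qed

section \<open>Contact sets of semiconvex functions\<close>

lemma C11_upper_linear_gradient:
  assumes "C11 C w G" "\<And>y. w y \<le> w x + p \<bullet> (y - x)"
  shows "G x = p"
proof (rule ccontr)
  assume neq: "G x \<noteq> p"
  define d where "d = G x - p"
  define t where "t = 1 / (C + 1)"
  have C: "C \<ge> 0" by (rule C11_nonneg[OF assms(1)])
  have t: "t > 0" "C * t < 1" using C by (auto simp: t_def)
  have "G x \<bullet> (t *\<^sub>R d) - p \<bullet> (t *\<^sub>R d) \<le> C * (norm (t *\<^sub>R d))\<^sup>2"
    using C11D[OF assms(1), of "x + t *\<^sub>R d" x] assms(2)[of "x + t *\<^sub>R d"] by simp
  moreover have "G x \<bullet> (t *\<^sub>R d) - p \<bullet> (t *\<^sub>R d) = t * (norm d)\<^sup>2"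
    by (simp add: power2_norm_eq_inner d_def inner_diff_left algebra_simps)
  ultimately have "t * (norm d)\<^sup>2 \<le> (C * t) * (t * (norm d)\<^sup>2)"
    by (simp add: power_mult_distrib power2_eq_square mult_ac)
  moreover have "t * (norm d)\<^sup>2 > 0" using t neq by (simp add: d_def)
  ultimately show False using t by (simp add: mult_le_cancel_right1 not_le[symmetric])
qed

lemma C11_gradient_continuous:
  assumes "C11 C w G"
  shows "continuous_on S G"
  using C11_nonneg[OF assms] C11_gradient_lipschitz[OF assms]
  by (intro lipschitz_on_continuous_on[of "6 * C"] lipschitz_onI) (auto simp: dist_norm)

lemma C11_continuous: "C11 C w G \<Longrightarrow> continuous_on S w"
  by (meson C11_has_derivative continuous_at_imp_continuous_on has_derivative_continuous)

text \<open>Jensen's lemma. For each slope \<open>p\<close> with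
  \<open>norm p \<le> \<delta>\<close> the function \<open>w y - p \<bullet> y\<close> attains its
  maximum, in the ball of radius \<open>2 * \<delta> / \<kappa>\<close> because beyond it the decay
  of \<open>w\<close> outweighs the slope. So \<open>G\<close> maps \<open>K\<close> onto a ball,
  and as a Lipschitz map it cannot do this from a null set.\<close>

lemma contact_set_not_negligible:
  fixes w :: "'a::euclidean_space \<Rightarrow> real"
  assumes C11: "C11 C w G" and \<kappa>: "\<kappa> > 0" and \<delta>: "\<delta> > 0"
    and max0: "\<And>z. w z \<le> w 0 - \<kappa> / 2 * (norm z)\<^sup>2"
  defines "K \<equiv> {z \<in> cball 0 (2 * \<delta> / \<kappa>). norm (G z) \<le> \<delta> \<and> (\<forall>z'. w z' \<le> w z + G z \<bullet> (z' - z))}"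
  shows "compact K" "\<not> negligible K"
proof -
  have K_eq: "K = cball 0 (2 * \<delta> / \<kappa>) \<inter> {z. norm (G z) \<le> \<delta>} \<inter> (\<Inter>z'. {z. w z' \<le> w z + G z \<bullet> (z' - z)})"
    by (auto simp: K_def)
  show "compact K"
    unfolding K_eq
    by (intro compact_Int_closed closed_Collect_le closed_INT ballI compact_cball continuous_intros
        C11_continuous[OF C11] C11_gradient_continuous[OF C11])
  have "cball 0 \<delta> \<subseteq> G ` K"
  proof
    fix p :: 'a assume p: "p \<in> cball 0 \<delta>"
    define B where "B = cball (0::'a) (2 * \<delta> / \<kappa>)"
    have B0: "0 \<in> B" using \<kappa> \<delta> by (simp add: B_def)
    have "\<exists>z\<in>B. \<forall>y\<in>B. w y - p \<bullet> y \<le> w z - p \<bullet> z"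
      using B0 by (intro continuous_attains_sup continuous_intros C11_continuous[OF C11]) (auto simp: B_def)
    then obtain z where z: "z \<in> B" "\<And>y. y \<in> B \<Longrightarrow> w y - p \<bullet> y \<le> w z - p \<bullet> z" by blast
    have glob: "w y - p \<bullet> y \<le> w z - p \<bullet> z" for y
    proof (cases "y \<in> B")
      case False
      have "- (p \<bullet> y) \<le> norm p * norm y" using norm_cauchy_schwarz[of "-p" y] by simp
      also have "\<dots> \<le> \<delta> * norm y" using p by (intro mult_right_mono) auto
      finally have "w y - p \<bullet> y \<le> w 0 - norm y * (\<kappa> / 2 * norm y - \<delta>)"
        using max0[of y] by (simp add: algebra_simps power2_eq_square)
      moreover have "\<kappa> / 2 * norm y - \<delta> \<ge> 0" using False \<kappa> by (simp add: B_def field_simps)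
      ultimately have "w y - p \<bullet> y \<le> w 0" by (smt (verit) mult_nonneg_nonneg norm_ge_zero)
      then show ?thesis using z(2)[OF B0] by simp
    qed (use z in auto)
    then have up: "w y \<le> w z + p \<bullet> (y - z)" for y
      using glob[of y] unfolding inner_diff_right by linarith
    then have "G z = p" by (rule C11_upper_linear_gradient[OF C11])
    moreover have "z \<in> K" using up z(1) \<open>G z = p\<close> p by (auto simp: K_def B_def)
    ultimately show "p \<in> G ` K" by blast
  qed
  moreover have "negligible (G ` K)" if "negligible K"
  proof (rule negligible_locally_Lipschitz_image[OF _ that])
    fix x assume "x \<in> K"
    show "\<exists>T B. open T \<and> x \<in> T \<and> (\<forall>y\<in>K \<inter> T. norm (G y - G x) \<le> B * norm (y - x))"
      using C11_gradient_lipschitz[OF C11] by (intro exI[of _ UNIV] exI[of _ "6 * C"]) auto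
  qed simp
  moreover have "\<not> negligible (cball (0::'a) \<delta>)"
    using \<delta> by (metis ball_subset_cball centre_in_ball empty_iff negligible_subset open_ball open_not_negligible)
  ultimately show "\<not> negligible K" using negligible_subset by blast
qed

text \<open>The contact set has positive measure, and the set where the expansion fails is allowed
  at most half of it, so some contact point has an expansion. The bound \<open>B\<close> on the
  operators is available before the scale is chosen; a scale below \<open>\<delta> / (B + 1)\<close>
  therefore makes \<open>H h\<close> as small as \<delta>.\<close>

lemma C11_jensen_point:
  fixes w :: "'a::euclidean_space \<Rightarrow> real"
  assumes C11: "C11 C w G" and \<kappa>: "\<kappa> > 0" and \<delta>: "\<delta> > 0" and \<eta>: "\<eta> > 0"
    and max0: "\<And>z. w z \<le> w 0 - \<kappa> / 2 * (norm z)\<^sup>2"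
  shows "\<exists>z \<rho> H. norm z \<le> \<delta> \<and> norm (G z) \<le> \<delta> \<and> (\<forall>z'. w z' \<le> w z + G z \<bullet> (z' - z)) \<and>
    0 < \<rho> \<and> \<rho> \<le> \<delta> \<and> selfadjoint H \<and> (\<forall>h. norm h \<le> \<rho> \<longrightarrow> norm (H h) \<le> \<delta>) \<and>
    (\<forall>h. norm h \<le> \<rho> \<longrightarrow> \<bar>w (z + h) - w z - G z \<bullet> h - (h \<bullet> H h) / 2\<bar> \<le> \<eta> * \<rho>\<^sup>2)"
proof -
  \<comment> \<open>Shrinking \<delta> brings the contact set into the unit ball, where the
    expansion is available, and into the ball of radius \<delta>.\<close>
  define \<delta>' where "\<delta>' = min \<delta> (min 1 \<delta> * \<kappa> / 2)"
  have \<delta>': "\<delta>' > 0" "\<delta>' \<le> \<delta>" "2 * \<delta>' / \<kappa> \<le> \<delta>" "2 * \<delta>' / \<kappa> \<le> 1"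
    using \<delta> \<kappa> by (auto simp: \<delta>'_def min_def field_simps)
  define K where "K = {z \<in> cball 0 (2 * \<delta>' / \<kappa>). norm (G z) \<le> \<delta>' \<and> (\<forall>z'. w z' \<le> w z + G z \<bullet> (z' - z))}"
  have K: "compact K" "\<not> negligible K"
    unfolding K_def by (rule contact_set_not_negligible[OF C11 \<kappa> \<delta>'(1) max0])+
  have Kb: "K \<in> sets lborel" using K(1) by (simp add: borel_compact)
  have Kfin: "emeasure lborel K < \<infinity>" using K(1) by (rule emeasure_compact_finite)
  have Kpos: "emeasure lborel K \<noteq> 0"
    using K(2) Kb by (auto simp: negligible_iff_null_sets null_sets_def)
  define \<epsilon> where "\<epsilon> = measure lborel K / 2"
  have eK: "emeasure lborel K = ennreal (measure lborel K)"
    using Kfin by (intro emeasure_eq_ennreal_measure) auto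
  then have mK: "measure lborel K > 0"
    using Kpos by (metis ennreal_0 measure_nonneg order_le_less)
  then have \<epsilon>: "\<epsilon> > 0" by (simp add: \<epsilon>_def)
  have lt: "ennreal \<epsilon> < emeasure lborel K"
    unfolding eK \<epsilon>_def using mK by (intro ennreal_lessI) auto
  define Q where "Q B k x \<longleftrightarrow> (\<exists>H. selfadjoint H \<and> (\<forall>h. norm (H h) \<le> B * norm h) \<and>
      (\<forall>h. norm h \<le> (1/2)^k \<longrightarrow>
        \<bar>w (x + h) - w x - G x \<bullet> h - (h \<bullet> H h) / 2\<bar> \<le> \<eta> * ((1/2)^k)\<^sup>2))" for B k x
  obtain B where B: "B \<ge> 0" and ev: "\<forall>\<^sub>F k in sequentially. \<exists>E\<in>sets lborel.
      emeasure lborel E \<le> ennreal \<epsilon> \<and> (\<forall>x\<in>cball 0 1 - E. Q B k x)"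
    using C11_second_order_expansion[OF C11 \<eta> \<epsilon>] unfolding Q_def by (elim exE conjE)
  have "(\<lambda>k. (1/2::real)^k) \<longlonglongrightarrow> 0" by (rule LIMSEQ_realpow_zero) auto
  then have "\<forall>\<^sub>F k in sequentially. (1/2::real)^k < \<delta> / (B + 1)"
    by (rule order_tendstoD) (use \<delta> B in simp)
  from eventually_happens'[OF sequentially_bot eventually_conj[OF this ev]]
  obtain k E where kE: "(1/2::real)^k < \<delta> / (B + 1)" "E \<in> sets lborel" "emeasure lborel E \<le> ennreal \<epsilon>"
    "\<And>x. x \<in> cball 0 1 - E \<Longrightarrow> Q B k x" by blast
  have "\<not> K \<subseteq> E"
    using emeasure_mono[of K E lborel] kE(2,3) lt by auto
  then obtain z where z: "z \<in> K" "z \<notin> E" by blast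
  then have "z \<in> cball 0 1 - E" using \<delta>'(4) by (auto simp: K_def)
  from kE(4)[OF this] obtain H where H: "selfadjoint H" "\<And>h. norm (H h) \<le> B * norm h"
    "\<And>h. norm h \<le> (1/2)^k \<Longrightarrow> \<bar>w (z + h) - w z - G z \<bullet> h - (h \<bullet> H h) / 2\<bar> \<le> \<eta> * ((1/2)^k)\<^sup>2"
    unfolding Q_def by (elim exE conjE) blast
  have kd: "(1/2::real)^k * (B + 1) < \<delta>" using kE(1) B by (simp add: field_simps)
  have k0: "(1/2::real)^k > 0" by simp
  have kB: "B * (1/2)^k \<ge> 0" using B by simp
  have "norm (H h) \<le> \<delta>" if "norm h \<le> (1/2)^k" for h
  proof -
    have "norm (H h) \<le> B * (1/2)^k"
      using order_trans[OF H(2) mult_left_mono[OF that B]] .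
    then show ?thesis using kd k0 unfolding distrib_left mult_1_right by (smt (verit) mult.commute)
  qed
  moreover have "(1/2::real)^k \<le> \<delta>" using kd kB by (simp add: algebra_simps)
  ultimately show ?thesis
    using z(1) \<delta>' H(1,3) k0 unfolding K_def
    by (intro exI[of _ z] exI[of _ "(1/2)^k"] exI[of _ H]) auto
qed

section \<open>Maxima of semicontinuous functions and two-sided bounds from semiconvexity\<close>

lemma usc_attains_max:
  fixes u :: "'a::metric_space \<Rightarrow> real"
  assumes "compact C" "C \<noteq> {}"
    and usc: "\<And>x e. x \<in> C \<Longrightarrow> e > 0 \<Longrightarrow> \<forall>\<^sub>F y in at x within C. u y < u x + e"
  shows "\<exists>x\<in>C. \<forall>y\<in>C. u y \<le> u x"
proof (rule ccontr)
  assume "\<not> ?thesis"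
  then obtain Y where Y: "\<And>x. x \<in> C \<Longrightarrow> Y x \<in> C \<and> u (Y x) > u x" by (metis not_le)
  have "\<exists>T. open T \<and> x \<in> T \<and> (\<forall>z\<in>T \<inter> C. u z < u (Y x))" if x: "x \<in> C" for x
  proof -
    have "\<forall>\<^sub>F y in at x within C. u y < u x + (u (Y x) - u x)"
      by (rule usc) (use x Y in auto)
    then obtain T where "open T" "x \<in> T" "\<forall>y\<in>T. y \<noteq> x \<longrightarrow> y \<in> C \<longrightarrow> u y < u (Y x)"
      unfolding eventually_at_topological by auto
    then show ?thesis using Y[OF x] by (intro exI[of _ T]) auto
  qed
  then obtain T where T: "\<And>x. x \<in> C \<Longrightarrow> open (T x) \<and> x \<in> T x \<and> (\<forall>z\<in>T x \<inter> C. u z < u (Y x))" by metis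
  then have "C \<subseteq> (\<Union>x\<in>C. T x)" by auto
  then obtain D where D: "D \<subseteq> C" "finite D" "C \<subseteq> (\<Union>x\<in>D. T x)"
    using compactE_image[OF assms(1), of C T] T by auto
  have "D \<noteq> {}" using D(3) assms(2) by auto
  define m where "m = Max ((\<lambda>x. u (Y x)) ` D)"
  have "m \<in> (\<lambda>x. u (Y x)) ` D" unfolding m_def using D(2) \<open>D \<noteq> {}\<close> by (intro Max_in) auto
  then obtain x where x: "x \<in> D" "m = u (Y x)" by auto
  have "Y x \<in> C" using x D(1) Y by auto
  then obtain x' where "x' \<in> D" "Y x \<in> T x'" using D(3) by auto
  then have "u (Y x) < u (Y x')" using T[of x'] D(1) \<open>Y x \<in> C\<close> by auto
  also have "u (Y x') \<le> m" unfolding m_def using D(2) \<open>x' \<in> D\<close> by (intro Max_ge) auto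
  finally show False using x by simp
qed

lemma convex_on_norm_square:
  fixes a b :: "'a::real_inner"
  assumes "0 \<le> t" "t \<le> 1"
  shows "(norm ((1 - t) *\<^sub>R a + t *\<^sub>R b))\<^sup>2 \<le> (1 - t) * (norm a)\<^sup>2 + t * (norm b)\<^sup>2"
proof -
  have "(1 - t) * (norm a)\<^sup>2 + t * (norm b)\<^sup>2 - (norm ((1 - t) *\<^sub>R a + t *\<^sub>R b))\<^sup>2
      = t * (1 - t) * (norm (a - b))\<^sup>2"
    unfolding power2_norm_eq_inner by (simp add: inner_commute algebra_simps)
  also have "\<dots> \<ge> 0" using assms by simp
  finally show ?thesis by simp
qed

text \<open>Only the lower bound requires work. \<open>x\<close> is a convex combination of
  \<open>y\<close> and a point \<open>x - t *\<^sub>R h\<close> on the opposite side, where the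
  upper paraboloid applies; letting \<open>t\<close> tend to 0 turns the convexity inequality into a
  supporting one with the slope \<open>G x\<close>.\<close>

lemma semiconvex_upper_paraboloid_imp_C11:
  fixes k :: "'a::euclidean_space \<Rightarrow> real"
  assumes conv: "convex_on UNIV (\<lambda>x. k x + c / 2 * (norm x)\<^sup>2)"
    and up: "\<And>x y. k y \<le> k x + G x \<bullet> (y - x) + \<Lambda> / 2 * (norm (y - x))\<^sup>2"
    and pos: "c \<ge> 0" "\<Lambda> \<ge> 0"
  shows "C11 ((\<Lambda> + c) / 2) k G"
  unfolding C11_def
proof (intro allI)
  fix x y :: 'a
  define h where "h = y - x"
  have par: "(norm (x - t *\<^sub>R h))\<^sup>2 = (norm x)\<^sup>2 - 2 * t * (x \<bullet> h) + t\<^sup>2 * (norm h)\<^sup>2"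
    "(norm (x + t *\<^sub>R h))\<^sup>2 = (norm x)\<^sup>2 + 2 * t * (x \<bullet> h) + t\<^sup>2 * (norm h)\<^sup>2" for t
    unfolding power2_norm_eq_inner by (simp_all add: inner_commute algebra_simps power2_eq_square)
  have low: "k y - k x - G x \<bullet> h + c / 2 * (norm h)\<^sup>2 \<ge> - ((\<Lambda> + c) / 2 * (norm h)\<^sup>2) * t" if t: "t > 0" for t
  proof -
    \<comment> \<open>The weight for which \<open>x\<close> is the combination of
      \<open>x - t *\<^sub>R h\<close> and \<open>y = x + h\<close>.\<close>
    define s where "s = t / (1 + t)"
    have s: "0 \<le> s" "s \<le> 1" "1 - s = 1 / (1 + t)" using t by (auto simp: s_def field_simps)
    have eq: "(1 - s) *\<^sub>R (x - t *\<^sub>R h) + s *\<^sub>R y = x"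
    proof -
      have "(1 - s) *\<^sub>R (x - t *\<^sub>R h) + s *\<^sub>R y = x + (s - (1 - s) * t) *\<^sub>R h"
        by (simp add: h_def algebra_simps)
      also have "s - (1 - s) * t = 0" using s(3) by (simp add: s_def)
      finally show ?thesis by simp
    qed
    have "k x + c / 2 * (norm x)\<^sup>2 \<le> (1 - s) * (k (x - t *\<^sub>R h) + c / 2 * (norm (x - t *\<^sub>R h))\<^sup>2)
      + s * (k y + c / 2 * (norm y)\<^sup>2)"
      using convex_onD[OF conv s(1,2), of "x - t *\<^sub>R h" y] unfolding eq by auto
    also have "\<dots> = (k (x - t *\<^sub>R h) + c / 2 * (norm (x - t *\<^sub>R h))\<^sup>2 + t * (k y + c / 2 * (norm y)\<^sup>2)) / (1 + t)"
      using t unfolding s(3) unfolding s_def by (simp add: add_divide_distrib)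
    finally have "(1 + t) * (k x + c / 2 * (norm x)\<^sup>2) \<le>
      k (x - t *\<^sub>R h) + c / 2 * (norm (x - t *\<^sub>R h))\<^sup>2 + t * (k y + c / 2 * (norm y)\<^sup>2)"
      using t by (simp add: pos_le_divide_eq mult.commute)
    moreover have "k (x - t *\<^sub>R h) \<le> k x - t * (G x \<bullet> h) + \<Lambda> / 2 * (t\<^sup>2 * (norm h)\<^sup>2)"
      using up[of "x - t *\<^sub>R h" x] by (simp add: power_mult_distrib)
    moreover have "(norm y)\<^sup>2 = (norm x)\<^sup>2 + 2 * (x \<bullet> h) + (norm h)\<^sup>2"
      using par(2)[of 1] by (simp add: h_def)
    ultimately have "0 \<le> t * (k y - k x - G x \<bullet> h + c / 2 * (norm h)\<^sup>2 + (\<Lambda> + c) / 2 * (norm h)\<^sup>2 * t)"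
      unfolding par by (simp add: algebra_simps power2_eq_square add_divide_distrib)
    then show ?thesis using t by (simp add: zero_le_mult_iff)
  qed
  have "((\<lambda>t. - ((\<Lambda> + c) / 2 * (norm h)\<^sup>2) * t) \<longlongrightarrow> - ((\<Lambda> + c) / 2 * (norm h)\<^sup>2) * 0) (at_right 0)"
    by (intro tendsto_intros)
  then have "- ((\<Lambda> + c) / 2 * (norm h)\<^sup>2) * 0 \<le> k y - k x - G x \<bullet> h + c / 2 * (norm h)\<^sup>2"
    by (rule tendsto_upperbound) (use low in \<open>auto simp: eventually_at_filter intro!: always_eventually\<close>)
  moreover have "\<Lambda> * (norm h)\<^sup>2 \<ge> 0" "c * (norm h)\<^sup>2 \<ge> 0" using pos by auto
  ultimately show "\<bar>k y - k x - G x \<bullet> (y - x)\<bar> \<le> (\<Lambda> + c) / 2 * (norm (y - x))\<^sup>2"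
    using up[of y x] unfolding h_def abs_le_iff by (simp add: field_simps)
qed

section \<open>Lasry-Lions regularisation\<close>

definition supconv :: "'a::euclidean_space set \<Rightarrow> ('a \<Rightarrow> real) \<Rightarrow> real \<Rightarrow> 'a \<Rightarrow> real" where
  "supconv C u l \<xi> = (SUP x\<in>C. u x - l / 2 * (norm (x - \<xi>))\<^sup>2)"

definition lasry_lions :: "'a::euclidean_space set \<Rightarrow> ('a \<Rightarrow> real) \<Rightarrow> real \<Rightarrow> real \<Rightarrow> 'a \<Rightarrow> real" where
  "lasry_lions C u l \<Lambda> x = (INF \<xi>. supconv C u l \<xi> + \<Lambda> / 2 * (norm (x - \<xi>))\<^sup>2)"

locale usc_compact =
  fixes C :: "'a::euclidean_space set" and u :: "'a \<Rightarrow> real"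
  assumes C: "compact C" "C \<noteq> {}"
    and usc: "\<And>x e. x \<in> C \<Longrightarrow> e > 0 \<Longrightarrow> \<forall>\<^sub>F y in at x within C. u y < u x + e"
begin

lemma supconv_attained:
  "\<exists>x\<in>C. supconv C u l \<xi> = u x - l / 2 * (norm (x - \<xi>))\<^sup>2 \<and>
    (\<forall>y\<in>C. u y - l / 2 * (norm (y - \<xi>))\<^sup>2 \<le> supconv C u l \<xi>)"
proof -
  define w where "w y = u y - l / 2 * (norm (y - \<xi>))\<^sup>2" for y
  have "\<exists>x\<in>C. \<forall>y\<in>C. w y \<le> w x"
  proof (rule usc_attains_max[OF C])
    fix x and e :: real assume x: "x \<in> C" and e: "e > 0"
    have "((\<lambda>y. l / 2 * (norm (y - \<xi>))\<^sup>2) \<longlongrightarrow> l / 2 * (norm (x - \<xi>))\<^sup>2) (at x within C)"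
      by (intro tendsto_intros)
    then have "\<forall>\<^sub>F y in at x within C. l / 2 * (norm (y - \<xi>))\<^sup>2 > l / 2 * (norm (x - \<xi>))\<^sup>2 - e / 2"
      by (rule order_tendstoD) (use e in simp)
    moreover have "\<forall>\<^sub>F y in at x within C. u y < u x + e / 2" by (rule usc) (use x e in auto)
    ultimately show "\<forall>\<^sub>F y in at x within C. w y < w x + e"
      by eventually_elim (simp add: w_def)
  qed
  then obtain x where x: "x \<in> C" "\<And>y. y \<in> C \<Longrightarrow> w y \<le> w x" by blast
  have "supconv C u l \<xi> = w x"
    unfolding supconv_def w_def[symmetric] using x by (intro cSup_eq_maximum) auto
  with x show ?thesis by (auto simp: w_def)
qed

lemma supconv_ge: "x \<in> C \<Longrightarrow> u x - l / 2 * (norm (x - \<xi>))\<^sup>2 \<le> supconv C u l \<xi>"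
  using supconv_attained by blast

text \<open>Adding the quadratic term cancels the square of \<xi> in every competitor, and a
  supremum of affine functions is convex.\<close>

lemma supconv_semiconvex: "convex_on UNIV (\<lambda>\<xi>. supconv C u l \<xi> + l / 2 * (norm \<xi>)\<^sup>2)"
proof (rule convex_onI)
  fix t :: real and a b :: 'a
  assume t: "0 < t" "t < 1"
  define \<xi> where "\<xi> = (1 - t) *\<^sub>R a + t *\<^sub>R b"
  obtain x where x: "x \<in> C" "supconv C u l \<xi> = u x - l / 2 * (norm (x - \<xi>))\<^sup>2"
    using supconv_attained by blast
  have aff: "u x - l / 2 * (norm (x - y))\<^sup>2 + l / 2 * (norm y)\<^sup>2 = u x - l / 2 * (norm x)\<^sup>2 + l * (x \<bullet> y)" for y
    unfolding power2_norm_eq_inner by (simp add: inner_commute algebra_simps)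
  define A where "A = u x - l / 2 * (norm x)\<^sup>2"
  define k where "k y = A + l * (x \<bullet> y)" for y
  have k: "k y \<le> supconv C u l y + l / 2 * (norm y)\<^sup>2" for y
    using supconv_ge[OF x(1), of l y] aff[of y] by (simp add: k_def A_def)
  have "supconv C u l \<xi> + l / 2 * (norm \<xi>)\<^sup>2 = k \<xi>" unfolding x(2) aff k_def A_def ..
  also have "\<dots> = (1 - t) * k a + t * k b"
    by (simp add: k_def \<xi>_def inner_add_right algebra_simps)
  also have "\<dots> \<le> (1 - t) * (supconv C u l a + l / 2 * (norm a)\<^sup>2) + t * (supconv C u l b + l / 2 * (norm b)\<^sup>2)"
    using t k by (intro add_mono mult_left_mono) auto
  finally show "supconv C u l ((1 - t) *\<^sub>R a + t *\<^sub>R b) + l / 2 * (norm ((1 - t) *\<^sub>R a + t *\<^sub>R b))\<^sup>2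
    \<le> (1 - t) * (supconv C u l a + l / 2 * (norm a)\<^sup>2) + t * (supconv C u l b + l / 2 * (norm b)\<^sup>2)"
    by (simp add: \<xi>_def)
qed simp

lemma supconv_continuous: "continuous_on S (supconv C u l)"
proof -
  have "continuous_on UNIV (\<lambda>\<xi>. (supconv C u l \<xi> + l / 2 * (norm \<xi>)\<^sup>2) - l / 2 * (norm \<xi>)\<^sup>2)"
    by (intro continuous_on_diff convex_on_continuous supconv_semiconvex continuous_intros) auto
  then show ?thesis by (auto intro: continuous_on_subset)
qed

lemma lasry_lions_attained:
  assumes l: "0 < l" "l < \<Lambda>"
  shows "\<exists>\<xi>. lasry_lions C u l \<Lambda> x = supconv C u l \<xi> + \<Lambda> / 2 * (norm (x - \<xi>))\<^sup>2 \<and>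
    (\<forall>\<xi>'. lasry_lions C u l \<Lambda> x \<le> supconv C u l \<xi>' + \<Lambda> / 2 * (norm (x - \<xi>'))\<^sup>2)"
proof -
  define w where "w \<xi> = supconv C u l \<xi> + \<Lambda> / 2 * (norm (x - \<xi>))\<^sup>2" for \<xi>
  obtain z where z: "z \<in> C" using C by blast
  define a where "a = norm (z - x)"
  define K where "K = \<bar>supconv C u l x - u z + l / 2 * a\<^sup>2\<bar>"
  \<comment> \<open>Beyond this radius \<open>(\<Lambda> - l) / 2 * r^2\<close> outweighs both
    \<open>l * a * r\<close> and the constant \<open>K\<close>, so a minimiser over the ball is a
    global one.\<close>
  define R where "R = max 1 (2 * (l * a + K) / (\<Lambda> - l))"
  have R: "R \<ge> 1" by (simp add: R_def)
  have cont: "continuous_on (cball x R) w"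
    unfolding w_def by (intro continuous_intros supconv_continuous)
  obtain \<xi> where \<xi>: "\<xi> \<in> cball x R" "\<And>y. y \<in> cball x R \<Longrightarrow> w \<xi> \<le> w y"
    using continuous_attains_inf[OF compact_cball _ cont] R by fastforce
  have "w \<xi> \<le> w y" for y
  proof (cases "y \<in> cball x R")
    case False
    define r where "r = norm (x - y)"
    have r: "r > R" using False by (simp add: r_def dist_norm)
    have "norm (z - y) \<le> a + r"
      using norm_triangle_ineq[of "z - x" "x - y"] by (simp add: a_def r_def)
    then have "(norm (z - y))\<^sup>2 \<le> (a + r)\<^sup>2" by (rule power_mono) simp
    then have "l / 2 * (norm (z - y))\<^sup>2 \<le> l / 2 * (a + r)\<^sup>2" using l by (intro mult_left_mono) auto
    then have 1: "w y \<ge> u z - l / 2 * (a + r)\<^sup>2 + \<Lambda> / 2 * r\<^sup>2"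
      using supconv_ge[OF z, of l y] by (simp add: w_def r_def)
    have "2 * (l * a + K) / (\<Lambda> - l) \<le> r" using r by (simp add: R_def)
    then have "l * a + K \<le> (\<Lambda> - l) / 2 * r" using l by (simp add: field_simps)
    then have "(l * a + K) * r \<le> (\<Lambda> - l) / 2 * r * r" using r R by (intro mult_right_mono) auto
    moreover have "K * 1 \<le> K * r" using r R by (intro mult_left_mono) (auto simp: K_def)
    ultimately have "K \<le> (\<Lambda> - l) / 2 * r\<^sup>2 - l * a * r" by (simp add: power2_eq_square algebra_simps)
    then have "w y \<ge> supconv C u l x"
    proof -
      have "l / 2 * (a + r)\<^sup>2 = l / 2 * a\<^sup>2 + l * a * r + l / 2 * r\<^sup>2"
        "(\<Lambda> - l) / 2 * r\<^sup>2 = \<Lambda> / 2 * r\<^sup>2 - l / 2 * r\<^sup>2"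
        by (simp_all add: power2_eq_square field_simps)
      moreover have "supconv C u l x - u z + l / 2 * a\<^sup>2 \<le> K" by (simp add: K_def)
      ultimately show ?thesis using 1 \<open>K \<le> _\<close> by linarith
    qed
    also have "supconv C u l x = w x" by (simp add: w_def)
    also have "w \<xi> \<le> w x" using \<xi>(2)[of x] R by simp
    finally show ?thesis by simp
  qed (use \<xi> in auto)
  moreover from this have "lasry_lions C u l \<Lambda> x = w \<xi>"
    unfolding lasry_lions_def w_def[symmetric] by (intro cInf_eq_minimum) auto
  ultimately show ?thesis unfolding w_def by auto
qed

end

text \<open>The relation says \<open>1 / l = 1 / l' + 1 / \<Lambda>\<close>. By the semigroup law
  for sup-convolutions, \<open>N\<close> is then the sup-convolution of \<open>f\<close> with
  parameter \<Lambda>, and \<open>U\<close> is the envelope of \<open>f\<close> by paraboloids of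
  opening \<Lambda> from above. This places \<open>U\<close> between \<open>f\<close> and
  \<open>N\<close>, keeps the semiconvexity constant \<open>l'\<close> of \<open>f\<close>, and adds
  a bound on the curvature from above.\<close>

locale lasry_lions_reg = usc_compact +
  fixes l \<Lambda> l' :: real
  assumes l: "0 < l" "l < \<Lambda>" and l'_eq: "l' = l * \<Lambda> / (\<Lambda> - l)"
begin

abbreviation "N \<equiv> supconv C u l"
abbreviation "f \<equiv> supconv C u l'"
abbreviation "U \<equiv> lasry_lions C u l \<Lambda>"

lemma l': "l < l'" "l' > 0" "l * l' + l * \<Lambda> = l' * \<Lambda>"
proof -
  have "l' - l = l * l / (\<Lambda> - l)" using l by (simp add: l'_eq field_simps)
  also have "\<dots> > 0" using l by simp
  finally show "l < l'" by simp
  then show "l' > 0" using l by simp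
  show "l * l' + l * \<Lambda> = l' * \<Lambda>" using l by (simp add: l'_eq field_simps)
qed

lemma U_le: "U x \<le> N \<xi> + \<Lambda> / 2 * (norm (x - \<xi>))\<^sup>2"
  using lasry_lions_attained[OF l] by blast

lemma U_le_N: "U x \<le> N x"
  using U_le[of x x] by simp

lemma f_le_U: "f x \<le> U x"
proof -
  obtain \<xi> where \<xi>: "U x = N \<xi> + \<Lambda> / 2 * (norm (x - \<xi>))\<^sup>2"
    using lasry_lions_attained[OF l] by blast
  obtain z where z: "z \<in> C" "f x = u z - l' / 2 * (norm (z - x))\<^sup>2"
    using supconv_attained by blast
  define a b where "a = z - x" and "b = x - \<xi>"
  \<comment> \<open>The inequality \<open>l * |a + b|^2 \<le> l' * |a|^2 + \<Lambda> * |b|^2\<close>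
    holds exactly because of the relation between the three parameters: its defect is a perfect
    square up to the factor \<open>\<Lambda> - l\<close>.\<close>
  have "(\<Lambda> - l) * (l' * (norm a)\<^sup>2 + \<Lambda> * (norm b)\<^sup>2 - l * (norm (a + b))\<^sup>2)
    = (norm (l *\<^sub>R a - (\<Lambda> - l) *\<^sub>R b))\<^sup>2"
  proof -
    have "(\<Lambda> - l) * l' = l * \<Lambda>" using l'(3) by (simp add: algebra_simps)
    then have "(\<Lambda> - l) * (l' * (a \<bullet> a)) = l * \<Lambda> * (a \<bullet> a)" by (simp flip: mult.assoc)
    then show ?thesis
      unfolding power2_norm_eq_inner right_diff_distrib distrib_left
      by (simp add: inner_commute algebra_simps)
  qed
  then have "0 \<le> (\<Lambda> - l) * (l' * (norm a)\<^sup>2 + \<Lambda> * (norm b)\<^sup>2 - l * (norm (a + b))\<^sup>2)" by simp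
  then have "0 \<le> l' * (norm a)\<^sup>2 + \<Lambda> * (norm b)\<^sup>2 - l * (norm (a + b))\<^sup>2"
    using l by (simp add: zero_le_mult_iff)
  moreover have "a + b = z - \<xi>" by (simp add: a_def b_def)
  ultimately show ?thesis
    using supconv_ge[OF z(1), of l \<xi>] unfolding z(2) \<xi> a_def b_def by (simp add: field_simps)
qed

text \<open>The converse half of the semigroup law. On the segment from \<xi> to the maximiser
  \<open>z\<close>, the point at fraction \<open>l / \<Lambda>\<close> gives equality in the
  inequality between the three squares, and there the value of \<open>f\<close> is at least what
  \<open>N \<xi>\<close> requires.\<close>

lemma N_le_if_paraboloid_above:
  assumes "\<And>y. f y \<le> c + \<Lambda> / 2 * (norm (y - \<xi>))\<^sup>2"
  shows "N \<xi> \<le> c"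
proof -
  obtain z where z: "z \<in> C" "N \<xi> = u z - l / 2 * (norm (z - \<xi>))\<^sup>2"
    using supconv_attained by blast
  have \<Lambda>: "\<Lambda> > 0" using l by simp
  define y where "y = \<xi> + (l / \<Lambda>) *\<^sub>R (z - \<xi>)"
  have 1: "y - \<xi> = (l / \<Lambda>) *\<^sub>R (z - \<xi>)" "z - y = (1 - l / \<Lambda>) *\<^sub>R (z - \<xi>)"
    by (auto simp: y_def algebra_simps)
  have "l' * (1 - l / \<Lambda>)\<^sup>2 + \<Lambda> * (l / \<Lambda>)\<^sup>2 = l"
  proof -
    have "l' * (1 - l / \<Lambda>) = l" using l \<Lambda> by (simp add: l'_eq field_simps)
    then have "l' * (1 - l / \<Lambda>)\<^sup>2 = l * (1 - l / \<Lambda>)" by (simp add: power2_eq_square flip: mult.assoc)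
    moreover have "\<Lambda> * (l / \<Lambda>)\<^sup>2 = l * (l / \<Lambda>)" using \<Lambda> by (simp add: power2_eq_square)
    ultimately show ?thesis by (simp add: right_diff_distrib)
  qed
  then have "l * (norm (z - \<xi>))\<^sup>2 = l' * (norm (z - y))\<^sup>2 + \<Lambda> * (norm (y - \<xi>))\<^sup>2"
    unfolding 1 norm_scaleR power_mult_distrib power2_abs by (metis distrib_right mult.assoc)
  then show ?thesis
    using supconv_ge[OF z(1), of l' y] assms[of y] z(2) by (simp add: field_simps)
qed

text \<open>A partial minimum of a jointly convex function is convex. The identity \<open>sq\<close>
  completes the square: after \<open>l' / 2 * (norm x)^2\<close> is added, the minimised expression
  is \<open>N\<close> plus \<open>l / 2 * (norm \<xi>)^2\<close>, convex in \<xi>, plus the square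
  of a linear map of the pair.\<close>

lemma U_semiconvex: "convex_on UNIV (\<lambda>x. U x + l' / 2 * (norm x)\<^sup>2)"
proof (rule convex_onI)
  fix t :: real and a b :: 'a
  assume t: "0 < t" "t < 1"
  obtain \<alpha> where \<alpha>: "U a = N \<alpha> + \<Lambda> / 2 * (norm (a - \<alpha>))\<^sup>2"
    using lasry_lions_attained[OF l] by blast
  obtain \<beta> where \<beta>: "U b = N \<beta> + \<Lambda> / 2 * (norm (b - \<beta>))\<^sup>2"
    using lasry_lions_attained[OF l] by blast
  define \<theta> where "\<theta> = \<Lambda> / (\<Lambda> + l')"
  have pos: "\<Lambda> + l' > 0" using l l' by simp
  have sq: "\<Lambda> / 2 * (norm (x - \<xi>))\<^sup>2 + l' / 2 * (norm x)\<^sup>2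
      = l / 2 * (norm \<xi>)\<^sup>2 + (\<Lambda> + l') / 2 * (norm (x - \<theta> *\<^sub>R \<xi>))\<^sup>2" for x \<xi> :: 'a
  proof -
    have 1: "(\<Lambda> + l') * \<theta> = \<Lambda>" using pos by (simp add: \<theta>_def)
    moreover have "\<Lambda> - l = \<Lambda> * \<theta>"
      using pos l'(3) by (simp add: \<theta>_def field_simps)
    ultimately have 2: "(\<Lambda> + l') * \<theta> = \<Lambda>" "\<Lambda> * \<theta> = \<Lambda> - l" by simp_all
    have "(\<Lambda> + l') * (norm (x - \<theta> *\<^sub>R \<xi>))\<^sup>2 =
      (\<Lambda> + l') * (x \<bullet> x) - 2 * ((\<Lambda> + l') * \<theta>) * (x \<bullet> \<xi>) + ((\<Lambda> + l') * \<theta> * \<theta>) * (\<xi> \<bullet> \<xi>)"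
      unfolding power2_norm_eq_inner by (simp add: inner_commute algebra_simps)
    also have "\<dots> = (\<Lambda> + l') * (x \<bullet> x) - 2 * \<Lambda> * (x \<bullet> \<xi>) + (\<Lambda> - l) * (\<xi> \<bullet> \<xi>)"
      unfolding 2 ..
    finally have E: "(\<Lambda> + l') * (norm (x - \<theta> *\<^sub>R \<xi>))\<^sup>2 =
      (\<Lambda> + l') * (x \<bullet> x) - 2 * \<Lambda> * (x \<bullet> \<xi>) + (\<Lambda> - l) * (\<xi> \<bullet> \<xi>)" .
    have "\<Lambda> * (norm (x - \<xi>))\<^sup>2 + l' * (norm x)\<^sup>2 = l * (norm \<xi>)\<^sup>2 + (\<Lambda> + l') * (norm (x - \<theta> *\<^sub>R \<xi>))\<^sup>2"
      unfolding E unfolding power2_norm_eq_inner by (simp add: inner_commute algebra_simps)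
    then show ?thesis by simp
  qed
  define x \<xi> where "x = (1 - t) *\<^sub>R a + t *\<^sub>R b" and "\<xi> = (1 - t) *\<^sub>R \<alpha> + t *\<^sub>R \<beta>"
  have x\<xi>: "x - \<theta> *\<^sub>R \<xi> = (1 - t) *\<^sub>R (a - \<theta> *\<^sub>R \<alpha>) + t *\<^sub>R (b - \<theta> *\<^sub>R \<beta>)"
    by (simp add: x_def \<xi>_def algebra_simps)
  have dist: "((1 - t) * (A + P) + t * (B + Q)) + D * ((1 - t) * E + t * F)
      = (1 - t) * (A + (P + D * E)) + t * (B + (Q + D * F))" for A B D E F P Q :: real
    by (simp add: algebra_simps)
  have "U x + l' / 2 * (norm x)\<^sup>2 \<le> (N \<xi> + l / 2 * (norm \<xi>)\<^sup>2) + (\<Lambda> + l') / 2 * (norm (x - \<theta> *\<^sub>R \<xi>))\<^sup>2"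
    using U_le[of x \<xi>] sq[of x \<xi>] by simp
  also have "\<dots> \<le> ((1 - t) * (N \<alpha> + l / 2 * (norm \<alpha>)\<^sup>2) + t * (N \<beta> + l / 2 * (norm \<beta>)\<^sup>2))
    + (\<Lambda> + l') / 2 * ((1 - t) * (norm (a - \<theta> *\<^sub>R \<alpha>))\<^sup>2 + t * (norm (b - \<theta> *\<^sub>R \<beta>))\<^sup>2)"
  proof (rule add_mono)
    show "N \<xi> + l / 2 * (norm \<xi>)\<^sup>2 \<le> (1 - t) * (N \<alpha> + l / 2 * (norm \<alpha>)\<^sup>2) + t * (N \<beta> + l / 2 * (norm \<beta>)\<^sup>2)"
      unfolding \<xi>_def using t by (intro convex_onD[OF supconv_semiconvex]) auto
    show "(\<Lambda> + l') / 2 * (norm (x - \<theta> *\<^sub>R \<xi>))\<^sup>2 \<le>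
      (\<Lambda> + l') / 2 * ((1 - t) * (norm (a - \<theta> *\<^sub>R \<alpha>))\<^sup>2 + t * (norm (b - \<theta> *\<^sub>R \<beta>))\<^sup>2)"
      unfolding x\<xi> using t pos by (intro mult_left_mono convex_on_norm_square) auto
  qed
  also have "\<dots> = (1 - t) * (N \<alpha> + (l / 2 * (norm \<alpha>)\<^sup>2 + (\<Lambda> + l') / 2 * (norm (a - \<theta> *\<^sub>R \<alpha>))\<^sup>2))
    + t * (N \<beta> + (l / 2 * (norm \<beta>)\<^sup>2 + (\<Lambda> + l') / 2 * (norm (b - \<theta> *\<^sub>R \<beta>))\<^sup>2))"
    by (rule dist)
  also have "\<dots> = (1 - t) * (U a + l' / 2 * (norm a)\<^sup>2) + t * (U b + l' / 2 * (norm b)\<^sup>2)"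
    unfolding sq[symmetric] \<alpha> \<beta> by (simp add: add.assoc)
  finally show "U ((1 - t) *\<^sub>R a + t *\<^sub>R b) + l' / 2 * (norm ((1 - t) *\<^sub>R a + t *\<^sub>R b))\<^sup>2
    \<le> (1 - t) * (U a + l' / 2 * (norm a)\<^sup>2) + t * (U b + l' / 2 * (norm b)\<^sup>2)"
    by (simp add: x_def)
qed simp

lemma U_C11: "\<exists>G. C11 ((\<Lambda> + l') / 2) U G"
proof -
  have "\<exists>q. \<forall>y. U y \<le> U x + q \<bullet> (y - x) + \<Lambda> / 2 * (norm (y - x))\<^sup>2" for x
  proof -
    obtain \<xi> where \<xi>: "U x = N \<xi> + \<Lambda> / 2 * (norm (x - \<xi>))\<^sup>2"
      using lasry_lions_attained[OF l] by blast
    have "U y \<le> U x + (\<Lambda> *\<^sub>R (x - \<xi>)) \<bullet> (y - x) + \<Lambda> / 2 * (norm (y - x))\<^sup>2" for y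
    proof -
      have "(norm (y - \<xi>))\<^sup>2 = (norm (x - \<xi>))\<^sup>2 + 2 * ((x - \<xi>) \<bullet> (y - x)) + (norm (y - x))\<^sup>2"
        unfolding power2_norm_eq_inner by (simp add: inner_commute algebra_simps)
      then show ?thesis using U_le[of y \<xi>] \<xi> by (simp add: distrib_left)
    qed
    then show ?thesis by blast
  qed
  then obtain G where "\<And>x y. U y \<le> U x + G x \<bullet> (y - x) + \<Lambda> / 2 * (norm (y - x))\<^sup>2" by metis
  from semiconvex_upper_paraboloid_imp_C11[OF U_semiconvex this] show ?thesis using l l' by force
qed

text \<open>Where a paraboloid that is less curved than the envelope touches it, the envelope must
  agree with the enveloped function, since otherwise it could be lowered there.\<close>

lemma f_eq_U_at_contact:
  assumes touch: "\<And>y. U y \<le> U x + q \<bullet> (y - x) + \<mu> / 2 * (norm (y - x))\<^sup>2" and \<mu>: "\<mu> < \<Lambda>"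
  shows "f x = U x"
proof (rule ccontr)
  assume "f x \<noteq> U x"
  then have gap: "f x < U x" using f_le_U[of x] by simp
  define \<psi> where "\<psi> y = U x + q \<bullet> (y - x) + \<Lambda> / 2 * (norm (y - x))\<^sup>2" for y
  have \<Lambda>: "\<Lambda> > 0" using l by simp
  have "((\<lambda>y. \<psi> y - f y) \<longlongrightarrow> \<psi> x - f x) (at x)"
    using supconv_continuous[of UNIV l'] unfolding \<psi>_def
    by (intro tendsto_intros) (auto simp: continuous_on_def)
  moreover have "\<psi> x - f x > (U x - f x) / 2" using gap by (simp add: \<psi>_def)
  ultimately have "\<forall>\<^sub>F y in at x. \<psi> y - f y > (U x - f x) / 2" by (rule order_tendstoD)
  then obtain r where r: "r > 0" "\<And>y. y \<noteq> x \<Longrightarrow> dist y x < r \<Longrightarrow> \<psi> y - f y > (U x - f x) / 2"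
    unfolding eventually_at by auto
  \<comment> \<open>The amount by which the paraboloid can be lowered while staying above
    \<open>f\<close>: near \<open>x\<close> the gap between \<open>f\<close> and \<open>U\<close>
    leaves room, and farther away the surplus curvature \<open>\<Lambda> - \<mu>\<close>
    does.\<close>
  define c where "c = min ((U x - f x) / 2) ((\<Lambda> - \<mu>) / 2 * r\<^sup>2)"
  have cle: "c \<le> (U x - f x) / 2" "c \<le> (\<Lambda> - \<mu>) / 2 * r\<^sup>2" unfolding c_def by (rule min.cobounded1 min.cobounded2)+
  have c: "c > 0" using gap r \<mu> by (simp add: c_def)
  have low: "f y \<le> \<psi> y - c" for y
  proof (cases "dist y x < r")
    case True
    then have "\<psi> y - f y \<ge> (U x - f x) / 2"
      using r(2)[of y] gap by (cases "y = x") (auto simp: \<psi>_def)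
    then show ?thesis using cle by linarith
  next
    case False
    then have "r\<^sup>2 \<le> (norm (y - x))\<^sup>2" using r(1) by (intro power_mono) (auto simp: dist_norm)
    then have "(\<Lambda> - \<mu>) / 2 * r\<^sup>2 \<le> (\<Lambda> - \<mu>) / 2 * (norm (y - x))\<^sup>2" using \<mu> by (intro mult_left_mono) auto
    also have "\<dots> \<le> \<psi> y - U y" using touch[of y] by (simp add: \<psi>_def field_simps)
    also have "\<dots> \<le> \<psi> y - f y" using f_le_U[of y] by simp
    finally show ?thesis using cle by linarith
  qed
  \<comment> \<open>The vertex of \<psi>. Once \<psi> is written around it, lowering \<psi> means
    lowering \<open>N \<xi>\<close>, which pushes \<open>U x\<close> below itself.\<close>
  define \<xi> where "\<xi> = x - (1 / \<Lambda>) *\<^sub>R q"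
  define c0 where "c0 = U x - \<Lambda> / 2 * (norm (x - \<xi>))\<^sup>2"
  have \<psi>: "\<psi> y = c0 + \<Lambda> / 2 * (norm (y - \<xi>))\<^sup>2" for y
  proof -
    have "(norm (y - \<xi>))\<^sup>2 = (norm (x - \<xi>))\<^sup>2 + 2 * ((x - \<xi>) \<bullet> (y - x)) + (norm (y - x))\<^sup>2"
      unfolding power2_norm_eq_inner by (simp add: inner_commute algebra_simps)
    moreover have "\<Lambda> * ((x - \<xi>) \<bullet> (y - x)) = q \<bullet> (y - x)" using \<Lambda> by (simp add: \<xi>_def)
    ultimately show ?thesis by (simp add: \<psi>_def c0_def distrib_left)
  qed
  have "N \<xi> \<le> c0 - c"
    using low \<psi> by (intro N_le_if_paraboloid_above) (simp add: algebra_simps)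
  then have "U x \<le> c0 - c + \<Lambda> / 2 * (norm (x - \<xi>))\<^sup>2" using U_le[of x \<xi>] by simp
  also have "\<dots> = U x - c" by (simp add: c0_def)
  finally show False using c by simp
qed

end

section \<open>The theorem on sums\<close>

lemma selfadjointD:
  assumes "selfadjoint T"
  shows "linear T" "x \<bullet> T y = T x \<bullet> y" "T (x + y) = T x + T y" "T (c *\<^sub>R x) = c *\<^sub>R T x" "T 0 = 0"
  using assms linear_add[of T] linear_scale[of T] linear_0[of T] by (auto simp: selfadjoint_def)

lemma selfadjoint_add_scaleR:
  assumes "selfadjoint T"
  shows "selfadjoint (\<lambda>x. T x + c *\<^sub>R x)"
  using selfadjointD[OF assms] unfolding selfadjoint_def
  by (auto intro!: linear_compose_add linear_scale_self simp: inner_add)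

lemma selfadjoint_expand:
  assumes "selfadjoint T"
  shows "((z + h) \<bullet> T (z + h)) / 2 = (z \<bullet> T z) / 2 + T z \<bullet> h + (h \<bullet> T h) / 2"
proof -
  have "h \<bullet> T z = T z \<bullet> h" "z \<bullet> T h = T z \<bullet> h"
    using selfadjointD(2)[OF assms, of z h] by (auto simp: inner_commute)
  then show ?thesis by (simp add: selfadjointD(3)[OF assms] inner_add field_simps)
qed

lemma C11_quadratic:
  fixes T :: "'a::euclidean_space \<Rightarrow> 'a"
  assumes "selfadjoint T" "\<And>x. norm (T x) \<le> B * norm x"
  shows "C11 B (\<lambda>z. (z \<bullet> T z) / 2) T"
  unfolding C11_def
proof (intro allI)
  fix x y :: 'a
  define h where "h = y - x"
  have "y \<bullet> T y / 2 - x \<bullet> T x / 2 - T x \<bullet> h = (h \<bullet> T h) / 2"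
  proof -
    have e: "y = x + h" by (simp add: h_def)
    show ?thesis unfolding e selfadjoint_expand[OF assms(1)] by simp
  qed
  moreover have "\<bar>h \<bullet> T h\<bar> \<le> B * (norm h)\<^sup>2"
  proof -
    have "\<bar>h \<bullet> T h\<bar> \<le> norm h * norm (T h)" by (rule Cauchy_Schwarz_ineq2)
    also have "\<dots> \<le> norm h * (B * norm h)" using assms(2) by (intro mult_left_mono) auto
    finally show ?thesis by (simp add: power2_eq_square mult_ac)
  qed
  ultimately show "\<bar>y \<bullet> T y / 2 - x \<bullet> T x / 2 - T x \<bullet> (y - x)\<bar> \<le> B * (norm (y - x))\<^sup>2"
    by (simp add: h_def)
qed

lemma norm_fst_snd_le: "norm (fst z) \<le> norm z" "norm (snd z) \<le> norm z"
  by (cases z; simp add: norm_fst_le norm_snd_le)+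

lemma C11_fst:
  assumes "C11 C w G"
  shows "C11 C (\<lambda>z. w (fst z)) (\<lambda>z. (G (fst z), 0))"
  unfolding C11_def
proof (intro allI)
  fix x y :: "'a \<times> 'b"
  have "\<bar>w (fst y) - w (fst x) - G (fst x) \<bullet> (fst y - fst x)\<bar> \<le> C * (norm (fst (y - x)))\<^sup>2"
    using C11D[OF assms] by simp
  also have "\<dots> \<le> C * (norm (y - x))\<^sup>2"
    using C11_nonneg[OF assms] norm_fst_snd_le(1)[of "y - x"] by (intro mult_left_mono power_mono) auto
  finally show "\<bar>w (fst y) - w (fst x) - (G (fst x), 0) \<bullet> (y - x)\<bar> \<le> C * (norm (y - x))\<^sup>2"
    by (simp add: inner_prod_def)
qed

lemma C11_snd:
  assumes "C11 C w G"
  shows "C11 C (\<lambda>z. w (snd z)) (\<lambda>z. (0, G (snd z)))"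
  unfolding C11_def
proof (intro allI)
  fix x y :: "'b \<times> 'a"
  have "\<bar>w (snd y) - w (snd x) - G (snd x) \<bullet> (snd y - snd x)\<bar> \<le> C * (norm (snd (y - x)))\<^sup>2"
    using C11D[OF assms] by simp
  also have "\<dots> \<le> C * (norm (y - x))\<^sup>2"
    using C11_nonneg[OF assms] norm_fst_snd_le(2)[of "y - x"] by (intro mult_left_mono power_mono) auto
  finally show "\<bar>w (snd y) - w (snd x) - (0, G (snd x)) \<bullet> (y - x)\<bar> \<le> C * (norm (y - x))\<^sup>2"
    by (simp add: inner_prod_def)
qed

text \<open>The added curvature raises the quadratic by \<open>2 * \<eta> * \<rho>^2\<close> on the
  sphere of radius \<rho>, twice the error allowed there. So the difference has an interior maximum,
  and at that point the shifted quadratic touches exactly. Its Hessian is fixed, which is why the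
  expansion at one scale is enough.\<close>

lemma approx_touch_imp_touch:
  fixes f :: "'a::euclidean_space \<Rightarrow> real"
  assumes cont: "continuous_on UNIV f" and H: "selfadjoint H" and \<rho>: "\<rho> > 0" and \<eta>: "\<eta> > 0"
    and app: "\<And>a. norm a \<le> \<rho> \<Longrightarrow> f (x + a) \<le> f x + g \<bullet> a + (a \<bullet> H a) / 2 + \<eta> * \<rho>\<^sup>2"
  defines "H' \<equiv> \<lambda>a. H a + (4 * \<eta>) *\<^sub>R a"
  shows "\<exists>a. norm a < \<rho> \<and> (\<exists>r>0. \<forall>h. norm h \<le> r \<longrightarrow>
    f (x + a + h) \<le> f (x + a) + (g + H' a) \<bullet> h + (h \<bullet> H' h) / 2)"
proof -
  have H': "selfadjoint H'" unfolding H'_def by (rule selfadjoint_add_scaleR[OF H])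
  define \<phi> where "\<phi> a = f (x + a) - (g \<bullet> a + (a \<bullet> H' a) / 2)" for a
  have "continuous_on UNIV H'"
    using selfadjointD(1)[OF H'] by (simp add: linear_continuous_on linear_linear)
  then have "continuous_on (cball 0 \<rho>) H'" by (rule continuous_on_subset) simp
  then have "continuous_on (cball 0 \<rho>) \<phi>"
    unfolding \<phi>_def by (intro continuous_intros continuous_on_compose2[OF cont]) auto
  then obtain a where a: "a \<in> cball 0 \<rho>" "\<And>b. b \<in> cball 0 \<rho> \<Longrightarrow> \<phi> b \<le> \<phi> a"
    using continuous_attains_sup[of "cball 0 \<rho>" \<phi>] \<rho> by fastforce
  have "norm a \<noteq> \<rho>"
  proof
    assume n: "norm a = \<rho>"
    have "a \<bullet> H' a = a \<bullet> H a + 4 * \<eta> * \<rho>\<^sup>2"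
      by (simp add: H'_def inner_add_right dot_square_norm n)
    then have "\<phi> a \<le> f x - \<eta> * \<rho>\<^sup>2" using app[of a] n by (simp add: \<phi>_def add_divide_distrib)
    also have "\<dots> < \<phi> 0" using \<eta> \<rho> by (simp add: \<phi>_def)
    finally show False using a(2)[of 0] \<rho> by simp
  qed
  then have n: "norm a < \<rho>" using a(1) by auto
  have "f (x + a + h) \<le> f (x + a) + (g + H' a) \<bullet> h + (h \<bullet> H' h) / 2" if h: "norm h \<le> \<rho> - norm a" for h
  proof -
    have "\<phi> (a + h) \<le> \<phi> a" using h norm_triangle_ineq[of a h] by (intro a(2)) auto
    then show ?thesis
      unfolding \<phi>_def selfadjoint_expand[OF H', of a h] by (simp add: inner_add add.assoc)
  qed
  then show ?thesis using n by (intro exI[of _ a] conjI exI[of _ "\<rho> - norm a"]) auto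
qed

context usc_compact
begin

text \<open>Translating both \<open>x\<close> and the maximiser by the same vector leaves the
  penalty unchanged, so a quadratic touching the sup-convolution at \<open>x\<close> touches
  \<open>u\<close> at the maximiser with the same derivatives.\<close>

lemma supconv_touch_transfer:
  assumes l': "l' > 0"
    and touch: "\<And>h. norm h \<le> r \<Longrightarrow> supconv C u l' (x + h) \<le> supconv C u l' x + p \<bullet> h + (h \<bullet> H h) / 2"
  shows "\<exists>z\<in>C. supconv C u l' x = u z - l' / 2 * (norm (z - x))\<^sup>2 \<and>
    (\<forall>y\<in>C. norm (y - z) \<le> r \<longrightarrow> u y \<le> u z + p \<bullet> (y - z) + ((y - z) \<bullet> H (y - z)) / 2)"
proof -
  obtain z where z: "z \<in> C" "supconv C u l' x = u z - l' / 2 * (norm (z - x))\<^sup>2"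
    using supconv_attained by blast
  have "u y \<le> u z + p \<bullet> (y - z) + ((y - z) \<bullet> H (y - z)) / 2" if "y \<in> C" "norm (y - z) \<le> r" for y
    using supconv_ge[OF that(1), of l' "x + (y - z)"] touch[OF that(2)] z(2) by simp
  with z show ?thesis by blast
qed

text \<open>The competitor 0 gives \<open>norm (z - x) \<le> \<theta> * norm z + norm x\<close> with
  \<theta> < 1, since \<open>u z\<close> exceeds \<open>u 0\<close> by at most a quadratic with
  constant \<open>l < l'\<close>. This keeps the points at which jets of \<open>u\<close> are found
  close to the origin.\<close>

lemma supconv_maximizer_near:
  assumes "0 < l" "l < l'" "0 \<in> C" "u z \<le> u 0 + l / 2 * (norm z)\<^sup>2"
    and z: "supconv C u l' x = u z - l' / 2 * (norm (z - x))\<^sup>2"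
  shows "norm z \<le> 2 / (1 - sqrt (l / l')) * norm x"
proof -
  define \<theta> where "\<theta> = sqrt (l / l')"
  have \<theta>: "0 \<le> \<theta>" "\<theta> < 1" "l = l' * \<theta>\<^sup>2" using assms by (auto simp: \<theta>_def)
  have "u 0 - l' / 2 * (norm x)\<^sup>2 \<le> supconv C u l' x"
    using supconv_ge[OF assms(3), of l' x] by simp
  then have "l' * (norm (z - x))\<^sup>2 \<le> l' * ((\<theta> * norm z)\<^sup>2 + (norm x)\<^sup>2)"
    using assms(4) z unfolding \<theta>(3) by (simp add: power_mult_distrib field_simps)
  then have "(norm (z - x))\<^sup>2 \<le> (\<theta> * norm z)\<^sup>2 + (norm x)\<^sup>2" using assms by simp
  also have "\<dots> \<le> (\<theta> * norm z + norm x)\<^sup>2" using \<theta> by (simp add: power2_sum)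
  finally have "norm (z - x) \<le> \<theta> * norm z + norm x"
    by (rule power2_le_imp_le) (use \<theta> in simp)
  then have "norm z * (1 - \<theta>) \<le> 2 * norm x"
    using norm_triangle_ineq[of "z - x" x] by (simp add: algebra_simps)
  then show ?thesis unfolding \<theta>_def[symmetric] using \<theta>(2) by (simp add: pos_le_divide_eq mult_ac)
qed

end

text \<open>An approximate form of the Crandall-Ishii theorem on sums: the jets are those of smooth
  functions touching at nearby points, so no closure of jets is needed.\<close>

theorem theorem_on_sums:
  fixes u1 :: "'a::euclidean_space \<Rightarrow> real" and u2 :: "'b::euclidean_space \<Rightarrow> real"
  assumes u1: "usc_compact C1 u1" "0 \<in> C1" and u2: "usc_compact C2 u2" "0 \<in> C2"
    and T: "selfadjoint T" and l: "l > 0" and \<mu>: "\<mu> > 0"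
    and le: "\<And>x y \<zeta>. x \<in> C1 \<Longrightarrow> y \<in> C2 \<Longrightarrow>
      u1 x + u2 y \<le> u1 0 + u2 0 + (\<zeta> \<bullet> T \<zeta>) / 2 + l / 2 * (norm ((x, y) - \<zeta>))\<^sup>2"
  shows "\<exists>x\<in>C1. \<exists>y\<in>C2. \<exists>p q X Y. norm x \<le> \<mu> \<and> norm y \<le> \<mu> \<and> norm p \<le> \<mu> \<and> norm q \<le> \<mu> \<and>
    selfadjoint X \<and> selfadjoint Y \<and>
    (\<exists>r>0. \<forall>x'\<in>C1. norm (x' - x) \<le> r \<longrightarrow> u1 x' \<le> u1 x + p \<bullet> (x' - x) + ((x' - x) \<bullet> X (x' - x)) / 2) \<and>
    (\<exists>r>0. \<forall>y'\<in>C2. norm (y' - y) \<le> r \<longrightarrow> u2 y' \<le> u2 y + q \<bullet> (y' - y) + ((y' - y) \<bullet> Y (y' - y)) / 2) \<and>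
    (\<forall>a b. a \<bullet> X a + b \<bullet> Y b \<le> (a, b) \<bullet> T (a, b) + \<mu> * ((norm a)\<^sup>2 + (norm b)\<^sup>2))"
proof -
  \<comment> \<open>The budget is \<open>\<kappa> + 8 * \<eta> = \<mu>\<close>: \<kappa> makes the
    maximum strict, \<open>4 * \<eta>\<close> is the error of the expansion in the form inequality,
    and another \<open>4 * \<eta>\<close> is added to make the quadratics touch.\<close>
  define \<kappa> where "\<kappa> = \<mu> / 2"
  define \<eta> where "\<eta> = \<mu> / 16"
  have \<kappa>\<eta>: "\<kappa> > 0" "\<eta> > 0" using \<mu> by (auto simp: \<kappa>_def \<eta>_def)
  obtain B where B: "B > 0" "\<And>x. norm (T x) \<le> B * norm x"
    using linear_bounded_pos[OF selfadjointD(1)[OF T]] by blast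
  define m where "m = B + \<kappa>"
  define S where "S z = T z + \<kappa> *\<^sub>R z" for z
  have S: "selfadjoint S" unfolding S_def by (rule selfadjoint_add_scaleR[OF T])
  have Sm: "norm (S z) \<le> m * norm z" for z
    using norm_triangle_ineq[of "T z" "\<kappa> *\<^sub>R z"] B(2)[of z] \<kappa>\<eta> by (simp add: S_def m_def distrib_right)
  have Sm2: "z \<bullet> S z \<le> m * (norm z)\<^sup>2" for z
  proof -
    have "z \<bullet> S z \<le> norm z * norm (S z)" by (rule norm_cauchy_schwarz)
    also have "\<dots> \<le> norm z * (m * norm z)" using Sm by (intro mult_left_mono) auto
    finally show ?thesis by (simp add: power2_eq_square mult_ac)
  qed
  have m: "m > 0" using B \<kappa>\<eta> by (simp add: m_def)
  \<comment> \<open>Larger than \<open>l\<close>, so that the inf-convolution is attained, and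
    larger than \<open>m\<close>, so that the quadratic form of \<open>S\<close> is less curved than
    the envelope and forces \<open>f\<close> and \<open>U\<close> to agree at the contact
    point.\<close>
  define \<Lambda> where "\<Lambda> = m + l + 1"
  define l' where "l' = l * \<Lambda> / (\<Lambda> - l)"
  have \<Lambda>: "l < \<Lambda>" "m < \<Lambda>" using m l by (auto simp: \<Lambda>_def)
  interpret A: lasry_lions_reg C1 u1 l \<Lambda> l'
    by (intro lasry_lions_reg.intro lasry_lions_reg_axioms.intro u1 l \<Lambda> l'_def)
  interpret B: lasry_lions_reg C2 u2 l \<Lambda> l'
    by (intro lasry_lions_reg.intro lasry_lions_reg_axioms.intro u2 l \<Lambda> l'_def)
  obtain G1 G2 where G1: "C11 ((\<Lambda> + l') / 2) A.U G1" and G2: "C11 ((\<Lambda> + l') / 2) B.U G2"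
    using A.U_C11 B.U_C11 by blast
  define w where "w z = A.U (fst z) + B.U (snd z) + (z \<bullet> (- S z)) / 2" for z
  define G where "G z = (G1 (fst z), 0) + (0, G2 (snd z)) + - S z" for z
  have "selfadjoint (\<lambda>z. - S z)"
    using S unfolding selfadjoint_def by (auto intro: linear_compose_neg)
  then have Q: "C11 m (\<lambda>z. (z \<bullet> (- S z)) / 2) (\<lambda>z. - S z)"
    using Sm by (intro C11_quadratic) auto
  have w: "C11 ((\<Lambda> + l') / 2 + (\<Lambda> + l') / 2 + m) w G"
    unfolding w_def G_def by (intro C11_add C11_fst C11_snd G1 G2 Q)
  have w0: "w z \<le> w 0 - \<kappa> / 2 * (norm z)\<^sup>2" for z
  proof -
    obtain x where x: "x \<in> C1" "A.N (fst z) = u1 x - l / 2 * (norm (x - fst z))\<^sup>2"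
      using A.supconv_attained by blast
    obtain y where y: "y \<in> C2" "B.N (snd z) = u2 y - l / 2 * (norm (y - snd z))\<^sup>2"
      using B.supconv_attained by blast
    have "(norm ((x, y) - z))\<^sup>2 = (norm (x - fst z))\<^sup>2 + (norm (y - snd z))\<^sup>2"
      by (cases z) (simp add: norm_Pair)
    then have "A.N (fst z) + B.N (snd z) \<le> u1 0 + u2 0 + (z \<bullet> T z) / 2"
      using le[OF x(1) y(1), of z] x(2) y(2) by (simp add: distrib_left)
    then have "A.U (fst z) + B.U (snd z) \<le> u1 0 + u2 0 + (z \<bullet> T z) / 2"
      using A.U_le_N[of "fst z"] B.U_le_N[of "snd z"] by linarith
    moreover have "u1 0 \<le> A.U 0" "u2 0 \<le> B.U 0"
      using A.supconv_ge[OF u1(2), of l' 0] A.f_le_U[of 0] B.supconv_ge[OF u2(2), of l' 0] B.f_le_U[of 0] by auto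
    moreover have "(z \<bullet> (- S z)) / 2 = - ((z \<bullet> T z) / 2) - \<kappa> / 2 * (norm z)\<^sup>2"
      unfolding S_def inner_minus_right inner_add_right inner_scaleR_right dot_square_norm by (simp add: field_simps)
    ultimately show ?thesis by (simp add: w_def)
  qed
  define c where "c = 2 / (1 - sqrt (l / l'))"
  have "sqrt (l / l') < 1" using l A.l' by simp
  then have c: "c > 0" by (simp add: c_def)
  \<comment> \<open>Each summand of the denominator covers one loss: \<open>2 * c\<close> the
    distance of the touching points, the others the gradient of the envelope, the displacement by
    \<open>X\<close> or \<open>Y\<close>, and the added curvature. All end up below \<mu>.\<close>
  define \<delta> where "\<delta> = \<mu> / (2 + 2 * m + \<mu> + 2 * c)"
  have \<delta>: "\<delta> > 0" "\<delta> * (2 + 2 * m + \<mu> + 2 * c) = \<mu>" using \<mu> m c by (auto simp: \<delta>_def)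
  obtain z \<rho> H where z: "norm z \<le> \<delta>" "norm (G z) \<le> \<delta>" "\<And>z'. w z' \<le> w z + G z \<bullet> (z' - z)"
    and \<rho>: "0 < \<rho>" "\<rho> \<le> \<delta>" and H: "selfadjoint H" "\<And>h. norm h \<le> \<rho> \<Longrightarrow> norm (H h) \<le> \<delta>"
    and ex: "\<And>h. norm h \<le> \<rho> \<Longrightarrow> \<bar>w (z + h) - w z - G z \<bullet> h - (h \<bullet> H h) / 2\<bar> \<le> \<eta> * \<rho>\<^sup>2"
    using C11_jensen_point[OF w \<kappa>\<eta>(1) \<delta>(1) \<kappa>\<eta>(2) w0] by blast
  define x y where "x = fst z" and "y = snd z"
  define V where "V h = A.U (x + fst h) + B.U (y + snd h) - A.U x - B.U y - (G1 x \<bullet> fst h + G2 y \<bullet> snd h)" for h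
  define K where "K h = H h + S h" for h
  have V: "V h = w (z + h) - w z - G z \<bullet> h + (h \<bullet> S h) / 2" for h
  proof -
    have 1: "G z \<bullet> h = G1 x \<bullet> fst h + G2 y \<bullet> snd h - S z \<bullet> h"
      by (simp add: G_def x_def y_def inner_diff_left inner_prod_def)
    have 2: "w (z + h) = A.U (x + fst h) + B.U (y + snd h) - ((z + h) \<bullet> S (z + h)) / 2"
      "w z = A.U x + B.U y - (z \<bullet> S z) / 2"
      by (simp_all add: w_def x_def y_def)
    show ?thesis unfolding V_def 1 2 selfadjoint_expand[OF S] by simp
  qed
  have V_up: "V h \<le> (h \<bullet> S h) / 2" for h
    using z(3)[of "z + h"] by (simp add: V)
  have V_ex: "\<bar>V h - (h \<bullet> K h) / 2\<bar> \<le> \<eta> * \<rho>\<^sup>2" if "norm h \<le> \<rho>" for h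
    using ex[OF that] by (simp add: V K_def inner_add_right add_divide_distrib)
  have V_sep: "V (a, b) = V (a, 0) + V (0, b)" for a b by (simp add: V_def)
  have K: "linear K" "h \<bullet> K h' = K h \<bullet> h'" for h h'
    using selfadjointD(1,2)[OF H(1)] selfadjointD(1,2)[OF S]
    unfolding K_def[abs_def] by (simp_all add: inner_add linear_compose_add)
  \<comment> \<open>Only the diagonal blocks of \<open>K\<close> are kept. The remainder
    \<open>V\<close> is a sum of a function of \<open>a\<close> and one of \<open>b\<close>, so the
    blocks describe \<open>V (a, 0)\<close> and \<open>V (0, b)\<close>, and the off-diagonal part
    is never compared with anything.\<close>
  define X where "X a = fst (K (a, 0))" for a
  define Y where "Y b = snd (K (0, b))" for b
  have X: "selfadjoint X"
  proof -
    have "linear (\<lambda>a::'a. (a, 0::'b))" by (rule linearI) auto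
    then have "linear X" unfolding X_def
      using linear_compose[OF linear_compose[OF _ K(1)] linear_fst] by (simp add: o_def)
    moreover have "a \<bullet> X b = X a \<bullet> b" for a b
      using K(2)[of "(a, 0)" "(b, 0)"] by (simp add: X_def inner_prod_def)
    ultimately show ?thesis by (simp add: selfadjoint_def)
  qed
  have Y: "selfadjoint Y"
  proof -
    have "linear (\<lambda>a::'b. (0::'a, a))" by (rule linearI) auto
    then have "linear Y" unfolding Y_def
      using linear_compose[OF linear_compose[OF _ K(1)] linear_snd] by (simp add: o_def)
    moreover have "a \<bullet> Y b = Y a \<bullet> b" for a b
      using K(2)[of "(0, a)" "(0, b)"] by (simp add: Y_def inner_prod_def)
    ultimately show ?thesis by (simp add: selfadjoint_def)
  qed
  have XK: "(a, 0) \<bullet> K (a, 0) = a \<bullet> X a" and YK: "(0, b) \<bullet> K (0, b) = b \<bullet> Y b" for a b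
    by (auto simp: X_def Y_def inner_prod_def)
  \<comment> \<open>Freezing the second variable turns the contact of the sum into a contact of
    \<open>A.U\<close> alone with a paraboloid of opening \<open>m < \<Lambda>\<close>.\<close>
  have fx: "A.f x = A.U x"
  proof (rule A.f_eq_U_at_contact[OF _ \<Lambda>(2)])
    fix x'
    show "A.U x' \<le> A.U x + G1 x \<bullet> (x' - x) + m / 2 * (norm (x' - x))\<^sup>2"
      using V_up[of "(x' - x, 0)"] Sm2[of "(x' - x, 0)"] by (simp add: V_def norm_Pair)
  qed
  have fy: "B.f y = B.U y"
  proof (rule B.f_eq_U_at_contact[OF _ \<Lambda>(2)])
    fix y'
    show "B.U y' \<le> B.U y + G2 y \<bullet> (y' - y) + m / 2 * (norm (y' - y))\<^sup>2"
      using V_up[of "(0, y' - y)"] Sm2[of "(0, y' - y)"] by (simp add: V_def norm_Pair)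
  qed
  define X' where "X' a = X a + (4 * \<eta>) *\<^sub>R a" for a
  define Y' where "Y' b = Y b + (4 * \<eta>) *\<^sub>R b" for b
  have "\<exists>a. norm a < \<rho> \<and> (\<exists>r>0. \<forall>h. norm h \<le> r \<longrightarrow>
    A.f (x + a + h) \<le> A.f (x + a) + (G1 x + X' a) \<bullet> h + (h \<bullet> X' h) / 2)"
    unfolding X'_def
  proof (rule approx_touch_imp_touch[OF A.supconv_continuous X \<rho>(1) \<kappa>\<eta>(2)])
    fix a :: 'a assume "norm a \<le> \<rho>"
    then show "A.f (x + a) \<le> A.f x + G1 x \<bullet> a + (a \<bullet> X a) / 2 + \<eta> * \<rho>\<^sup>2"
      using V_ex[of "(a, 0)"] A.f_le_U[of "x + a"] unfolding XK fx by (simp add: V_def norm_Pair)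
  qed
  then obtain a ra where a: "norm a < \<rho>" "ra > 0"
    "\<And>h. norm h \<le> ra \<Longrightarrow> A.f (x + a + h) \<le> A.f (x + a) + (G1 x + X' a) \<bullet> h + (h \<bullet> X' h) / 2" by blast
  have "\<exists>b. norm b < \<rho> \<and> (\<exists>r>0. \<forall>h. norm h \<le> r \<longrightarrow>
    B.f (y + b + h) \<le> B.f (y + b) + (G2 y + Y' b) \<bullet> h + (h \<bullet> Y' h) / 2)"
    unfolding Y'_def
  proof (rule approx_touch_imp_touch[OF B.supconv_continuous Y \<rho>(1) \<kappa>\<eta>(2)])
    fix b :: 'b assume "norm b \<le> \<rho>"
    then show "B.f (y + b) \<le> B.f y + G2 y \<bullet> b + (b \<bullet> Y b) / 2 + \<eta> * \<rho>\<^sup>2"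
      using V_ex[of "(0, b)"] B.f_le_U[of "y + b"] unfolding YK fy by (simp add: V_def norm_Pair)
  qed
  then obtain b rb where b: "norm b < \<rho>" "rb > 0"
    "\<And>h. norm h \<le> rb \<Longrightarrow> B.f (y + b + h) \<le> B.f (y + b) + (G2 y + Y' b) \<bullet> h + (h \<bullet> Y' h) / 2" by blast
  obtain x1 where x1: "x1 \<in> C1" "A.f (x + a) = u1 x1 - l' / 2 * (norm (x1 - (x + a)))\<^sup>2"
    "\<And>x'. x' \<in> C1 \<Longrightarrow> norm (x' - x1) \<le> ra \<Longrightarrow>
      u1 x' \<le> u1 x1 + (G1 x + X' a) \<bullet> (x' - x1) + ((x' - x1) \<bullet> X' (x' - x1)) / 2"
    using A.supconv_touch_transfer[OF A.l'(2) a(3)] by blast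
  obtain y1 where y1: "y1 \<in> C2" "B.f (y + b) = u2 y1 - l' / 2 * (norm (y1 - (y + b)))\<^sup>2"
    "\<And>y'. y' \<in> C2 \<Longrightarrow> norm (y' - y1) \<le> rb \<Longrightarrow>
      u2 y' \<le> u2 y1 + (G2 y + Y' b) \<bullet> (y' - y1) + ((y' - y1) \<bullet> Y' (y' - y1)) / 2"
    using B.supconv_touch_transfer[OF B.l'(2) b(3)] by blast
  have nxy: "norm x \<le> \<delta>" "norm y \<le> \<delta>"
    using norm_fst_snd_le(1)[of z] norm_fst_snd_le(2)[of z] z(1) by (auto simp: x_def y_def)
  have T0: "T 0 = 0" by (rule selfadjointD(5)[OF T])
  have c_bd: "c * (2 * \<delta>) \<le> \<mu>"
  proof -
    have "\<delta> * (2 + 2 * m + \<mu>) \<ge> 0" using \<delta> m \<mu> by simp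
    then show ?thesis using \<delta>(2) by (simp add: algebra_simps)
  qed
  have "norm x1 \<le> c * norm (x + a)"
    unfolding c_def
    by (rule A.supconv_maximizer_near[OF l A.l'(1) u1(2) _ x1(2)])
       (use le[OF x1(1) u2(2), of 0] T0 in \<open>simp add: norm_Pair\<close>)
  also have "\<dots> \<le> c * (2 * \<delta>)"
    using norm_triangle_ineq[of x a] nxy a \<rho> c by (intro mult_left_mono) auto
  finally have nx1: "norm x1 \<le> \<mu>" using c_bd by simp
  have "norm y1 \<le> c * norm (y + b)"
    unfolding c_def
    by (rule B.supconv_maximizer_near[OF l B.l'(1) u2(2) _ y1(2)])
       (use le[OF u1(2) y1(1), of 0] T0 in \<open>simp add: norm_Pair\<close>)
  also have "\<dots> \<le> c * (2 * \<delta>)"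
    using norm_triangle_ineq[of y b] nxy b \<rho> c by (intro mult_left_mono) auto
  finally have ny1: "norm y1 \<le> \<mu>" using c_bd by simp
  have KB: "norm (K h) \<le> \<delta> + m * \<delta>" if "norm h \<le> \<rho>" for h
  proof -
    have "m * norm h \<le> m * \<delta>" using that \<rho> m by (intro mult_left_mono) auto
    then show ?thesis
      using norm_triangle_ineq[of "H h" "S h"] H(2)[OF that] Sm[of h] by (simp add: K_def)
  qed
  have Gz: "norm (G1 x, G2 y) \<le> \<delta> + m * \<delta>"
  proof -
    have "(G1 x, G2 y) = G z + S z" by (simp add: G_def x_def y_def)
    moreover have "m * norm z \<le> m * \<delta>" using z m by (intro mult_left_mono) auto
    ultimately show ?thesis
      using norm_triangle_ineq[of "G z" "S z"] z(2) Sm[of z] by simp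
  qed
  have \<eta>d: "norm ((4 * \<eta>) *\<^sub>R h) \<le> \<mu> * \<delta>" if "norm h < \<rho>" for h :: "'c::real_normed_vector"
  proof -
    have "norm ((4 * \<eta>) *\<^sub>R h) = \<mu> / 4 * norm h" using \<mu> by (simp add: \<eta>_def)
    also have "\<dots> \<le> \<mu> * \<delta>" using that \<rho> \<mu> by (intro mult_mono) auto
    finally show ?thesis .
  qed
  have p_bd: "2 * (\<delta> + m * \<delta>) + \<mu> * \<delta> \<le> \<mu>"
  proof -
    have "\<delta> * (2 * c) \<ge> 0" using \<delta> c by simp
    then show ?thesis using \<delta>(2) by (simp add: algebra_simps)
  qed
  have np: "norm (G1 x + X' a) \<le> \<mu>"
  proof -
    have "norm (G1 x) \<le> \<delta> + m * \<delta>" using Gz norm_fst_snd_le(1)[of "(G1 x, G2 y)"] by simp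
    moreover have "norm (X a) \<le> \<delta> + m * \<delta>"
      using KB[of "(a, 0)"] norm_fst_snd_le(1)[of "K (a, 0)"] a(1) by (simp add: X_def norm_Pair)
    ultimately show ?thesis
      using norm_triangle_ineq[of "G1 x" "X' a"] norm_triangle_ineq[of "X a" "(4 * \<eta>) *\<^sub>R a"] \<eta>d[OF a(1)] p_bd
      by (simp add: X'_def)
  qed
  have nq: "norm (G2 y + Y' b) \<le> \<mu>"
  proof -
    have "norm (G2 y) \<le> \<delta> + m * \<delta>" using Gz norm_fst_snd_le(2)[of "(G1 x, G2 y)"] by simp
    moreover have "norm (Y b) \<le> \<delta> + m * \<delta>"
      using KB[of "(0, b)"] norm_fst_snd_le(2)[of "K (0, b)"] b(1) by (simp add: Y_def norm_Pair)
    ultimately show ?thesis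
      using norm_triangle_ineq[of "G2 y" "Y' b"] norm_triangle_ineq[of "Y b" "(4 * \<eta>) *\<^sub>R b"] \<eta>d[OF b(1)] p_bd
      by (simp add: Y'_def)
  qed
  \<comment> \<open>The expansions of \<open>V (a, 0)\<close> and \<open>V (0, b)\<close> add up to
    that of \<open>V (a, b)\<close>, which lies below the form of \<open>S\<close> by contact. This
    is an inequality on the sphere of radius \<rho>; homogeneity extends it to all vectors.\<close>
  have XY: "a \<bullet> X a + b \<bullet> Y b \<le> (a, b) \<bullet> S (a, b) + 4 * \<eta> * (norm (a, b))\<^sup>2" for a b
  proof (cases "(a, b) = (0, 0)")
    case True
    then have "a = 0" "b = 0" by auto
    then show ?thesis using selfadjointD(5)[OF X] selfadjointD(5)[OF Y] selfadjointD(5)[OF S]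
      by (simp flip: zero_prod_def)
  next
    case False
    define t where "t = \<rho> / norm (a, b)"
    have n: "norm (a, b) > 0" using False by (auto simp flip: zero_prod_def)
    then have t: "t > 0" using \<rho> by (simp add: t_def)
    have tn: "norm (t *\<^sub>R a, t *\<^sub>R b) = \<rho>"
    proof -
      have "norm (t *\<^sub>R (a, b)) = \<rho>" unfolding norm_scaleR using n \<rho> by (simp add: t_def)
      then show ?thesis by (simp only: scaleR_Pair)
    qed
    have "norm (t *\<^sub>R a) \<le> \<rho>" "norm (t *\<^sub>R b) \<le> \<rho>"
      unfolding tn[symmetric] by (rule norm_fst_le norm_snd_le)+
    then have "(t *\<^sub>R a) \<bullet> X (t *\<^sub>R a) / 2 + (t *\<^sub>R b) \<bullet> Y (t *\<^sub>R b) / 2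
      \<le> V (t *\<^sub>R a, t *\<^sub>R b) + 2 * (\<eta> * \<rho>\<^sup>2)"
      using V_ex[of "(t *\<^sub>R a, 0)"] V_ex[of "(0, t *\<^sub>R b)"] unfolding XK YK V_sep[of "t *\<^sub>R a" "t *\<^sub>R b"]
      by (simp add: norm_Pair abs_le_iff)
    also have "\<dots> \<le> ((t *\<^sub>R a, t *\<^sub>R b) \<bullet> S (t *\<^sub>R a, t *\<^sub>R b)) / 2 + 2 * (\<eta> * (t\<^sup>2 * (norm (a, b))\<^sup>2))"
      using V_up[of "(t *\<^sub>R a, t *\<^sub>R b)"] n by (simp add: t_def power_divide)
    also have "(t *\<^sub>R a, t *\<^sub>R b) \<bullet> S (t *\<^sub>R a, t *\<^sub>R b) = t\<^sup>2 * ((a, b) \<bullet> S (a, b))"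
      using selfadjointD(4)[OF S, of t "(a, b)"] by (simp add: power2_eq_square inner_prod_def algebra_simps)
    finally have "t\<^sup>2 * (a \<bullet> X a + b \<bullet> Y b) \<le> t\<^sup>2 * ((a, b) \<bullet> S (a, b) + 4 * \<eta> * (norm (a, b))\<^sup>2)"
      by (simp add: selfadjointD(4)[OF X] selfadjointD(4)[OF Y] power2_eq_square algebra_simps)
    then show ?thesis using t by simp
  qed
  have "a \<bullet> X' a + b \<bullet> Y' b \<le> (a, b) \<bullet> T (a, b) + \<mu> * ((norm a)\<^sup>2 + (norm b)\<^sup>2)" for a b
  proof -
    have "(norm (a, b))\<^sup>2 = (norm a)\<^sup>2 + (norm b)\<^sup>2" by (simp add: norm_Pair)
    moreover have "(a, b) \<bullet> S (a, b) = (a, b) \<bullet> T (a, b) + \<kappa> * (norm (a, b))\<^sup>2"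
      unfolding S_def inner_add_right inner_scaleR_right dot_square_norm ..
    ultimately show ?thesis
      using XY[of a b]
      by (simp add: X'_def Y'_def inner_add_right dot_square_norm \<kappa>_def \<eta>_def field_simps)
  qed
  moreover have "selfadjoint X'" "selfadjoint Y'"
    unfolding X'_def Y'_def by (intro selfadjoint_add_scaleR X Y)+
  ultimately show ?thesis
    using x1(1,3) y1(1,3) nx1 ny1 np nq a(2) b(2) by blast
qed

section \<open>Degenerate ellipticity\<close>

lemma sym_mat_nth: "sym_mat M \<Longrightarrow> M $ i $ j = M $ j $ i"
  unfolding sym_mat_def transpose_def by (metis vec_lambda_beta)

lemma sym_mat_inner: "sym_mat M \<Longrightarrow> x \<bullet> (M *v y) = (M *v x) \<bullet> y"
  by (simp add: dot_lmul_matrix sym_mat_def flip: vector_transpose_matrix)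

text \<open>An argument without eigenvalues: testing with sums and differences of two axis vectors
  bounds each entry by the mean of two diagonal entries. The dimension factor is harmless, as it
  only enters constants.\<close>

lemma quadratic_form_le_trace:
  fixes E :: "real^'n^'n"
  assumes E: "psd_mat E"
  shows "\<xi> \<bullet> (E *v \<xi>) \<le> CARD('n) * trace E * (norm \<xi>)\<^sup>2"
proof -
  have sym: "sym_mat E" and nn: "0 \<le> \<xi> \<bullet> (E *v \<xi>)" for \<xi> using E by (auto simp: psd_mat_def)
  have ax: "axis i 1 \<bullet> (E *v axis j 1) = E $ i $ j" for i j
    by (simp add: inner_axis' matrix_vector_mul_component inner_axis)
  have diag: "E $ i $ i \<ge> 0" for i using nn[of "axis i 1"] by (simp add: ax)
  have off: "2 * \<bar>E $ i $ j\<bar> \<le> E $ i $ i + E $ j $ j" for i j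
  proof -
    have "0 \<le> E $ i $ i + E $ i $ j + (E $ j $ i + E $ j $ j)"
      using nn[of "axis i 1 + axis j 1"] by (simp add: inner_add matrix_vector_right_distrib ax)
    moreover have "0 \<le> E $ i $ i - E $ i $ j - (E $ j $ i - E $ j $ j)"
      using nn[of "axis i 1 - axis j 1"] by (simp add: inner_diff matrix_vector_mult_diff_distrib ax)
    ultimately show ?thesis using sym_mat_nth[OF sym, of i j] by linarith
  qed
  have "\<xi> \<bullet> (E *v \<xi>) = (\<Sum>i\<in>UNIV. \<Sum>j\<in>UNIV. \<xi> $ i * (E $ i $ j * \<xi> $ j))"
    by (simp add: inner_vec_def matrix_vector_mult_def sum_distrib_left)
  also have "\<dots> \<le> (\<Sum>i\<in>(UNIV::'n set). \<Sum>j\<in>(UNIV::'n set). (norm \<xi>)\<^sup>2 * ((E $ i $ i + E $ j $ j) / 2))"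
  proof (intro sum_mono)
    fix i j :: 'n
    have "\<xi> $ i * (E $ i $ j * \<xi> $ j) \<le> \<bar>\<xi> $ i\<bar> * \<bar>\<xi> $ j\<bar> * \<bar>E $ i $ j\<bar>"
      using abs_ge_self[of "\<xi> $ i * (E $ i $ j * \<xi> $ j)"] by (simp add: abs_mult mult_ac)
    also have "\<dots> \<le> norm \<xi> * norm \<xi> * ((E $ i $ i + E $ j $ j) / 2)"
      using off[of i j] component_le_norm_cart[of \<xi>] by (intro mult_mono) auto
    finally show "\<xi> $ i * (E $ i $ j * \<xi> $ j) \<le> (norm \<xi>)\<^sup>2 * ((E $ i $ i + E $ j $ j) / 2)"
      by (simp add: power2_eq_square)
  qed
  also have "\<dots> = CARD('n) * trace E * (norm \<xi>)\<^sup>2"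
    by (simp add: trace_def sum.distrib flip: sum_distrib_left sum_divide_distrib)
  finally show ?thesis .
qed

lemma sym_mat_arith:
  "sym_mat M \<Longrightarrow> sym_mat N \<Longrightarrow> sym_mat (M + N)"
  "sym_mat M \<Longrightarrow> sym_mat N \<Longrightarrow> sym_mat (M - N)"
  "sym_mat (c *\<^sub>R mat 1)"
  unfolding sym_mat_def transpose_def mat_def by (auto simp: vec_eq_iff)

lemma mat_scaled_inner:
  fixes x :: "real^'n"
  shows "x \<bullet> ((c *\<^sub>R mat 1) *v x) = c * (norm x)\<^sup>2"
  by (simp add: dot_square_norm flip: scaleR_matrix_vector_assoc)

text \<open>\<open>M'\<close> and \<open>M\<close> are joined through \<open>M' + I = M + E\<close>
  with \<open>I\<close> and \<open>E\<close> positive semidefinite. Raising \<open>M'\<close> by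
  \<open>I\<close> costs at most \<open>A\<close> times its trace, while raising \<open>M\<close> by
  \<open>E\<close> gains at least \<open>a\<close> times its trace, and a single very negative
  direction of \<open>M - M'\<close> already makes that trace large.\<close>

lemma structural_F_diff_le:
  fixes F :: "real^'n^'n \<Rightarrow> real"
  assumes F: "structural_F F a A" and sym: "sym_mat M" "sym_mat M'" and \<tau>: "\<tau> \<ge> 0"
    and up: "\<And>\<xi>. \<xi> \<bullet> ((M - M') *v \<xi>) \<le> \<tau> * (norm \<xi>)\<^sup>2"
    and \<xi>: "\<xi> \<noteq> 0" "\<xi> \<bullet> ((M - M') *v \<xi>) \<le> - s * (norm \<xi>)\<^sup>2"
  shows "F M - F M' \<le> A * CARD('n) * \<tau> - a / CARD('n) * s"
proof -
  let ?n = "real CARD('n)"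
  define I where "I = \<tau> *\<^sub>R (mat 1 :: real^'n^'n)"
  define E where "E = I - (M - M')"
  have symI: "sym_mat I" "sym_mat E" unfolding I_def E_def by (intro sym_mat_arith sym)+
  have Eq: "x \<bullet> (E *v x) = \<tau> * (norm x)\<^sup>2 - x \<bullet> ((M - M') *v x)" for x
    unfolding E_def I_def matrix_vector_mult_diff_rdistrib[of _ "M - M'"] inner_diff_right mat_scaled_inner ..
  have "psd_mat E" using symI(2) up by (simp add: psd_mat_def Eq)
  moreover have "psd_mat I" using symI(1) \<tau> by (simp add: psd_mat_def I_def mat_scaled_inner)
  moreover have "trace I = ?n * \<tau>" by (simp add: I_def trace_def mat_def)
  moreover have a: "a > 0" and aA: "\<And>M N. sym_mat M \<Longrightarrow> psd_mat N \<Longrightarrow>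
        a * trace N \<le> F (M + N) - F M \<and> F (M + N) - F M \<le> A * trace N"
    using F by (auto simp: structural_F_def)
  ultimately have "F (M' + I) - F M' \<le> A * (?n * \<tau>)" "a * trace E \<le> F (M + E) - F M"
    using aA[OF sym(2), of I] aA[OF sym(1), of E] by auto
  moreover have "M + E = M' + I" by (simp add: E_def)
  moreover have "a / ?n * s \<le> a * trace E"
  proof -
    have "s * (norm \<xi>)\<^sup>2 \<le> \<xi> \<bullet> (E *v \<xi>)"
    proof -
      have "\<tau> * (norm \<xi>)\<^sup>2 \<ge> 0" using \<tau> by simp
      then show ?thesis using \<xi>(2) unfolding Eq by linarith
    qed
    also have "\<dots> \<le> ?n * trace E * (norm \<xi>)\<^sup>2" by (rule quadratic_form_le_trace[OF \<open>psd_mat E\<close>])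
    finally have "s \<le> ?n * trace E" using \<xi>(1) by simp
    then have "a / ?n * s \<le> a / ?n * (?n * trace E)" using a by (intro mult_left_mono) auto
    then show ?thesis by simp
  qed
  ultimately show ?thesis by (simp add: mult.assoc)
qed

section \<open>Differences of powers\<close>

lemma powr_subadditive:
  fixes x y q :: real
  assumes "0 \<le> x" "0 \<le> y" "0 < q" "q \<le> 1"
  shows "(x + y) powr q \<le> x powr q + y powr q"
proof (cases "x + y = 0")
  case False
  define s where "s = x + y"
  have s: "s > 0" using False assms by (simp add: s_def)
  have "t / s * s powr q \<le> t powr q" if t: "0 \<le> t" "t \<le> s" for t
  proof (cases "t = 0")
    case False
    have "t / s = (t / s) powr 1" using t s by simp
    also have "\<dots> \<le> (t / s) powr q" using t s False assms by (intro powr_mono') auto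
    also have "\<dots> = t powr q / s powr q" using t s by (simp add: powr_divide)
    finally show ?thesis using s by (simp add: field_simps)
  qed simp
  from this[of x] this[of y] have "(x / s + y / s) * s powr q \<le> x powr q + y powr q"
    using assms by (simp add: s_def algebra_simps)
  moreover have "x / s + y / s = 1" using s by (simp add: s_def flip: add_divide_distrib)
  ultimately show ?thesis by (simp add: s_def)
qed (use assms in auto)

lemma powr_diff_le_powr:
  fixes x y q :: real
  assumes "0 \<le> x" "0 \<le> y" "0 < q" "q \<le> 1"
  shows "\<bar>x powr q - y powr q\<bar> \<le> \<bar>x - y\<bar> powr q"
proof (cases "x \<ge> y")
  case True
  then show ?thesis
    using powr_subadditive[of y "x - y" q] powr_mono2[of q y x] assms by (simp add: abs_if)
next
  case False
  then show ?thesis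
    using powr_subadditive[of x "y - x" q] powr_mono2[of q x y] assms by (simp add: abs_if)
qed

lemma powr_diff_le_mvt:
  fixes x y q R :: real
  assumes "0 \<le> x" "0 \<le> y" "x \<le> R" "y \<le> R" "1 \<le> q"
  shows "\<bar>x powr q - y powr q\<bar> \<le> q * R powr (q - 1) * \<bar>x - y\<bar>"
proof -
  have *: "x powr q - y powr q \<le> q * R powr (q - 1) * (x - y)" if "0 \<le> y" "y < x" "x \<le> R" for x y
  proof -
    have d: "((\<lambda>z. z powr q) has_real_derivative q * z powr (q - 1)) (at z)" if "y < z" for z
      using that \<open>0 \<le> y\<close> by (intro has_real_derivative_powr) auto
    have "continuous_on {y..x} (\<lambda>z. z powr q)"
      using \<open>0 \<le> y\<close> assms by (intro continuous_on_powr' continuous_intros) auto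
    then obtain l z where z: "z > y" "z < x" "((\<lambda>z. z powr q) has_real_derivative l) (at z)"
      "x powr q - y powr q = (x - y) * l"
      using MVT[OF \<open>y < x\<close>, of "\<lambda>z. z powr q"] d by (auto simp: real_differentiable_def)
    then have z: "z > y" "z < x" "x powr q - y powr q = (x - y) * (q * z powr (q - 1))"
      using d[of z] DERIV_unique by auto
    have "z powr (q - 1) \<le> R powr (q - 1)" using z that assms by (intro powr_mono2) auto
    then have "(x - y) * (q * z powr (q - 1)) \<le> (x - y) * (q * R powr (q - 1))"
      using that assms by (intro mult_left_mono) auto
    then show ?thesis using z by (simp add: mult_ac)
  qed
  have "q * R powr (q - 1) * \<bar>x - y\<bar> \<ge> 0" using assms by simp
  then show ?thesis
    using *[of y x] *[of x y] assms powr_mono2[of q x y] powr_mono2[of q y x]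
    by (cases x y rule: linorder_cases) (auto simp: abs_if)
qed

lemma powr_diff_le:
  fixes x y q R d :: real
  assumes "0 \<le> x" "0 \<le> y" "x \<le> R" "y \<le> R" "0 < R" "\<bar>x - y\<bar> \<le> d" "0 < q"
  shows "\<bar>x powr q - y powr q\<bar> \<le> max 1 q * R powr (q - min 1 q) * d powr (min 1 q)"
proof (cases "q \<le> 1")
  case True
  have "\<bar>x powr q - y powr q\<bar> \<le> \<bar>x - y\<bar> powr q" by (rule powr_diff_le_powr) (use assms True in auto)
  also have "\<dots> \<le> d powr q" using assms by (intro powr_mono2) auto
  finally show ?thesis using True assms by simp
next
  case False
  have "\<bar>x powr q - y powr q\<bar> \<le> q * R powr (q - 1) * \<bar>x - y\<bar>" by (rule powr_diff_le_mvt) (use assms False in auto)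
  also have "\<dots> \<le> q * R powr (q - 1) * d" using assms by (intro mult_left_mono) auto
  finally show ?thesis using False assms by simp
qed

section \<open>The degenerate weights\<close>

lemma Theta_nth: "(Theta \<alpha> p *v \<xi>) $ i = \<bar>p $ i\<bar> powr (\<alpha> / 2) * \<xi> $ i"
  by (simp add: Theta_def matrix_vector_mult_def if_distrib[of "\<lambda>x. x * _"] cong: if_cong)

lemma sym_mat_Theta: "sym_mat (Theta \<alpha> p)"
  by (auto simp: sym_mat_def Theta_def transpose_def vec_eq_iff)

lemma sym_mat_Theta_conj: "sym_mat X \<Longrightarrow> sym_mat (Theta \<alpha> p ** X ** Theta \<alpha> p)"
  using sym_mat_Theta[of \<alpha> p] by (simp add: sym_mat_def matrix_transpose_mul matrix_mul_assoc)

lemma Theta_conj_inner: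
  "\<xi> \<bullet> ((Theta \<alpha> p ** X ** Theta \<alpha> p) *v \<xi>) = (Theta \<alpha> p *v \<xi>) \<bullet> (X *v (Theta \<alpha> p *v \<xi>))"
  by (simp add: sym_mat_inner[OF sym_mat_Theta] flip: matrix_vector_mul_assoc)

lemma norm_power2_cart: "(norm (x :: real^'n))\<^sup>2 = (\<Sum>i\<in>UNIV. (x $ i)\<^sup>2)"
  unfolding power2_norm_eq_inner inner_vec_def by (simp add: power2_eq_square)

lemma norm_le_scaled_cart:
  fixes x y :: "real^'n"
  assumes "\<And>i. \<bar>x $ i\<bar> \<le> c * \<bar>y $ i\<bar>"
  shows "(norm x)\<^sup>2 \<le> c\<^sup>2 * (norm y)\<^sup>2"
  unfolding norm_power2_cart sum_distrib_left
proof (rule sum_mono)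
  fix i
  show "(x $ i)\<^sup>2 \<le> c\<^sup>2 * (y $ i)\<^sup>2"
    using power_mono[OF assms[of i] abs_ge_zero, of 2] by (simp add: power_mult_distrib)
qed

text \<open>The form bound is tested with \<open>(\<Theta>\<^sub>1 \<xi>, \<Theta>\<^sub>2 \<xi>)\<close> to bound the difference of the matrices from
  above, and with \<open>(\<Theta>\<^sub>1 \<xi>, - \<Theta>\<^sub>2 \<xi>)\<close> to find one very negative direction: \<open>\<xi>\<close> is chosen such that
  \<open>\<Theta>\<^sub>1 \<xi> + \<Theta>\<^sub>2 \<xi>\<close> is twice \<open>e\<close> without its small components, where \<open>\<Theta>\<close> may degenerate.\<close>

lemma Fp_diff_le:
  fixes F :: "real^'n^'n \<Rightarrow> real"
  assumes F: "structural_F F a A" and \<alpha>: "\<alpha> > 0"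
  shows "\<exists>c1>0. \<exists>C1>0. \<forall>e p1 p2 X Y P z0 \<kappa> K \<delta>. norm e = 1 \<longrightarrow> P > 0 \<longrightarrow> z0 > 0 \<longrightarrow> 0 < \<kappa> \<longrightarrow> \<kappa> \<le> 1 \<longrightarrow>
    K \<ge> 0 \<longrightarrow> \<delta> > 0 \<longrightarrow> \<delta> \<le> P * sqrt (\<kappa> / (64 * CARD('n))) \<longrightarrow>
    norm (p1 - P *\<^sub>R e) \<le> \<delta> \<longrightarrow> norm (p2 - P *\<^sub>R e) \<le> \<delta> \<longrightarrow> sym_mat X \<longrightarrow> sym_mat Y \<longrightarrow>
    (\<forall>a b. a \<bullet> (X *v a) - b \<bullet> (Y *v b) \<le> - (\<kappa> * z0 / 2) * ((a - b) \<bullet> e)\<^sup>2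
      + 2 * z0 * ((norm (a - b))\<^sup>2 - ((a - b) \<bullet> e)\<^sup>2) + K * ((norm a)\<^sup>2 + (norm b)\<^sup>2)) \<longrightarrow>
    Fp F \<alpha> p1 X - Fp F \<alpha> p2 Y \<le> P powr \<alpha> *
      (C1 * (z0 * (\<delta> / P) powr (2 * min 1 (\<alpha> / 2)) + K) - c1 * (z0 * \<kappa> powr (1 + \<alpha> / 2)))"
proof -
  define n where "n = real CARD('n)"
  have n: "n \<ge> 1" using zero_less_card_finite[where 'a='n] unfolding n_def by linarith
  have aA: "0 < a" "a < A" using F by (auto simp: structural_F_def)
  define q where "q = \<alpha> / 2"
  define m where "m = min 1 q"
  have q: "q > 0" "\<alpha> = 2 * q" using \<alpha> by (auto simp: q_def)
  define M where "M = max 1 q"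
  have M: "M \<ge> 1" by (simp add: M_def)
  define C1 where "C1 = 2 * A * n * M\<^sup>2 * 2 powr \<alpha> + 2 * A * n * 2 powr \<alpha> + 2 * a / n * 2 powr \<alpha>"
  define c1 where "c1 = a / n * (1 / (64 * n)) powr q"
  have c1: "c1 > 0" using aA n by (simp add: c1_def)
  have C1pos: "2 * A * n * M\<^sup>2 * 2 powr \<alpha> > 0" "2 * A * n * 2 powr \<alpha> > 0" "2 * a / n * 2 powr \<alpha> > 0"
    using aA n M by auto
  then have C1: "C1 > 0" by (simp add: C1_def)
  have "Fp F \<alpha> p1 X - Fp F \<alpha> p2 Y \<le> P powr \<alpha> *
      (C1 * (z0 * (\<delta> / P) powr (2 * m) + K) - c1 * (z0 * \<kappa> powr (1 + q)))"
    if e: "norm e = 1" and P: "P > 0" and z0: "z0 > 0" and \<kappa>: "0 < \<kappa>" "\<kappa> \<le> 1" and K: "K \<ge> 0" and \<delta>: "\<delta> > 0"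
      and \<delta>P: "\<delta> \<le> P * sqrt (\<kappa> / (64 * n))" and p: "norm (p1 - P *\<^sub>R e) \<le> \<delta>" "norm (p2 - P *\<^sub>R e) \<le> \<delta>"
      and XY: "sym_mat X" "sym_mat Y"
      and form: "\<And>a b. a \<bullet> (X *v a) - b \<bullet> (Y *v b) \<le> - (\<kappa> * z0 / 2) * ((a - b) \<bullet> e)\<^sup>2
      + 2 * z0 * ((norm (a - b))\<^sup>2 - ((a - b) \<bullet> e)\<^sup>2) + K * ((norm a)\<^sup>2 + (norm b)\<^sup>2)"
    for e p1 p2 :: "real^'n" and X Y and P z0 \<kappa> K \<delta> :: real
  proof -
    \<comment> \<open>Components of \<open>e\<close> below \<open>2 * \<epsilon>\<close> will be
      dropped. Their squares sum to at most \<open>4 * n * \<epsilon>^2 = \<kappa> / 16\<close>, a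
      small part of the available concavity, while on the remaining components the hypothesis
      \<open>\<delta> \<le> P * \<epsilon>\<close> keeps the gradients at least
      \<open>P * \<epsilon>\<close> in size.\<close>
    define \<epsilon> where "\<epsilon> = sqrt (\<kappa> / (64 * n))"
    have \<epsilon>: "\<epsilon> > 0" "\<epsilon>\<^sup>2 = \<kappa> / (64 * n)" "\<delta> \<le> P * \<epsilon>" using \<kappa> n \<delta>P by (auto simp: \<epsilon>_def)
    have "\<epsilon> \<le> 1"
    proof (rule power2_le_imp_le)
      show "\<epsilon>\<^sup>2 \<le> 1\<^sup>2" using \<kappa> n unfolding \<epsilon>(2) by (simp add: divide_le_eq)
    qed simp
    then have "P * \<epsilon> \<le> P * 1" using P by (intro mult_left_mono) auto
    then have \<delta>P': "\<delta> \<le> P" using \<epsilon> by simp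
    define D where "D = Theta \<alpha> p1 ** X ** Theta \<alpha> p1 - Theta \<alpha> p2 ** Y ** Theta \<alpha> p2"
    have Dq: "\<xi> \<bullet> (D *v \<xi>) = (Theta \<alpha> p1 *v \<xi>) \<bullet> (X *v (Theta \<alpha> p1 *v \<xi>)) - (Theta \<alpha> p2 *v \<xi>) \<bullet> (Y *v (Theta \<alpha> p2 *v \<xi>))" for \<xi>
      unfolding D_def matrix_vector_mult_diff_rdistrib inner_diff_right Theta_conj_inner ..
    have pi: "\<bar>p1 $ i - P * e $ i\<bar> \<le> \<delta>" "\<bar>p2 $ i - P * e $ i\<bar> \<le> \<delta>" for i
      using component_le_norm_cart[of "p1 - P *\<^sub>R e" i] component_le_norm_cart[of "p2 - P *\<^sub>R e" i] p by auto
    have ei: "\<bar>P * e $ i\<bar> \<le> P" for i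
      using component_le_norm_cart[of e i] e P by (simp add: abs_mult)
    have p_up: "\<bar>p1 $ i\<bar> \<le> 2 * P" "\<bar>p2 $ i\<bar> \<le> 2 * P" for i
      using pi[of i] ei[of i] \<delta>P' by linarith+
    define t1 t2 where "t1 i = \<bar>p1 $ i\<bar> powr q" and "t2 i = \<bar>p2 $ i\<bar> powr q" for i
    have t_nn: "t1 i \<ge> 0" "t2 i \<ge> 0" for i by (auto simp: t1_def t2_def)
    have t_up: "t1 i \<le> (2 * P) powr q" "t2 i \<le> (2 * P) powr q" for i
      using p_up[of i] q by (auto simp: t1_def t2_def intro!: powr_mono2)
    \<comment> \<open>The weights are only Hoelder continuous in the gradient when
      \<open>q < 1\<close>; the exponent \<open>m\<close> covers this case and the Lipschitz one
      together, and its square yields the power \<open>2 * m\<close> in the conclusion.\<close>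
    define \<Delta> where "\<Delta> = M * (2 * P) powr (q - m) * (2 * \<delta>) powr m"
    have t_diff: "\<bar>t1 i - t2 i\<bar> \<le> \<Delta>" for i
      unfolding t1_def t2_def \<Delta>_def M_def m_def
    proof (rule powr_diff_le)
      show "\<bar>\<bar>p1 $ i\<bar> - \<bar>p2 $ i\<bar>\<bar> \<le> 2 * \<delta>" using pi[of i] by linarith
    qed (use p_up P q in auto)
    have th: "(Theta \<alpha> p1 *v \<xi>) $ i = t1 i * \<xi> $ i" "(Theta \<alpha> p2 *v \<xi>) $ i = t2 i * \<xi> $ i" for \<xi> i
      by (auto simp: Theta_nth t1_def t2_def q_def)
    define R where "R = (2 * P) powr \<alpha>"
    have R: "((2 * P) powr q)\<^sup>2 = R" using P by (simp add: R_def q(2) powr_powr[symmetric] powr_numeral mult.commute)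
    have nTh: "(norm (Theta \<alpha> p1 *v \<xi>))\<^sup>2 \<le> R * (norm \<xi>)\<^sup>2" "(norm (Theta \<alpha> p2 *v \<xi>))\<^sup>2 \<le> R * (norm \<xi>)\<^sup>2" for \<xi>
      unfolding R[symmetric]
      by (rule norm_le_scaled_cart; use t_up t_nn in \<open>auto simp: th abs_mult intro!: mult_right_mono\<close>)+
    have nK: "K * ((norm (Theta \<alpha> p1 *v \<xi>))\<^sup>2 + (norm (Theta \<alpha> p2 *v \<xi>))\<^sup>2) \<le> 2 * K * R * (norm \<xi>)\<^sup>2" for \<xi>
    proof -
      have "(norm (Theta \<alpha> p1 *v \<xi>))\<^sup>2 + (norm (Theta \<alpha> p2 *v \<xi>))\<^sup>2 \<le> 2 * R * (norm \<xi>)\<^sup>2" using nTh[of \<xi>] by simp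
      from mult_left_mono[OF this K] show ?thesis by (simp add: mult_ac)
    qed
    have nd: "(norm (Theta \<alpha> p1 *v \<xi> - Theta \<alpha> p2 *v \<xi>))\<^sup>2 \<le> \<Delta>\<^sup>2 * (norm \<xi>)\<^sup>2" for \<xi>
    proof (rule norm_le_scaled_cart)
      fix i
      show "\<bar>(Theta \<alpha> p1 *v \<xi> - Theta \<alpha> p2 *v \<xi>) $ i\<bar> \<le> \<Delta> * \<bar>\<xi> $ i\<bar>"
        using t_diff[of i] by (simp add: th abs_mult mult_right_mono flip: left_diff_distrib)
    qed
    define \<tau> where "\<tau> = 2 * z0 * \<Delta>\<^sup>2 + 2 * K * R"
    have \<tau>: "\<tau> \<ge> 0" using z0 K P by (simp add: \<tau>_def R_def)
    have up: "\<xi> \<bullet> (D *v \<xi>) \<le> \<tau> * (norm \<xi>)\<^sup>2" for \<xi>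
    proof -
      define d where "d = Theta \<alpha> p1 *v \<xi> - Theta \<alpha> p2 *v \<xi>"
      have "0 \<le> \<kappa> * z0 / 2 * (d \<bullet> e)\<^sup>2" "0 \<le> 2 * z0 * (d \<bullet> e)\<^sup>2" using \<kappa> z0 by auto
      moreover have "2 * z0 * (norm d)\<^sup>2 \<le> 2 * z0 * (\<Delta>\<^sup>2 * (norm \<xi>)\<^sup>2)"
        using nd[of \<xi>] z0 unfolding d_def by (intro mult_left_mono) auto
      ultimately show ?thesis
        using form[of "Theta \<alpha> p1 *v \<xi>" "Theta \<alpha> p2 *v \<xi>"] nK[of \<xi>]
        unfolding Dq d_def[symmetric] \<tau>_def by (simp add: algebra_simps)
    qed
    define \<xi> where "\<xi> = (\<chi> i. if 2 * \<epsilon> \<le> \<bar>e $ i\<bar> then 2 * e $ i / (t1 i + t2 i) else 0)"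
    define eI where "eI = (\<chi> i. if 2 * \<epsilon> \<le> \<bar>e $ i\<bar> then e $ i else 0)"
    have t_low: "(P * \<epsilon>) powr q \<le> t1 i" "(P * \<epsilon>) powr q \<le> t2 i" if "2 * \<epsilon> \<le> \<bar>e $ i\<bar>" for i
    proof -
      have "P * (2 * \<epsilon>) \<le> \<bar>P * e $ i\<bar>" using that P by (simp add: abs_mult)
      then have "P * \<epsilon> \<le> \<bar>p1 $ i\<bar>" "P * \<epsilon> \<le> \<bar>p2 $ i\<bar>" using pi[of i] \<epsilon>(3) by linarith+
      then show "(P * \<epsilon>) powr q \<le> t1 i" "(P * \<epsilon>) powr q \<le> t2 i"
        using P \<epsilon> q by (auto simp: t1_def t2_def intro!: powr_mono2)
    qed
    define w where "w = (P * \<epsilon>) powr q"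
    have w: "w > 0" using P \<epsilon> by (simp add: w_def)
    have sumv: "Theta \<alpha> p1 *v \<xi> + Theta \<alpha> p2 *v \<xi> = 2 *\<^sub>R eI"
    proof -
      have "t1 i * (2 * e $ i / (t1 i + t2 i)) + t2 i * (2 * e $ i / (t1 i + t2 i)) = 2 * e $ i"
        if "2 * \<epsilon> \<le> \<bar>e $ i\<bar>" for i
      proof -
        have "t1 i + t2 i > 0" using t_low[OF that] w unfolding w_def by linarith
        then show ?thesis by (simp add: divide_simps) (simp add: algebra_simps)
      qed
      then show ?thesis by (simp add: vec_eq_iff th \<xi>_def eI_def)
    qed
    define E where "E = (norm eI)\<^sup>2"
    have eI_e: "eI \<bullet> e = E"
      unfolding E_def norm_power2_cart unfolding inner_vec_def by (intro sum.cong) (auto simp: eI_def power2_eq_square)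
    have Elow: "1 - \<kappa> / 16 \<le> E"
    proof -
      have "1 - E = (\<Sum>i\<in>UNIV. (e $ i)\<^sup>2 - (eI $ i)\<^sup>2)"
        using e norm_power2_cart[of e] unfolding E_def norm_power2_cart[of eI] by (simp add: sum_subtractf)
      also have "\<dots> \<le> (\<Sum>i\<in>(UNIV::'n set). (2 * \<epsilon>)\<^sup>2)"
      proof (rule sum_mono)
        fix i :: 'n
        show "(e $ i)\<^sup>2 - (eI $ i)\<^sup>2 \<le> (2 * \<epsilon>)\<^sup>2"
        proof (cases "2 * \<epsilon> \<le> \<bar>e $ i\<bar>")
          case False
          then have "\<bar>e $ i\<bar>\<^sup>2 \<le> (2 * \<epsilon>)\<^sup>2" by (intro power_mono) auto
          then show ?thesis using False by (simp add: eI_def)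
        qed (simp add: eI_def)
      qed
      also have "\<dots> = \<kappa> / 16" using n by (simp add: power_mult_distrib \<epsilon>(2) n_def)
      finally show ?thesis by simp
    qed
    have Eup: "E \<le> 1"
    proof -
      have "E \<le> 1\<^sup>2 * (norm e)\<^sup>2" unfolding E_def by (rule norm_le_scaled_cart) (auto simp: eI_def)
      then show ?thesis using e by simp
    qed
    have low: "\<xi> \<bullet> (D *v \<xi>) \<le> - \<kappa> * z0 + 2 * K * R * (norm \<xi>)\<^sup>2"
    proof -
      have D': "\<xi> \<bullet> (D *v \<xi>) = (Theta \<alpha> p1 *v \<xi>) \<bullet> (X *v (Theta \<alpha> p1 *v \<xi>))
          - (- (Theta \<alpha> p2 *v \<xi>)) \<bullet> (Y *v (- (Theta \<alpha> p2 *v \<xi>)))"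
        unfolding Dq by (simp add: linear_neg[OF matrix_vector_mul_linear])
      have diff: "Theta \<alpha> p1 *v \<xi> - - (Theta \<alpha> p2 *v \<xi>) = 2 *\<^sub>R eI" using sumv by simp
      have "\<xi> \<bullet> (D *v \<xi>) \<le> - (\<kappa> * z0 / 2) * (2 * E)\<^sup>2 + 2 * z0 * (4 * E - (2 * E)\<^sup>2) + 2 * K * R * (norm \<xi>)\<^sup>2"
        using form[of "Theta \<alpha> p1 *v \<xi>" "- (Theta \<alpha> p2 *v \<xi>)"] nK[of \<xi>]
        unfolding D' diff inner_scaleR_left eI_e norm_scaleR norm_minus_cancel
        by (simp add: E_def[symmetric] power_mult_distrib)
      \<comment> \<open>With \<open>E\<close> close to 1 the concave term contributes at least
        \<open>3 / 2 * \<kappa> * z0\<close>. The part of \<open>eI\<close> orthogonal to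
        \<open>e\<close>, present because components were dropped, costs at most
        \<open>8 * z0 * (\<kappa> / 16)\<close>, half of \<open>\<kappa> * z0\<close>.\<close>
      also have "- (\<kappa> * z0 / 2) * (2 * E)\<^sup>2 + 2 * z0 * (4 * E - (2 * E)\<^sup>2) \<le> - \<kappa> * z0"
      proof -
        have "15 / 16 \<le> E" using Elow \<kappa> by simp
        then have "(15 / 16) * (15 / 16) \<le> E * E" by (intro mult_mono) auto
        then have "\<kappa> * z0 * (2 * (E * E)) \<ge> \<kappa> * z0 * (3 / 2)" using \<kappa> z0 by (intro mult_left_mono) auto
        moreover have "E * (1 - E) \<le> 1 * (\<kappa> / 16)" using Elow Eup \<open>15 / 16 \<le> E\<close> by (intro mult_mono) auto
        then have "8 * z0 * (E * (1 - E)) \<le> 8 * z0 * (\<kappa> / 16)" using z0 by (intro mult_left_mono) auto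
        ultimately show ?thesis by (simp add: power2_eq_square algebra_simps)
      qed
      finally show ?thesis by simp
    qed
    \<comment> \<open>This converts the fixed amount \<open>- \<kappa> * z0\<close> into a multiple
      of \<open>(norm \<xi>)^2\<close>. The factor \<open>w^2\<close> is
      \<open>P powr \<alpha> * \<epsilon> powr \<alpha>\<close>, which is where the additional
      exponent \<open>\<alpha> / 2\<close> of \<kappa> arises.\<close>
    have \<xi>up: "w\<^sup>2 * (norm \<xi>)\<^sup>2 \<le> 1"
    proof -
      have "(norm \<xi>)\<^sup>2 \<le> (1 / w)\<^sup>2 * (norm e)\<^sup>2"
      proof (rule norm_le_scaled_cart)
        fix i
        show "\<bar>\<xi> $ i\<bar> \<le> 1 / w * \<bar>e $ i\<bar>"
        proof (cases "2 * \<epsilon> \<le> \<bar>e $ i\<bar>")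
          case True
          have t: "2 * w \<le> t1 i + t2 i" using t_low[OF True] unfolding w_def by linarith
          then have "\<bar>2 * e $ i / (t1 i + t2 i)\<bar> = 2 * \<bar>e $ i\<bar> / (t1 i + t2 i)" using w by (simp add: abs_mult abs_divide)
          also have "\<dots> \<le> 2 * \<bar>e $ i\<bar> / (2 * w)" using t w by (intro divide_left_mono) auto
          finally show ?thesis using True by (simp add: \<xi>_def)
        qed (use w in \<open>simp add: \<xi>_def\<close>)
      qed
      then show ?thesis using w e by (simp add: power_divide field_simps)
    qed
    have \<xi>0: "\<xi> \<noteq> 0"
    proof
      assume "\<xi> = 0"
      then have "eI = 0" using sumv by simp
      then show False using Elow \<kappa> by (simp add: E_def)
    qed
    have neg: "\<xi> \<bullet> (D *v \<xi>) \<le> - (\<kappa> * z0 * w\<^sup>2 - 2 * K * R) * (norm \<xi>)\<^sup>2"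
    proof -
      have "\<kappa> * z0 * (w\<^sup>2 * (norm \<xi>)\<^sup>2) \<le> \<kappa> * z0 * 1" using \<xi>up \<kappa> z0 by (intro mult_left_mono) auto
      then show ?thesis using low by (simp add: algebra_simps)
    qed
    have "Fp F \<alpha> p1 X - Fp F \<alpha> p2 Y \<le> A * n * \<tau> - a / n * (\<kappa> * z0 * w\<^sup>2 - 2 * K * R)"
      unfolding Fp_def n_def
      by (rule structural_F_diff_le[OF F sym_mat_Theta_conj[OF XY(1)] sym_mat_Theta_conj[OF XY(2)] \<tau> _ \<xi>0])
         (use up neg in \<open>auto simp: D_def\<close>)
    also have "w\<^sup>2 = P powr \<alpha> * (\<kappa> powr q * (1 / (64 * n)) powr q)"
    proof -
      have "w\<^sup>2 = (P * \<epsilon>) powr (q + q)" unfolding w_def power2_eq_square powr_add ..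
      also have "\<dots> = P powr \<alpha> * \<epsilon> powr (2 * q)" using P \<epsilon> by (simp add: powr_mult q(2))
      also have "\<epsilon> powr (2 * q) = (\<epsilon>\<^sup>2) powr q" using \<epsilon> by (simp add: powr_powr[symmetric] powr_numeral)
      also have "\<dots> = \<kappa> powr q * (1 / (64 * n)) powr q"
        unfolding \<epsilon>(2) using \<kappa> n by (simp add: powr_mult[symmetric])
      finally show ?thesis .
    qed
    also have R': "R = P powr \<alpha> * 2 powr \<alpha>" using P by (simp add: R_def powr_mult mult.commute)
    also have "\<tau> = P powr \<alpha> * (2 * z0 * M\<^sup>2 * 2 powr \<alpha> * (\<delta> / P) powr (2 * m) + 2 * K * 2 powr \<alpha>)"
    proof -
      have "\<Delta>\<^sup>2 = M\<^sup>2 * ((2 * P) powr (q - m + (q - m)) * (2 * \<delta>) powr (m + m))"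
        unfolding \<Delta>_def powr_add by (simp add: power2_eq_square)
      also have "(2 * P) powr (q - m + (q - m)) * (2 * \<delta>) powr (m + m) =
          (2 * P) powr \<alpha> * ((2 * \<delta>) powr (2 * m) / (2 * P) powr (2 * m))"
      proof -
        have "q - m + (q - m) = \<alpha> - 2 * m" "m + m = 2 * m" using q(2) by auto
        then show ?thesis by (simp only: powr_diff) simp
      qed
      also have "(2 * \<delta>) powr (2 * m) / (2 * P) powr (2 * m) = (\<delta> / P) powr (2 * m)"
        using P \<delta> by (simp add: powr_divide[symmetric])
      also have "(2 * P) powr \<alpha> = P powr \<alpha> * 2 powr \<alpha>" using P by (simp add: powr_mult mult.commute)
      finally show ?thesis unfolding \<tau>_def R' by (simp add: algebra_simps)
    qed
    also have "A * n * (P powr \<alpha> * (2 * z0 * M\<^sup>2 * 2 powr \<alpha> * (\<delta> / P) powr (2 * m) + 2 * K * 2 powr \<alpha>))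
        - a / n * (\<kappa> * z0 * (P powr \<alpha> * (\<kappa> powr q * (1 / (64 * n)) powr q)) - 2 * K * (P powr \<alpha> * 2 powr \<alpha>))
      = P powr \<alpha> * ((2 * A * n * M\<^sup>2 * 2 powr \<alpha>) * (z0 * (\<delta> / P) powr (2 * m))
        + (2 * A * n * 2 powr \<alpha> + 2 * a / n * 2 powr \<alpha>) * K - c1 * (z0 * (\<kappa> * \<kappa> powr q)))"
      using n by (simp add: c1_def field_simps)
    also have "\<dots> \<le> P powr \<alpha> * (C1 * (z0 * (\<delta> / P) powr (2 * m)) + C1 * K - c1 * (z0 * (\<kappa> * \<kappa> powr q)))"
      using C1pos z0 K
      by (intro mult_left_mono diff_right_mono add_mono mult_right_mono) (auto simp: C1_def)
    also have "\<kappa> * \<kappa> powr q = \<kappa> powr (1 + q)" using \<kappa> by (simp add: powr_add)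
    finally show ?thesis by (simp add: distrib_left)
  qed
  then show ?thesis
    unfolding m_def q_def n_def using c1 C1 by (intro exI[of _ c1] exI[of _ C1] conjI allI impI) auto
qed

section \<open>Doubling of variables\<close>

lemma selfadjoint_matrix:
  fixes X :: "real^'n \<Rightarrow> real^'n"
  assumes "selfadjoint X"
  shows "sym_mat (matrix X)" "matrix X *v a = X a"
proof -
  show m: "matrix X *v a = X a" for a
    by (rule matrix_works) (simp add: linear_matrix_vector_mul_eq selfadjointD(1)[OF assms])
  have "X (axis j 1) $ i = X (axis i 1) $ j" for i j
    using selfadjointD(2)[OF assms, of "axis i 1" "axis j 1"] by (simp add: inner_axis inner_axis')
  then show "sym_mat (matrix X)" by (simp add: sym_mat_def matrix_def transpose_def vec_eq_iff)
qed

lemma C2_on_quadratic: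
  fixes X :: "real^'n^'n"
  assumes "sym_mat X" "open U"
  shows "C2_on U (\<lambda>y. p \<bullet> (y - x) + ((y - x) \<bullet> (X *v (y - x))) / 2) (\<lambda>y. p + X *v (y - x)) (\<lambda>_. X)"
proof -
  have X: "((\<lambda>y. X *v (y - x)) has_derivative (\<lambda>h. X *v h)) (at y)" for y
    by (rule bounded_linear.has_derivative[OF matrix_vector_mul_bounded_linear])
       (auto intro!: derivative_eq_intros)
  have "((\<lambda>y. p \<bullet> (y - x) + ((y - x) \<bullet> (X *v (y - x))) / 2) has_derivative
      (\<lambda>h. (p + X *v (y - x)) \<bullet> h)) (at y)" for y
  proof -
    have "((\<lambda>y. p \<bullet> (y - x) + ((y - x) \<bullet> (X *v (y - x))) / 2) has_derivative
      (\<lambda>h. p \<bullet> h + ((y - x) \<bullet> (X *v h) + h \<bullet> (X *v (y - x))) / 2)) (at y)"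
      by (auto intro!: derivative_eq_intros X)
    moreover have "p \<bullet> h + ((y - x) \<bullet> (X *v h) + h \<bullet> (X *v (y - x))) / 2 = (p + X *v (y - x)) \<bullet> h" for h
      using sym_mat_inner[OF assms(1), of "y - x" h] by (simp add: inner_add_left inner_add_right inner_commute)
    ultimately show ?thesis by simp
  qed
  moreover have "((\<lambda>y. p + X *v (y - x)) has_derivative (\<lambda>h. X *v h)) (at y)" for y
    by (auto intro!: derivative_eq_intros X)
  ultimately show ?thesis using assms(2) by (simp add: C2_on_def)
qed

lemma visc_sub_quadratic:
  assumes "visc_sub F \<alpha> \<beta> b g S u" "open S" "x \<in> S" "sym_mat X" "r > 0"
    and "\<And>y. y \<in> S \<Longrightarrow> norm (y - x) \<le> r \<Longrightarrow> u y \<le> u x + p \<bullet> (y - x) + ((y - x) \<bullet> (X *v (y - x))) / 2"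
  shows "- Fp F \<alpha> p X + b x * norm p powr \<beta> \<le> g x"
proof -
  have "C2_on (S \<inter> ball x r) (\<lambda>y. p \<bullet> (y - x) + ((y - x) \<bullet> (X *v (y - x))) / 2) (\<lambda>y. p + X *v (y - x)) (\<lambda>_. X)"
    by (rule C2_on_quadratic) (use assms in auto)
  moreover have "u y - (p \<bullet> (y - x) + ((y - x) \<bullet> (X *v (y - x))) / 2) \<le>
      u x - (p \<bullet> (x - x) + ((x - x) \<bullet> (X *v (x - x))) / 2)" if "y \<in> S \<inter> ball x r" for y
    using assms(6)[of y] that by (auto simp: dist_norm norm_minus_commute)
  ultimately show ?thesis
    using assms(1,3,5) unfolding visc_sub_def
    by (auto dest!: bspec[OF _ assms(3)] spec[of _ "S \<inter> ball x r"]
      spec[of _ "\<lambda>y. p \<bullet> (y - x) + ((y - x) \<bullet> (X *v (y - x))) / 2"]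
      spec[of _ "\<lambda>y. p + X *v (y - x)"] spec[of _ "\<lambda>_. X"])
qed

lemma visc_super_quadratic:
  assumes "visc_super F \<alpha> \<beta> b f S v" "open S" "x \<in> S" "sym_mat X" "r > 0"
    and "\<And>y. y \<in> S \<Longrightarrow> norm (y - x) \<le> r \<Longrightarrow> v y \<ge> v x + p \<bullet> (y - x) + ((y - x) \<bullet> (X *v (y - x))) / 2"
  shows "- Fp F \<alpha> p X + b x * norm p powr \<beta> \<ge> f x"
proof -
  have "C2_on (S \<inter> ball x r) (\<lambda>y. p \<bullet> (y - x) + ((y - x) \<bullet> (X *v (y - x))) / 2) (\<lambda>y. p + X *v (y - x)) (\<lambda>_. X)"
    by (rule C2_on_quadratic) (use assms in auto)
  moreover have "v y - (p \<bullet> (y - x) + ((y - x) \<bullet> (X *v (y - x))) / 2) \<ge>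
      v x - (p \<bullet> (x - x) + ((x - x) \<bullet> (X *v (x - x))) / 2)" if "y \<in> S \<inter> ball x r" for y
    using assms(6)[of y] that by (auto simp: dist_norm norm_minus_commute)
  ultimately show ?thesis
    using assms(1,3,5) unfolding visc_super_def
    by (auto dest!: bspec[OF _ assms(3)] spec[of _ "S \<inter> ball x r"]
      spec[of _ "\<lambda>y. p \<bullet> (y - x) + ((y - x) \<bullet> (X *v (y - x))) / 2"]
      spec[of _ "\<lambda>y. p + X *v (y - x)"] spec[of _ "\<lambda>_. X"])
qed

lemma usc_on_translate:
  fixes p :: "real^'n"
  assumes "usc_on S u" "\<And>a. a \<in> C \<Longrightarrow> x + a \<in> S" "a \<in> C" "e > 0"
  shows "\<forall>\<^sub>F c in at a within C. u (x + c) - p \<bullet> c < u (x + a) - p \<bullet> a + e"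
proof -
  have "filterlim (\<lambda>c. x + c) (at (x + a) within S) (at a within C)"
    unfolding filterlim_at using assms(2)
    by (auto intro!: tendsto_intros simp: eventually_at_filter)
  moreover have "\<forall>\<^sub>F y in at (x + a) within S. u y < u (x + a) + e / 2"
    using assms unfolding usc_on_def by auto
  ultimately have "\<forall>\<^sub>F c in at a within C. u (x + c) < u (x + a) + e / 2"
    by (rule eventually_compose_filterlim[rotated])
  moreover have "((\<lambda>c. p \<bullet> c) \<longlongrightarrow> p \<bullet> a) (at a within C)" by (intro tendsto_intros)
  then have "\<forall>\<^sub>F c in at a within C. p \<bullet> c > p \<bullet> a - e / 2"
    by (rule order_tendstoD) (use assms in simp)
  ultimately show ?thesis by eventually_elim linarith
qed

lemma lsc_on_imp_usc_on_minus: "lsc_on S v \<Longrightarrow> usc_on S (\<lambda>x. - v x)"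
  unfolding lsc_on_def usc_on_def by (force elim: eventually_mono)

text \<open>The theorem on sums, applied to \<open>u\<close> and \<open>- v\<close> recentred at the
  maximum with their first-order terms removed. The hypothesis has coefficients
  \<open>3 / 4 * Q\<close>, \<open>3 / 2 * z0\<close> and \<open>2 * L\<close> where the form used
  in the proof has \<open>Q / 2\<close>, \<open>2 * z0\<close> and \<open>4 * L\<close>: this margin
  allows the form to be evaluated at a nearby \<zeta> instead of \<open>(a, b)\<close>.\<close>

lemma doubling_jets:
  fixes u v b f g :: "real^'n \<Rightarrow> real" and xb yb e l1 l2 :: "real^'n"
  assumes sub: "visc_sub F \<alpha> \<beta> b g S u" and super: "visc_super F \<alpha> \<beta> b f S v"
    and usc: "usc_on S u" and lsc: "lsc_on S v" and S: "open S" "xb \<in> S" "yb \<in> S"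
    and e: "norm e = 1" and Q: "0 \<le> Q" "Q \<le> z0" and L: "L > 0" and \<rho>: "\<rho> > 0" and \<mu>: "\<mu> > 0"
    and max: "\<And>a b. norm a \<le> \<rho> \<Longrightarrow> norm b \<le> \<rho> \<Longrightarrow>
      u (xb + a) - v (yb + b) \<le> u xb - v yb + (P *\<^sub>R e + l1) \<bullet> a - (P *\<^sub>R e - l2) \<bullet> b
        + (- (3 / 4 * Q) * ((a - b) \<bullet> e)\<^sup>2 + 3 / 2 * z0 * ((norm (a - b))\<^sup>2 - ((a - b) \<bullet> e)\<^sup>2)
           + 2 * L * ((norm a)\<^sup>2 + (norm b)\<^sup>2)) / 2"
  shows "\<exists>x\<in>S. \<exists>y\<in>S. \<exists>p q X Y. norm (x - xb) \<le> \<mu> \<and> norm (y - yb) \<le> \<mu> \<and>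
    norm (p - (P *\<^sub>R e + l1)) \<le> \<mu> \<and> norm (q - (P *\<^sub>R e - l2)) \<le> \<mu> \<and> sym_mat X \<and> sym_mat Y \<and>
    - Fp F \<alpha> p X + b x * norm p powr \<beta> \<le> g x \<and> - Fp F \<alpha> q Y + b y * norm q powr \<beta> \<ge> f y \<and>
    (\<forall>a b. a \<bullet> (X *v a) - b \<bullet> (Y *v b) \<le> - (Q / 2) * ((a - b) \<bullet> e)\<^sup>2
      + 2 * z0 * ((norm (a - b))\<^sup>2 - ((a - b) \<bullet> e)\<^sup>2) + 5 * L * ((norm a)\<^sup>2 + (norm b)\<^sup>2))"
proof -
  obtain r1 where r1: "r1 > 0" "ball xb r1 \<subseteq> S" using S openE by blast
  obtain r2 where r2: "r2 > 0" "ball yb r2 \<subseteq> S" using S openE by blast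
  define r where "r = min \<rho> (min r1 r2) / 2"
  have r: "r > 0" "r < \<rho>" "r < r1" "r < r2" using r1 r2 \<rho> by (auto simp: r_def)
  define C where "C = cball (0::real^'n) r"
  have C: "compact C" "C \<noteq> {}" "0 \<in> C" using r by (auto simp: C_def)
  have inS: "xb + a \<in> S" "yb + a \<in> S" if "a \<in> C" for a
    using that r1 r2 r by (auto simp: C_def subset_iff dist_norm)
  define p0 q0 where "p0 = P *\<^sub>R e + l1" and "q0 = P *\<^sub>R e - l2"
  define u1 where "u1 a = u (xb + a) - p0 \<bullet> a" for a
  define u2 where "u2 b = - v (yb + b) - (- q0) \<bullet> b" for b
  have u1: "usc_compact C u1"
    unfolding u1_def by standard (use C usc_on_translate[OF usc inS(1)] in auto)
  have u2: "usc_compact C u2"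
  proof
    show "\<forall>\<^sub>F c in at a within C. u2 c < u2 a + e" if "a \<in> C" "e > 0" for a e
      unfolding u2_def by (rule usc_on_translate[OF lsc_on_imp_usc_on_minus[OF lsc] inS(2) that])
  qed (use C in auto)
  have z0: "z0 \<ge> 0" using Q by simp
  define Sd where "Sd d = (- (Q / 2) * (d \<bullet> e)) *\<^sub>R e + (2 * z0) *\<^sub>R (d - (d \<bullet> e) *\<^sub>R e)" for d
  have Sd: "linear Sd" "c \<bullet> Sd d = Sd c \<bullet> d" for c d
  proof -
    show "linear Sd"
      by (rule linearI) (simp_all add: Sd_def inner_add_left algebra_simps)
    show "c \<bullet> Sd d = Sd c \<bullet> d"
      by (simp add: Sd_def inner_add_left inner_add_right inner_diff_left inner_diff_right inner_commute algebra_simps)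
  qed
  have Sdq: "d \<bullet> Sd d = - (Q / 2) * (d \<bullet> e)\<^sup>2 + 2 * z0 * ((norm d)\<^sup>2 - (d \<bullet> e)\<^sup>2)" for d
    by (simp add: Sd_def inner_add_right inner_diff_right dot_square_norm inner_commute power2_eq_square algebra_simps)
  define T where "T z = (Sd (fst z - snd z) + (4 * L) *\<^sub>R fst z, - Sd (fst z - snd z) + (4 * L) *\<^sub>R snd z)" for z
  have T: "selfadjoint T"
    unfolding selfadjoint_def
  proof (intro conjI allI)
    have [simp]: "Sd (c - d) = Sd c - Sd d" "Sd (c + d) = Sd c + Sd d" "Sd (k *\<^sub>R c) = k *\<^sub>R Sd c" for c d k
      using Sd(1) by (simp_all add: linear_diff linear_add linear_scale)
    show "linear T" by (rule linearI) (simp_all add: T_def algebra_simps)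
    fix w z :: "(real^'n) \<times> (real^'n)"
    show "w \<bullet> T z = T w \<bullet> z"
      using Sd(2) by (simp add: T_def inner_prod_def inner_add_left inner_add_right inner_diff_left inner_diff_right)
  qed
  have Tq: "z \<bullet> T z = (fst z - snd z) \<bullet> Sd (fst z - snd z) + 4 * L * ((norm (fst z))\<^sup>2 + (norm (snd z))\<^sup>2)" for z
    by (simp add: T_def inner_prod_def inner_add_right inner_diff_left dot_square_norm algebra_simps)
  \<comment> \<open>The price of moving from \<open>(a, b)\<close> to \<zeta>. The difference vector
    changes by \<open>k\<close> with \<open>(norm k)^2 \<le> 2 * N1\<close>, at a cost of
    \<open>6 * z0 * (norm k)^2\<close>, and the localising terms add
    \<open>4 * L * N1\<close>.\<close>
  define l where "l = 12 * z0 + 4 * L"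
  have l: "l > 0" using z0 L by (simp add: l_def add_nonneg_pos)
  have le: "u1 a + u2 b \<le> u1 0 + u2 0 + (\<zeta> \<bullet> T \<zeta>) / 2 + l / 2 * (norm ((a, b) - \<zeta>))\<^sup>2"
    if ab: "a \<in> C" "b \<in> C" for a b \<zeta>
  proof -
    define h h' k where "h = a - b" and "h' = fst \<zeta> - snd \<zeta>" and "k = h - h'"
    define N1 N2 where "N1 = (norm (a - fst \<zeta>))\<^sup>2 + (norm (b - snd \<zeta>))\<^sup>2" and "N2 = (norm (fst \<zeta>))\<^sup>2 + (norm (snd \<zeta>))\<^sup>2"
    define pr where "pr d = d - (d \<bullet> e) *\<^sub>R e" for d
    have ee: "e \<bullet> e = 1" using e by (simp add: dot_square_norm)
    have pr: "(norm (pr d))\<^sup>2 = (norm d)\<^sup>2 - (d \<bullet> e)\<^sup>2" for d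
      unfolding power2_norm_eq_inner pr_def
      by (simp add: inner_diff_left inner_diff_right inner_commute ee power2_eq_square algebra_simps)
    have sq2: "(norm (c + d))\<^sup>2 \<le> 2 * (norm c)\<^sup>2 + 2 * (norm d)\<^sup>2" for c d :: "real^'n"
    proof -
      have "2 * (norm c)\<^sup>2 + 2 * (norm d)\<^sup>2 - (norm (c + d))\<^sup>2 = (norm (c - d))\<^sup>2"
        unfolding power2_norm_eq_inner by (simp add: inner_commute algebra_simps)
      then show ?thesis by (metis diff_ge_0_iff_ge zero_le_power2)
    qed
    \<comment> \<open>Young's inequality with the weights for which \<open>3 / 2 * z0\<close>
      becomes exactly \<open>2 * z0\<close>; the bound \<open>t\<close> below does the same from
      \<open>3 / 4 * Q\<close> to \<open>Q / 2\<close>.\<close>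
    have sq4: "(norm (c + d))\<^sup>2 \<le> 4 / 3 * (norm c)\<^sup>2 + 4 * (norm d)\<^sup>2" for c d :: "real^'n"
    proof -
      have "4 / 3 * (norm c)\<^sup>2 + 4 * (norm d)\<^sup>2 - (norm (c + d))\<^sup>2 = 3 * (norm ((1 / 3) *\<^sub>R c - d))\<^sup>2"
        unfolding power2_norm_eq_inner by (simp add: inner_commute algebra_simps)
      then show ?thesis by (smt (verit) zero_le_power2)
    qed
    have hk: "h = h' + k" by (simp add: k_def)
    have kN: "(norm k)\<^sup>2 \<le> 2 * N1"
      using sq2[of "a - fst \<zeta>" "- (b - snd \<zeta>)"]
      by (simp add: k_def h_def h'_def N1_def algebra_simps del: norm_minus_cancel) (simp add: norm_minus_commute)
    have t: "(h \<bullet> e)\<^sup>2 \<ge> 2 / 3 * (h' \<bullet> e)\<^sup>2 - 2 * (k \<bullet> e)\<^sup>2"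
    proof -
      have "(h \<bullet> e)\<^sup>2 - (2 / 3 * (h' \<bullet> e)\<^sup>2 - 2 * (k \<bullet> e)\<^sup>2) = 3 * (1 / 3 * (h' \<bullet> e) + k \<bullet> e)\<^sup>2"
        unfolding hk by (simp add: inner_add_left power2_eq_square algebra_simps)
      then show ?thesis by (smt (verit) zero_le_power2)
    qed
    have "pr h = pr h' + pr k" unfolding hk pr_def by (simp add: inner_add_left algebra_simps)
    then have hp: "(norm (pr h))\<^sup>2 \<le> 4 / 3 * (norm (pr h'))\<^sup>2 + 4 * (norm (pr k))\<^sup>2"
      using sq4[of "pr h'" "pr k"] by simp
    have "3 / 4 * Q * (2 / 3 * (h' \<bullet> e)\<^sup>2 - 2 * (k \<bullet> e)\<^sup>2) \<le> 3 / 4 * Q * (h \<bullet> e)\<^sup>2"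
      using t Q by (intro mult_left_mono) auto
    moreover have "3 / 2 * z0 * (norm (pr h))\<^sup>2 \<le> 3 / 2 * z0 * (4 / 3 * (norm (pr h'))\<^sup>2 + 4 * (norm (pr k))\<^sup>2)"
      using hp z0 by (intro mult_left_mono) auto
    moreover have "3 / 2 * Q * (k \<bullet> e)\<^sup>2 \<le> 6 * z0 * (k \<bullet> e)\<^sup>2" using Q by (intro mult_right_mono) auto
    moreover have "6 * z0 * (norm k)\<^sup>2 \<le> 6 * z0 * (2 * N1)" using kN z0 by (intro mult_left_mono) auto
    moreover have "2 * L * ((norm a)\<^sup>2 + (norm b)\<^sup>2) \<le> 2 * L * (2 * N2 + 2 * N1)"
      using sq2[of "fst \<zeta>" "a - fst \<zeta>"] sq2[of "snd \<zeta>" "b - snd \<zeta>"] L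
      by (intro mult_left_mono) (auto simp: N1_def N2_def)
    moreover have "z0 * (norm (pr k))\<^sup>2 = z0 * (norm k)\<^sup>2 - z0 * (k \<bullet> e)\<^sup>2"
      unfolding pr by (simp add: right_diff_distrib)
    ultimately have fin: "- (3 / 4 * Q) * (h \<bullet> e)\<^sup>2 + 3 / 2 * z0 * (norm (pr h))\<^sup>2 + 2 * L * ((norm a)\<^sup>2 + (norm b)\<^sup>2)
      \<le> - (Q / 2) * (h' \<bullet> e)\<^sup>2 + 2 * z0 * (norm (pr h'))\<^sup>2 + 4 * L * N2 + l * N1"
      unfolding l_def by (simp add: algebra_simps)
    have T1: "(norm ((a, b) - \<zeta>))\<^sup>2 = N1" by (cases \<zeta>) (simp add: norm_Pair N1_def)
    have T2: "\<zeta> \<bullet> T \<zeta> = - (Q / 2) * (h' \<bullet> e)\<^sup>2 + 2 * z0 * (norm (pr h'))\<^sup>2 + 4 * L * N2"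
      unfolding Tq Sdq pr h'_def N2_def ..
    have "u1 a + u2 b \<le> u1 0 + u2 0 + (- (3 / 4 * Q) * (h \<bullet> e)\<^sup>2 + 3 / 2 * z0 * (norm (pr h))\<^sup>2
        + 2 * L * ((norm a)\<^sup>2 + (norm b)\<^sup>2)) / 2"
      using max[of a b] ab r unfolding pr h_def p0_def[symmetric] q0_def[symmetric]
      by (simp add: u1_def u2_def C_def)
    moreover have "U \<le> V + X / 2 \<Longrightarrow> X \<le> Y + l * N1 \<Longrightarrow> U \<le> V + Y / 2 + l / 2 * N1" for U V X Y
      by (simp add: field_simps)
    ultimately show ?thesis unfolding T1 T2 using fin by blast
  qed
  \<comment> \<open>Being at most \<open>L\<close>, it raises \<open>4 * L\<close> only to
    \<open>5 * L\<close>; being at most \<open>r / 2\<close>, it keeps the touching points inside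
    \<open>C\<close>, so that touching relative to \<open>C\<close> is touching in
    \<open>S\<close>.\<close>
  define \<mu>' where "\<mu>' = min (min \<mu> L) (r / 2)"
  have \<mu>': "\<mu>' > 0" "\<mu>' \<le> \<mu>" "\<mu>' \<le> L" "\<mu>' < r" using \<mu> L r by (auto simp: \<mu>'_def min_def)
  obtain x y p q X Y where x: "x \<in> C" "norm x \<le> \<mu>'" and y: "y \<in> C" "norm y \<le> \<mu>'"
    and pq: "norm p \<le> \<mu>'" "norm q \<le> \<mu>'" and XY: "selfadjoint X" "selfadjoint Y"
    and tx: "\<exists>r>0. \<forall>x'\<in>C. norm (x' - x) \<le> r \<longrightarrow> u1 x' \<le> u1 x + p \<bullet> (x' - x) + ((x' - x) \<bullet> X (x' - x)) / 2"
    and ty: "\<exists>r>0. \<forall>y'\<in>C. norm (y' - y) \<le> r \<longrightarrow> u2 y' \<le> u2 y + q \<bullet> (y' - y) + ((y' - y) \<bullet> Y (y' - y)) / 2"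
    and fm: "\<And>a b. a \<bullet> X a + b \<bullet> Y b \<le> (a, b) \<bullet> T (a, b) + \<mu>' * ((norm a)\<^sup>2 + (norm b)\<^sup>2)"
    using theorem_on_sums[OF u1 C(3) u2 C(3) T l \<mu>'(1) le] by blast
  obtain rx where rx: "rx > 0" "\<And>x'. x' \<in> C \<Longrightarrow> norm (x' - x) \<le> rx \<Longrightarrow>
    u1 x' \<le> u1 x + p \<bullet> (x' - x) + ((x' - x) \<bullet> X (x' - x)) / 2" using tx by blast
  obtain ry where ry: "ry > 0" "\<And>x'. x' \<in> C \<Longrightarrow> norm (x' - y) \<le> ry \<Longrightarrow>
    u2 x' \<le> u2 y + q \<bullet> (x' - y) + ((x' - y) \<bullet> Y (x' - y)) / 2" using ty by blast
  define mX mY where "mX = matrix X" and "mY = - matrix Y"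
  have sX: "sym_mat mX" "mX *v a = X a" for a unfolding mX_def by (rule selfadjoint_matrix[OF XY(1)])+
  have sY: "sym_mat mY" "mY *v a = - Y a" for a
  proof -
    show "sym_mat mY"
      using selfadjoint_matrix(1)[OF XY(2)] by (simp add: mY_def sym_mat_def transpose_def vec_eq_iff)
    show "mY *v a = - Y a"
      using selfadjoint_matrix(2)[OF XY(2), of a] matrix_vector_mult_diff_rdistrib[of 0 "matrix Y" a]
      by (simp add: mY_def)
  qed
  have "- Fp F \<alpha> (p0 + p) mX + b (xb + x) * norm (p0 + p) powr \<beta> \<le> g (xb + x)"
  proof (rule visc_sub_quadratic[OF sub S(1) inS(1)[OF x(1)] sX(1), where r = "min rx (r - \<mu>')"])
    show "min rx (r - \<mu>') > 0" using rx \<mu>' by simp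
    fix z assume z: "z \<in> S" "norm (z - (xb + x)) \<le> min rx (r - \<mu>')"
    define c where "c = z - xb"
    have c: "c - x = z - (xb + x)" "z = xb + c" by (auto simp: c_def)
    have "c \<in> C" using norm_triangle_ineq[of "c - x" x] z x c(1) by (simp add: C_def)
    then have "u1 c \<le> u1 x + p \<bullet> (c - x) + ((c - x) \<bullet> X (c - x)) / 2"
    proof (rule rx)
      show "norm (c - x) \<le> rx" unfolding c(1) using z by simp
    qed
    then show "u z \<le> u (xb + x) + (p0 + p) \<bullet> (z - (xb + x)) + (z - (xb + x)) \<bullet> (mX *v (z - (xb + x))) / 2"
      unfolding c(1)[symmetric] sX(2) unfolding c(2) by (simp add: u1_def inner_add_left inner_diff_right)
  qed
  moreover have "- Fp F \<alpha> (q0 - q) mY + b (yb + y) * norm (q0 - q) powr \<beta> \<ge> f (yb + y)"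
  proof (rule visc_super_quadratic[OF super S(1) inS(2)[OF y(1)] sY(1), where r = "min ry (r - \<mu>')"])
    show "min ry (r - \<mu>') > 0" using ry \<mu>' by simp
    fix z assume z: "z \<in> S" "norm (z - (yb + y)) \<le> min ry (r - \<mu>')"
    define c where "c = z - yb"
    have c: "c - y = z - (yb + y)" "z = yb + c" by (auto simp: c_def)
    have "c \<in> C" using norm_triangle_ineq[of "c - y" y] z y c(1) by (simp add: C_def)
    then have "u2 c \<le> u2 y + q \<bullet> (c - y) + ((c - y) \<bullet> Y (c - y)) / 2"
    proof (rule ry)
      show "norm (c - y) \<le> ry" unfolding c(1) using z by simp
    qed
    then show "v (yb + y) + (q0 - q) \<bullet> (z - (yb + y)) + (z - (yb + y)) \<bullet> (mY *v (z - (yb + y))) / 2 \<le> v z"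
      unfolding c(1)[symmetric] sY(2) unfolding c(2) by (simp add: u2_def inner_diff_left[of q0 q] inner_diff_right[of q0] inner_diff_right[of q])
  qed
  moreover have "a \<bullet> (mX *v a) - b \<bullet> (mY *v b) \<le> - (Q / 2) * ((a - b) \<bullet> e)\<^sup>2
      + 2 * z0 * ((norm (a - b))\<^sup>2 - ((a - b) \<bullet> e)\<^sup>2) + 5 * L * ((norm a)\<^sup>2 + (norm b)\<^sup>2)" for a b
  proof -
    have "\<mu>' * ((norm a)\<^sup>2 + (norm b)\<^sup>2) \<le> L * ((norm a)\<^sup>2 + (norm b)\<^sup>2)"
      using \<mu>' by (intro mult_right_mono) auto
    then show ?thesis using fm[of a b] unfolding sX sY Tq fst_conv snd_conv Sdq by simp
  qed
  ultimately show ?thesis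
    using inS(1)[OF x(1)] inS(2)[OF y(1)] x y pq \<mu>' sX(1) sY(1)
    by (intro bexI[of _ "xb + x"] bexI[of _ "yb + y"] exI[of _ "p0 + p"] exI[of _ "q0 - q"] exI[of _ mX] exI[of _ mY])
       (auto simp: p0_def q0_def)
qed

section \<open>Second-order upper bounds for radial functions\<close>

lemma concave_taylor:
  fixes \<omega> :: "real \<Rightarrow> real"
  assumes D1: "\<And>t. t \<in> {0<..<1} \<Longrightarrow> (\<omega> has_real_derivative \<omega>1 t) (at t)"
    and D2: "\<And>t. t \<in> {0<..<1} \<Longrightarrow> (\<omega>1 has_real_derivative \<omega>2 t) (at t)"
    and s: "s \<in> {0<..<1}" and x: "x \<in> {0<..<1}"
    and le: "\<And>t. min s x \<le> t \<Longrightarrow> t \<le> max s x \<Longrightarrow> \<omega>2 t \<le> k"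
  shows "\<omega> x \<le> \<omega> s + \<omega>1 s * (x - s) + k / 2 * (x - s)\<^sup>2"
proof -
  define f where "f t = \<omega> t - \<omega>1 s * (t - s) - k / 2 * (t - s)\<^sup>2" for t
  have f': "(f has_real_derivative (\<omega>1 t - \<omega>1 s - k * (t - s))) (at t)" if "t \<in> {0<..<1}" for t
    unfolding f_def using D1[OF that] by (auto intro!: derivative_eq_intros)
  have "f x \<le> f s"
  proof (cases x s rule: linorder_cases)
    case less
    obtain z where z: "x < z" "z < s" "f s - f x = (s - x) * (\<omega>1 z - \<omega>1 s - k * (z - s))"
      using MVT2[OF less, of f "\<lambda>t. \<omega>1 t - \<omega>1 s - k * (t - s)", OF f'] s x by auto
    obtain y where y: "z < y" "y < s" "\<omega>1 s - \<omega>1 z = (s - z) * \<omega>2 y"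
      using MVT2[OF z(2), of \<omega>1 \<omega>2, OF D2] s x z by auto
    have "(s - z) * \<omega>2 y \<le> (s - z) * k" using y z less by (intro mult_left_mono le) auto
    then have "\<omega>1 z - \<omega>1 s - k * (z - s) \<ge> 0" using y by (simp add: algebra_simps)
    then have "f s - f x \<ge> 0" unfolding z(3) using less by (intro mult_nonneg_nonneg) auto
    then show ?thesis by simp
  next
    case greater
    obtain z where z: "s < z" "z < x" "f x - f s = (x - s) * (\<omega>1 z - \<omega>1 s - k * (z - s))"
      using MVT2[OF greater, of f "\<lambda>t. \<omega>1 t - \<omega>1 s - k * (t - s)", OF f'] s x by auto
    obtain y where y: "s < y" "y < z" "\<omega>1 z - \<omega>1 s = (z - s) * \<omega>2 y"
      using MVT2[OF z(1), of \<omega>1 \<omega>2, OF D2] s x z by auto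
    have "(z - s) * \<omega>2 y \<le> (z - s) * k" using y z greater by (intro mult_left_mono le) auto
    then have "\<omega>1 z - \<omega>1 s - k * (z - s) \<le> 0" using y by (simp add: algebra_simps)
    then have "f x - f s \<le> 0" unfolding z(3) using greater by (intro mult_nonneg_nonpos) auto
    then show ?thesis by simp
  qed simp
  then show ?thesis by (simp add: f_def)
qed

text \<open>Exact Taylor coefficients would be \<open>\<omega>2 s / 2\<close> and
  \<open>\<omega>1 s / (2 * s)\<close>. The factors 3/4 and 3/2 weaken them, which absorbs the
  variation of \<open>\<omega>2\<close> and of \<open>\<omega>1 t / t\<close> on a small ball and
  leaves an inequality without remainder.\<close>

lemma radial_second_order:
  fixes z :: "'a::real_inner"
  assumes D1: "\<And>t. t \<in> {0<..<1} \<Longrightarrow> (\<omega> has_real_derivative \<omega>1 t) (at t)"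
    and D2: "\<And>t. t \<in> {0<..<1} \<Longrightarrow> (\<omega>1 has_real_derivative \<omega>2 t) (at t)"
    and pos: "\<And>t. t \<in> {0<..<1} \<Longrightarrow> \<omega>1 t > 0" and neg: "\<And>t. t \<in> {0<..<1} \<Longrightarrow> \<omega>2 t < 0"
    and cont: "isCont \<omega>2 (norm z)" and z: "z \<noteq> 0" "norm z < 1"
  defines "s \<equiv> norm z" and "e \<equiv> z /\<^sub>R norm z"
  shows "\<exists>\<rho>>0. \<forall>h. norm h \<le> \<rho> \<longrightarrow> \<omega> (norm (z + h)) \<le> \<omega> s + \<omega>1 s * (h \<bullet> e)
    + 3 / 8 * \<omega>2 s * (h \<bullet> e)\<^sup>2 + 3 / 4 * (\<omega>1 s / s) * ((norm h)\<^sup>2 - (h \<bullet> e)\<^sup>2)"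
proof -
  have s: "s \<in> {0<..<1}" "s > 0" using z by (auto simp: s_def)
  have e: "norm e = 1" "z = s *\<^sub>R e" using z by (auto simp: e_def s_def)
  have "isCont \<omega>1 s" using D2[OF s(1)] by (rule DERIV_isCont)
  then have "isCont (\<lambda>t. \<omega>1 t / t) s" using s by (intro continuous_intros) auto
  then have "((\<lambda>t. \<omega>1 t / t) \<longlongrightarrow> \<omega>1 s / s) (at s)" by (simp add: isCont_def)
  moreover have "\<omega>1 s / s < 3 / 2 * (\<omega>1 s / s)" using divide_pos_pos[OF pos[OF s(1)] s(2)] by linarith
  ultimately have "\<forall>\<^sub>F t in at s. \<omega>1 t / t < 3 / 2 * (\<omega>1 s / s)" by (rule order_tendstoD)
  then obtain r1 where r1: "r1 > 0" "\<And>t. t \<noteq> s \<Longrightarrow> \<bar>t - s\<bar> < r1 \<Longrightarrow> \<omega>1 t / t < 3 / 2 * (\<omega>1 s / s)"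
    unfolding eventually_at dist_real_def by auto
  have "(\<omega>2 \<longlongrightarrow> \<omega>2 s) (at s)" using cont by (simp add: isCont_def s_def)
  moreover have "\<omega>2 s < 3 / 4 * \<omega>2 s" using neg[OF s(1)] by simp
  ultimately have "\<forall>\<^sub>F t in at s. \<omega>2 t < 3 / 4 * \<omega>2 s" by (rule order_tendstoD)
  then obtain r2 where r2: "r2 > 0" "\<And>t. t \<noteq> s \<Longrightarrow> \<bar>t - s\<bar> < r2 \<Longrightarrow> \<omega>2 t < 3 / 4 * \<omega>2 s"
    unfolding eventually_at dist_real_def by auto
  define \<rho> where "\<rho> = min (min r1 r2) (min s (1 - s)) / 4"
  have \<rho>: "\<rho> > 0" "\<rho> < r1" "\<rho> < r2" "4 * \<rho> \<le> s" "4 * \<rho> \<le> 1 - s"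
    using r1 r2 s by (auto simp: \<rho>_def)
  have "\<omega> (norm (z + h)) \<le> \<omega> s + \<omega>1 s * (h \<bullet> e)
    + 3 / 8 * \<omega>2 s * (h \<bullet> e)\<^sup>2 + 3 / 4 * (\<omega>1 s / s) * ((norm h)\<^sup>2 - (h \<bullet> e)\<^sup>2)" if h: "norm h \<le> \<rho>" for h
  proof -
    define t k where "t = h \<bullet> e" and "k = (norm h)\<^sup>2 - (h \<bullet> e)\<^sup>2"
    have t: "\<bar>t\<bar> \<le> \<rho>" using Cauchy_Schwarz_ineq2[of h e] h e by (simp add: t_def)
    have "\<bar>h \<bullet> e\<bar> \<le> norm h" using Cauchy_Schwarz_ineq2[of h e] e by simp
    then have "\<bar>h \<bullet> e\<bar>\<^sup>2 \<le> (norm h)\<^sup>2" by (rule power_mono) simp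
    then have k0: "k \<ge> 0" by (simp add: k_def)
    have "(norm h)\<^sup>2 \<le> \<rho>\<^sup>2" using h by (intro power_mono) auto
    then have k1: "k \<le> \<rho>\<^sup>2" unfolding k_def by (smt (verit) zero_le_power2)
    define x where "x = s + t"
    have x: "s / 2 \<le> x" "x > 0" "x \<le> s + \<rho>" "\<bar>x - s\<bar> \<le> \<rho>" using t \<rho> s by (auto simp: x_def)
    \<comment> \<open>An upper bound for the length of \<open>z + h\<close>, from the square root of
      \<open>x^2 + k\<close>. Since \<omega> is increasing, the component \<open>x\<close> along
      \<open>e\<close> and the orthogonal correction \<open>R - x\<close> can be treated one after
      the other.\<close>
    define R where "R = x + k / (2 * x)"
    have kx: "k / (2 * x) \<ge> 0" using k0 x by simp
    have "k / (2 * x) \<le> \<rho>\<^sup>2 / s"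
      using k0 k1 x s by (intro frac_le) auto
    also have "\<dots> \<le> \<rho>" using \<rho> s by (simp add: power2_eq_square divide_le_eq)
    finally have R: "x \<le> R" "R < 1" using kx x \<rho> by (auto simp: R_def)
    have n2: "(norm (z + h))\<^sup>2 = x\<^sup>2 + k"
    proof -
      have "(norm (z + h))\<^sup>2 = s\<^sup>2 + 2 * (s * t) + (norm h)\<^sup>2"
        unfolding e(2) power2_norm_eq_inner using e(1)
        by (simp add: inner_add inner_commute t_def power2_eq_square norm_eq_1)
      then show ?thesis by (simp add: x_def k_def t_def power2_sum)
    qed
    have nx: "x \<le> norm (z + h)"
      by (rule power2_le_imp_le) (use n2 k0 in auto)
    have nR: "norm (z + h) \<le> R"
    proof (rule power2_le_imp_le)
      have "R\<^sup>2 = x\<^sup>2 + k + (k / (2 * x))\<^sup>2"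
        using x by (simp add: R_def power2_eq_square field_simps)
      then show "(norm (z + h))\<^sup>2 \<le> R\<^sup>2" using n2 by simp
    qed (use R x in auto)
    have "\<omega> (norm (z + h)) \<le> \<omega> R"
    proof (rule DERIV_nonneg_imp_nondecreasing[OF nR])
      fix y assume "norm (z + h) \<le> y" "y \<le> R"
      then have "y \<in> {0<..<1}" using nx x R by auto
      then show "\<exists>d. (\<omega> has_real_derivative d) (at y) \<and> 0 \<le> d" using D1 pos by (meson less_imp_le)
    qed
    also have "\<omega> R \<le> \<omega> x + \<omega>1 x * (R - x) + 0 / 2 * (R - x)\<^sup>2"
      by (rule concave_taylor[OF D1 D2]) (use x R neg in \<open>auto intro!: less_imp_le\<close>)
    also have "\<omega> x \<le> \<omega> s + \<omega>1 s * (x - s) + (3 / 4 * \<omega>2 s) / 2 * (x - s)\<^sup>2"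
    proof (rule concave_taylor[OF D1 D2])
      show "\<omega>2 y \<le> 3 / 4 * \<omega>2 s" if "min s x \<le> y" "y \<le> max s x" for y
        using r2(2)[of y] neg[OF s(1)] that x(4) \<rho>(3) by (cases "y = s") (auto simp: min_def max_def split: if_splits)
    qed (use s x R in auto)
    also have "\<omega>1 x * (R - x) \<le> 3 / 4 * (\<omega>1 s / s) * k"
    proof -
      have "\<omega>1 x / x \<le> 3 / 2 * (\<omega>1 s / s)"
      proof (cases "x = s")
        case True
        then show ?thesis using divide_pos_pos[OF pos[OF s(1)] s(2)] unfolding True by linarith
      next
        case False
        then show ?thesis using r1(2)[of x] x(4) \<rho>(2) by auto
      qed
      then have "\<omega>1 x / x * (k / 2) \<le> 3 / 2 * (\<omega>1 s / s) * (k / 2)" using k0 by (intro mult_right_mono) auto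
      then show ?thesis using x by (simp add: R_def)
    qed
    finally show ?thesis by (simp add: x_def t_def[symmetric] k_def)
  qed
  then show ?thesis using \<rho>(1) by blast
qed

text \<open>Everything is multiplied by \<open>s * P powr (- \<alpha> - 1)\<close>. Since
  \<open>1 \<le> P\<close> and \<beta> \<le> \<alpha> + 2, the error from the difference of the
  gradients loses all powers of \<open>P\<close>. The one from the difference of \<open>b\<close>
  keeps \<open>P powr (\<beta> - \<alpha> - 1)\<close>, because only the regularity of
  \<open>b\<close> can control it.\<close>

lemma normalised_doubling_inequality:
  fixes P s \<alpha> \<beta> :: real
  assumes P: "P \<ge> 1" and s: "s > 0" and \<beta>: "\<alpha> + 1 \<le> \<beta>" "\<beta> \<le> \<alpha> + 2" "\<alpha> > 0"
    and pos: "C1 > 0" "L \<ge> 0" "\<delta> \<ge> 0" "B \<ge> 0" "G \<ge> 0" "D \<ge> 0" "r \<ge> 0"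
    and le: "- (D * (2 * P) powr \<beta> + B * (\<beta> * (2 * P) powr (\<beta> - 1) * (2 * \<delta>)) + G)
      \<le> P powr \<alpha> * (C1 * (P / s * r + 5 * L) - c1 * (P / s * k))"
  shows "c1 * k \<le> (6 * C1 + 2 powr \<beta> + \<beta> * 2 powr \<beta> * B + G) *
    (r + D * s * P powr (\<beta> - \<alpha> - 1) + s * (L + \<delta> + 1))"
proof -
  define w where "w = s * P powr (- \<alpha> - 1)"
  have w: "w > 0" using P s by (simp add: w_def)
  have Pa: "w * P powr \<alpha> = s / P"
  proof -
    have "P powr (- \<alpha> - 1) * P powr \<alpha> = P powr (- 1)" by (simp flip: powr_add)
    then show ?thesis using P by (simp add: w_def powr_minus_divide mult.assoc)
  qed
  have w1: "w \<le> s"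
  proof -
    have "P powr (- \<alpha> - 1) \<le> P powr 0" using P \<beta> by (intro powr_mono) auto
    then show ?thesis using s P by (simp add: w_def)
  qed
  have wb: "w * (2 * P) powr \<beta> = 2 powr \<beta> * (s * P powr (\<beta> - \<alpha> - 1))"
  proof -
    have "P powr (- \<alpha> - 1) * P powr \<beta> = P powr (\<beta> - \<alpha> - 1)" by (simp add: algebra_simps flip: powr_add)
    then show ?thesis using P by (simp add: w_def powr_mult mult_ac)
  qed
  have wb1: "w * ((2 * P) powr (\<beta> - 1) * 2) \<le> 2 powr \<beta> * s"
  proof -
    have "P powr (- \<alpha> - 1) * P powr (\<beta> - 1) = P powr (\<beta> - \<alpha> - 2)" by (simp add: algebra_simps flip: powr_add)
    also have "\<dots> \<le> P powr 0" using P \<beta> by (intro powr_mono) auto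
    finally have 1: "P powr (- \<alpha> - 1) * P powr (\<beta> - 1) \<le> 1" using P by simp
    have "w * ((2 * P) powr (\<beta> - 1) * 2) = 2 powr \<beta> * s * (P powr (- \<alpha> - 1) * P powr (\<beta> - 1))"
    proof -
      have "2 powr (\<beta> - 1) * 2 = (2 powr \<beta> :: real)" by (simp add: powr_diff)
      then show ?thesis using P by (simp add: w_def powr_mult mult_ac)
    qed
    also have "\<dots> \<le> 2 powr \<beta> * s * 1" using 1 s by (intro mult_left_mono) auto
    finally show ?thesis by simp
  qed
  have "w * (- (D * (2 * P) powr \<beta> + B * (\<beta> * (2 * P) powr (\<beta> - 1) * (2 * \<delta>)) + G))
      \<le> w * (P powr \<alpha> * (C1 * (P / s * r + 5 * L) - c1 * (P / s * k)))"
    using w le by (intro mult_left_mono) auto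
  also have "\<dots> = s / P * (C1 * (P / s * r + 5 * L) - c1 * (P / s * k))"
    using Pa by (simp flip: mult.assoc)
  also have "\<dots> = C1 * r + 5 * C1 * L * (s / P) - c1 * k"
    using P s by (simp add: field_simps)
  finally have "c1 * k \<le> C1 * r + 5 * C1 * L * (s / P) + D * (w * (2 * P) powr \<beta>)
      + B * \<beta> * \<delta> * (w * ((2 * P) powr (\<beta> - 1) * 2)) + w * G"
    by (simp add: algebra_simps)
  also have "\<dots> \<le> C1 * r + 5 * C1 * L * s + D * (2 powr \<beta> * (s * P powr (\<beta> - \<alpha> - 1)))
      + B * \<beta> * \<delta> * (2 powr \<beta> * s) + s * G"
  proof -
    have "5 * C1 * L * (s / P) \<le> 5 * C1 * L * s"
      using pos P s by (intro mult_left_mono) (auto simp: divide_le_eq)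
    moreover have "B * \<beta> * \<delta> * (w * ((2 * P) powr (\<beta> - 1) * 2)) \<le> B * \<beta> * \<delta> * (2 powr \<beta> * s)"
      using pos \<beta> by (intro mult_left_mono wb1) auto
    moreover have "w * G \<le> s * G" using w1 pos by (intro mult_right_mono) auto
    ultimately show ?thesis unfolding wb by linarith
  qed
  also have "\<dots> \<le> (6 * C1 + 2 powr \<beta> + \<beta> * 2 powr \<beta> * B + G) *
    (r + D * s * P powr (\<beta> - \<alpha> - 1) + s * (L + \<delta> + 1))"
  proof -
    define E where "E = D * (s * P powr (\<beta> - \<alpha> - 1))"
    define a1 a2 a3 where "a1 = (2::real) powr \<beta>" and "a2 = \<beta> * 2 powr \<beta> * B" and "a3 = 6 * C1"
    have E: "E \<ge> 0" "D * s * P powr (\<beta> - \<alpha> - 1) = E" using pos s by (auto simp: E_def)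
    have a: "a1 \<ge> 0" "a2 \<ge> 0" "a3 \<ge> 0" using pos \<beta> by (auto simp: a1_def a2_def a3_def)
    have sL: "s * L \<ge> 0" "s * \<delta> \<ge> 0" using s pos by auto
    define S where "S = r + E + s * (L + \<delta> + 1)"
    have S: "r \<le> S" "E \<le> S" "s * L \<le> S" "s * \<delta> \<le> S" "s \<le> S"
      using E sL pos s by (auto simp: S_def algebra_simps add_nonneg_nonneg)
    have "C1 * r \<le> C1 * S" "5 * C1 * (s * L) \<le> 5 * C1 * S" "a1 * E \<le> a1 * S" "a2 * (s * \<delta>) \<le> a2 * S" "G * s \<le> G * S"
      using S a pos by (auto intro!: mult_left_mono)
    moreover have eq: "C1 * r + 5 * C1 * L * s + D * (2 powr \<beta> * (s * P powr (\<beta> - \<alpha> - 1)))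
      + B * \<beta> * \<delta> * (2 powr \<beta> * s) + s * G = C1 * r + 5 * C1 * (s * L) + a1 * E + a2 * (s * \<delta>) + G * s"
      by (simp add: E_def a1_def a2_def algebra_simps)
    moreover have "6 * C1 + 2 powr \<beta> + \<beta> * 2 powr \<beta> * B + G = 6 * C1 + a1 + a2 + G"
      by (simp add: a1_def a2_def)
    ultimately show ?thesis unfolding E(2) S_def[symmetric] eq by (simp only: distrib_right)
  qed
  finally show ?thesis .
qed

lemma usc_on_nhd:
  assumes "usc_on S u" "x \<in> S" "e > 0"
  shows "\<exists>T. open T \<and> x \<in> T \<and> (\<forall>y\<in>T \<inter> S. u y < u x + e)"
proof -
  obtain T where "open T" "x \<in> T" "\<forall>y\<in>T. y \<noteq> x \<longrightarrow> y \<in> S \<longrightarrow> u y < u x + e"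
    using assms unfolding usc_on_def eventually_at_topological by blast
  then show ?thesis using assms(3) by (intro exI[of _ T]) auto
qed

lemma doubling_attains_max:
  fixes u v :: "real^'n \<Rightarrow> real" and \<phi> :: "(real^'n) \<times> (real^'n) \<Rightarrow> real"
  assumes usc: "usc_on S u" and lsc: "lsc_on S v" and C: "compact C" "C \<noteq> {}" "C \<subseteq> S"
    and cont: "continuous_on (C \<times> C) \<phi>"
  shows "\<exists>x\<in>C. \<exists>y\<in>C. \<forall>x'\<in>C. \<forall>y'\<in>C. u x' - v y' - \<phi> (x', y') \<le> u x - v y - \<phi> (x, y)"
proof -
  define w where "w z = u (fst z) - v (snd z) - \<phi> z" for z
  have "\<exists>z\<in>C \<times> C. \<forall>z'\<in>C \<times> C. w z' \<le> w z"
  proof (rule usc_attains_max)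
    show "compact (C \<times> C)" using C by (intro compact_Times)
    show "C \<times> C \<noteq> {}" using C by simp
    fix z and e :: real
    assume z: "z \<in> C \<times> C" and e: "e > 0"
    obtain T1 where T1: "open T1" "fst z \<in> T1" "\<And>y. y \<in> T1 \<inter> S \<Longrightarrow> u y < u (fst z) + e / 3"
      using usc_on_nhd[OF usc, of "fst z" "e / 3"] z e C by fastforce
    obtain T2 where T2: "open T2" "snd z \<in> T2" "\<And>y. y \<in> T2 \<inter> S \<Longrightarrow> - v y < - v (snd z) + e / 3"
      using usc_on_nhd[OF lsc_on_imp_usc_on_minus[OF lsc], of "snd z" "e / 3"] z e C by fastforce
    have "\<forall>\<^sub>F y in at z within C \<times> C. y \<in> T1 \<times> T2"
      using T1 T2 by (intro topological_tendstoD[OF tendsto_ident_at]) (auto simp: open_Times mem_Times_iff)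
    moreover have "\<forall>\<^sub>F y in at z within C \<times> C. y \<in> C \<times> C"
      by (simp add: eventually_at_filter)
    moreover have "(\<phi> \<longlongrightarrow> \<phi> z) (at z within C \<times> C)"
      using cont z unfolding continuous_on_def by blast
    then have "\<forall>\<^sub>F y in at z within C \<times> C. \<phi> y > \<phi> z - e / 3"
      by (rule order_tendstoD(1)) (use e in simp)
    ultimately show "\<forall>\<^sub>F y in at z within C \<times> C. w y < w z + e"
    proof eventually_elim
      case (elim y)
      then have "fst y \<in> T1 \<inter> S" "snd y \<in> T2 \<inter> S" using C by auto
      then show ?case using T1(3)[of "fst y"] T2(3)[of "snd y"] elim(3) unfolding w_def by linarith
    qed
  qed
  then show ?thesis by (auto simp: w_def)
qed

section \<open>The maximum of the doubled function\<close>

locale visc_pair =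
  fixes F :: "real^'n^'n \<Rightarrow> real"
    and a A \<alpha> \<beta> :: real
    and b f g u v :: "real^'n \<Rightarrow> real"
  assumes F: "structural_F F a A"
    and \<alpha>: "\<alpha> > 0"
    and \<beta>: "\<alpha> + 1 \<le> \<beta>" "\<beta> \<le> \<alpha> + 2"
    and b_cont: "continuous_on (ball 0 1) b"
    and b_hold: "\<beta> = \<alpha> + 2 \<Longrightarrow> holder_on (ball 0 1) b"
    and f: "bounded (f ` ball 0 1)"
    and g: "bounded (g ` ball 0 1)"
    and u: "usc_on (ball 0 1) u" "bdd_above (u ` ball 0 1)" "visc_sub F \<alpha> \<beta> b g (ball 0 1) u"
    and v: "lsc_on (ball 0 1) v" "bdd_below (v ` ball 0 1)" "visc_super F \<alpha> \<beta> b f (ball 0 1) v"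
begin

definition \<sigma> :: real where "\<sigma> = (SUP z\<in>ball 0 1. u z - v z)"

definition m :: real where "m = min 1 (\<alpha> / 2)"

lemma diff_bound: "\<exists>C0>0. \<forall>x\<in>ball 0 1. \<forall>y\<in>ball 0 1. u x - v y - \<sigma> \<le> C0"
proof -
  obtain U where U: "\<And>x. x \<in> ball 0 1 \<Longrightarrow> u x \<le> U" using u(2) unfolding bdd_above_def by blast
  obtain V where V: "\<And>x. x \<in> ball 0 1 \<Longrightarrow> V \<le> v x" using v(2) unfolding bdd_below_def by blast
  have "u x - v y - \<sigma> \<le> \<bar>U - V - \<sigma>\<bar> + 1" if "x \<in> ball 0 1" "y \<in> ball 0 1" for x y
    using U[OF that(1)] V[OF that(2)] by linarith
  then show ?thesis by (intro exI[of _ "\<bar>U - V - \<sigma>\<bar> + 1"]) auto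
qed

lemma diag_le: "z \<in> ball 0 1 \<Longrightarrow> u z - v z \<le> \<sigma>"
proof -
  assume z: "z \<in> ball 0 1"
  obtain U where U: "\<And>x. x \<in> ball 0 1 \<Longrightarrow> u x \<le> U" using u(2) unfolding bdd_above_def by blast
  obtain V where V: "\<And>x. x \<in> ball 0 1 \<Longrightarrow> V \<le> v x" using v(2) unfolding bdd_below_def by blast
  have "u x - v x \<le> U - V" if "x \<in> ball 0 1" for x using U[OF that] V[OF that] by linarith
  then have "bdd_above ((\<lambda>z. u z - v z) ` ball 0 1)" unfolding bdd_above_def by blast
  then show ?thesis unfolding \<sigma>_def by (rule cSUP_upper[OF z])
qed

text \<open>The assertion about \<open>\<delta>\<close> is the inequality between the equations at points near the maximum,
  divided by \<open>P\<^sup>\<alpha>\<^sup>+\<^sup>1 / s\<close>; \<open>\<kappa>\<close> measures the concavity of \<open>\<omega>\<close>.\<close>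

definition doubling_property :: "real \<Rightarrow> real \<Rightarrow> real \<Rightarrow> bool" where
  "doubling_property r c1 C2 \<longleftrightarrow> (\<forall>\<omega> \<omega>1 \<omega>2 M L x0 d. M > 0 \<longrightarrow> L > 0 \<longrightarrow> 0 < d \<longrightarrow> d \<le> 1 / 4 \<longrightarrow> cball x0 d \<subseteq> cball 0 r \<longrightarrow>
    \<omega> 0 = 0 \<longrightarrow> continuous_on {0..1/2} \<omega> \<longrightarrow> (\<forall>t\<in>{0..1/2}. \<omega> t \<ge> 0) \<longrightarrow>
    (\<forall>t\<in>{0<..<1}. (\<omega> has_real_derivative \<omega>1 t) (at t)) \<longrightarrow>
    (\<forall>t\<in>{0<..<1}. (\<omega>1 has_real_derivative \<omega>2 t) (at t)) \<longrightarrow>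
    (\<forall>t\<in>{0<..<1}. \<omega>1 t > 0 \<and> \<omega>2 t < 0 \<and> - \<omega>2 t * t \<le> \<omega>1 t) \<longrightarrow> continuous_on {0<..<1} \<omega>2 \<longrightarrow>
    (\<forall>x\<in>ball 0 1. \<forall>y\<in>ball 0 1. u x - v y - \<sigma> < L * d\<^sup>2) \<longrightarrow>
    (\<exists>x\<in>cball x0 d. \<exists>y\<in>cball x0 d. u x - v y - \<sigma> - M * \<omega> (dist x y) - L * (norm (x - x0))\<^sup>2 - L * (norm (y - x0))\<^sup>2 > 0) \<longrightarrow>
    (\<exists>x\<in>cball x0 d. \<exists>y\<in>cball x0 d. x \<noteq> y \<and> dist x y \<le> 1/2 \<and>
      M * \<omega> (dist x y) + L * (norm (x - x0))\<^sup>2 + L * (norm (y - x0))\<^sup>2 < u x - v y - \<sigma> \<and>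
      (\<forall>s P \<kappa> \<delta> \<mu>. s = dist x y \<longrightarrow> P = M * \<omega>1 s \<longrightarrow> \<kappa> = - \<omega>2 s * s / \<omega>1 s \<longrightarrow> 1 \<le> P \<longrightarrow>
        2 * L * norm (x - x0) < \<delta> \<longrightarrow> 2 * L * norm (y - x0) < \<delta> \<longrightarrow> \<delta> \<le> P * sqrt (\<kappa> / (64 * CARD('n))) \<longrightarrow> \<mu> > 0 \<longrightarrow>
        (\<exists>x'\<in>ball 0 1. \<exists>y'\<in>ball 0 1. norm (x' - x) \<le> \<mu> \<and> norm (y' - y) \<le> \<mu> \<and>
          c1 * \<kappa> powr (1 + \<alpha> / 2) \<le> C2 * ((\<delta> / P) powr (2 * m) + \<bar>b x' - b y'\<bar> * s * P powr (\<beta> - \<alpha> - 1) + s * (L + \<delta> + 1))))))"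

lemmas doubling_propertyD = doubling_property_def[THEN iffD1, THEN spec, THEN spec, THEN spec, THEN spec, THEN spec, THEN spec, THEN spec,
  THEN mp, THEN mp, THEN mp, THEN mp, THEN mp, THEN mp, THEN mp, THEN mp, THEN mp, THEN mp, THEN mp, THEN mp, THEN mp, THEN mp]

text \<open>The point is the order of quantifiers: \<open>c1\<close> and \<open>C2\<close> depend on
  the data and on \<open>r\<close>, but not on \<omega>, \<open>M\<close> or \<open>L\<close>. Both
  rounds can therefore choose \<open>M\<close> afterwards to violate the inequality.\<close>

lemma doubling_maximum:
  assumes r: "r < 1"
  shows "\<exists>c1>0. \<exists>C2>0. doubling_property r c1 C2"
proof -
  obtain c1 C1 where c1: "c1 > 0" "C1 > 0" and Fp: "\<And>e p1 p2 X Y P z0 \<kappa> K \<delta>. norm e = 1 \<Longrightarrow> P > 0 \<Longrightarrow> z0 > 0 \<Longrightarrow> 0 < \<kappa> \<Longrightarrow> \<kappa> \<le> 1 \<Longrightarrow>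
    K \<ge> 0 \<Longrightarrow> \<delta> > 0 \<Longrightarrow> \<delta> \<le> P * sqrt (\<kappa> / (64 * CARD('n))) \<Longrightarrow>
    norm (p1 - P *\<^sub>R e) \<le> \<delta> \<Longrightarrow> norm (p2 - P *\<^sub>R e) \<le> \<delta> \<Longrightarrow> sym_mat X \<Longrightarrow> sym_mat Y \<Longrightarrow>
    (\<forall>a b. a \<bullet> (X *v a) - b \<bullet> (Y *v b) \<le> - (\<kappa> * z0 / 2) * ((a - b) \<bullet> e)\<^sup>2
      + 2 * z0 * ((norm (a - b))\<^sup>2 - ((a - b) \<bullet> e)\<^sup>2) + K * ((norm a)\<^sup>2 + (norm b)\<^sup>2)) \<Longrightarrow>
    Fp F \<alpha> p1 X - Fp F \<alpha> p2 Y \<le> P powr \<alpha> *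
      (C1 * (z0 * (\<delta> / P) powr (2 * m) + K) - c1 * (z0 * \<kappa> powr (1 + \<alpha> / 2)))"
    using Fp_diff_le[OF F \<alpha>] unfolding m_def by metis
  \<comment> \<open>Room between the ball of the maximum and the unit ball: the points with jets may
    leave the former slightly, and \<open>b\<close> is bounded on the closed ball of radius
    \<open>r'\<close>.\<close>
  define r' where "r' = (r + 1) / 2"
  have r': "r < r'" "r' < 1" using r by (auto simp: r'_def)
  have "compact (b ` cball 0 r')"
    by (intro compact_continuous_image continuous_on_subset[OF b_cont]) (use r' in auto)
  then obtain B where B: "B > 0" "\<And>x. x \<in> cball 0 r' \<Longrightarrow> \<bar>b x\<bar> \<le> B"
    using compact_imp_bounded bounded_pos by (metis imageI real_norm_def)
  obtain Bf where Bf: "Bf > 0" "\<And>x. x \<in> ball 0 1 \<Longrightarrow> \<bar>f x\<bar> \<le> Bf"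
    using f bounded_pos by (metis imageI real_norm_def)
  obtain Bg where Bg: "Bg > 0" "\<And>x. x \<in> ball 0 1 \<Longrightarrow> \<bar>g x\<bar> \<le> Bg"
    using g bounded_pos by (metis imageI real_norm_def)
  define C2 where "C2 = 6 * C1 + 2 powr \<beta> + \<beta> * 2 powr \<beta> * B + (Bf + Bg)"
  have C2: "C2 > 0" using c1 Bf Bg B \<alpha> \<beta> unfolding C2_def by (intro add_pos_pos) auto
  have "\<exists>x\<in>cball x0 d. \<exists>y\<in>cball x0 d. x \<noteq> y \<and> dist x y \<le> 1/2 \<and>
      M * \<omega> (dist x y) + L * (norm (x - x0))\<^sup>2 + L * (norm (y - x0))\<^sup>2 < u x - v y - \<sigma> \<and>
      (\<forall>s P \<kappa> \<delta> \<mu>. s = dist x y \<longrightarrow> P = M * \<omega>1 s \<longrightarrow> \<kappa> = - \<omega>2 s * s / \<omega>1 s \<longrightarrow> 1 \<le> P \<longrightarrow>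
        2 * L * norm (x - x0) < \<delta> \<longrightarrow> 2 * L * norm (y - x0) < \<delta> \<longrightarrow> \<delta> \<le> P * sqrt (\<kappa> / (64 * CARD('n))) \<longrightarrow> \<mu> > 0 \<longrightarrow>
        (\<exists>x'\<in>ball 0 1. \<exists>y'\<in>ball 0 1. norm (x' - x) \<le> \<mu> \<and> norm (y' - y) \<le> \<mu> \<and>
          c1 * \<kappa> powr (1 + \<alpha> / 2) \<le> C2 * ((\<delta> / P) powr (2 * m) + \<bar>b x' - b y'\<bar> * s * P powr (\<beta> - \<alpha> - 1) + s * (L + \<delta> + 1))))"
    if M: "M > 0" and L: "L > 0" and d: "0 < d" "d \<le> 1 / 4" and sub: "cball x0 d \<subseteq> cball 0 r"
      and \<omega>0: "\<omega> 0 = 0" and \<omega>c: "continuous_on {0..1/2} \<omega>" and \<omega>nn: "\<And>t. t \<in> {0..1/2} \<Longrightarrow> \<omega> t \<ge> 0"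
      and D1: "\<And>t. t \<in> {0<..<1} \<Longrightarrow> (\<omega> has_real_derivative \<omega>1 t) (at t)"
      and D2: "\<And>t. t \<in> {0<..<1} \<Longrightarrow> (\<omega>1 has_real_derivative \<omega>2 t) (at t)"
      and \<omega>1: "\<And>t. t \<in> {0<..<1} \<Longrightarrow> \<omega>1 t > 0" and \<omega>2: "\<And>t. t \<in> {0<..<1} \<Longrightarrow> \<omega>2 t < 0"
      and \<omega>12: "\<And>t. t \<in> {0<..<1} \<Longrightarrow> - \<omega>2 t * t \<le> \<omega>1 t" and \<omega>2c: "continuous_on {0<..<1} \<omega>2"
      and C0: "\<And>x y. x \<in> ball 0 1 \<Longrightarrow> y \<in> ball 0 1 \<Longrightarrow> u x - v y - \<sigma> < L * d\<^sup>2"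
      and ex: "\<exists>x\<in>cball x0 d. \<exists>y\<in>cball x0 d. u x - v y - \<sigma> - M * \<omega> (dist x y) - L * (norm (x - x0))\<^sup>2 - L * (norm (y - x0))\<^sup>2 > 0"
    for \<omega> \<omega>1 \<omega>2 :: "real \<Rightarrow> real" and M L d and x0 :: "real^'n"
  proof -
    define \<phi> where "\<phi> z = M * \<omega> (dist (fst z) (snd z)) + L * (norm (fst z - x0))\<^sup>2 + L * (norm (snd z - x0))\<^sup>2" for z
    have dd: "dist x y \<in> {0..1/2}" if "x \<in> cball x0 d" "y \<in> cball x0 d" for x y
      using dist_triangle3[of x y x0] that d by auto
    have in1: "x \<in> ball 0 1" if "x \<in> cball x0 d" for x
      using sub that r by (auto simp: subset_iff)
    have "\<exists>x\<in>cball x0 d. \<exists>y\<in>cball x0 d. \<forall>x'\<in>cball x0 d. \<forall>y'\<in>cball x0 d.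
      u x' - v y' - \<phi> (x', y') \<le> u x - v y - \<phi> (x, y)"
    proof (rule doubling_attains_max[OF u(1) v(1)])
      show "continuous_on (cball x0 d \<times> cball x0 d) \<phi>"
        unfolding \<phi>_def
        by (intro continuous_intros continuous_on_compose2[OF \<omega>c]) (use dd in auto)
    qed (use in1 d in auto)
    then obtain x y where xy: "x \<in> cball x0 d" "y \<in> cball x0 d" and
      mx: "\<And>x' y'. x' \<in> cball x0 d \<Longrightarrow> y' \<in> cball x0 d \<Longrightarrow> u x' - v y' - \<phi> (x', y') \<le> u x - v y - \<phi> (x, y)"
      by blast
    have pos: "u x - v y - \<sigma> - \<phi> (x, y) > 0"
    proof -
      obtain x' y' where "x' \<in> cball x0 d" "y' \<in> cball x0 d" "u x' - v y' - \<sigma> - \<phi> (x', y') > 0"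
        using ex by (auto simp: \<phi>_def algebra_simps)
      then show ?thesis using mx[of x' y'] by linarith
    qed
    have ne: "x \<noteq> y"
    proof
      assume "x = y"
      moreover have "u x - v x \<le> \<sigma>" using diag_le[OF in1[OF xy(1)]] .
      moreover have "\<phi> (x, x) \<ge> 0" using L \<omega>0 by (simp add: \<phi>_def)
      ultimately show False using pos by simp
    qed
    define s where "s = dist x y"
    have s: "0 < s" "s \<le> 1/2" "s \<in> {0<..<1}" using ne dd[OF xy] by (auto simp: s_def)
    have s_nn: "M * \<omega> s \<ge> 0" using M \<omega>nn[of s] s by simp
    \<comment> \<open>The excess \<open>u x - v y - \<sigma>\<close> is below
      \<open>L * d^2\<close>, so at a positive maximum neither localising term can reach its
      boundary value.\<close>
    have intr: "norm (x - x0) < d" "norm (y - x0) < d"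
    proof -
      have "L * (norm (x - x0))\<^sup>2 + L * (norm (y - x0))\<^sup>2 < L * d\<^sup>2"
        using pos C0[OF in1[OF xy(1)] in1[OF xy(2)]] s_nn by (simp add: \<phi>_def s_def)
      moreover have "L * (norm (x - x0))\<^sup>2 \<ge> 0" "L * (norm (y - x0))\<^sup>2 \<ge> 0" using L by auto
      ultimately have "L * (norm (x - x0))\<^sup>2 < L * d\<^sup>2" "L * (norm (y - x0))\<^sup>2 < L * d\<^sup>2" by linarith+
      then have "(norm (x - x0))\<^sup>2 < d\<^sup>2" "(norm (y - x0))\<^sup>2 < d\<^sup>2" using L by auto
      then show "norm (x - x0) < d" "norm (y - x0) < d" using d power_less_imp_less_base by fastforce+
    qed
    define e where "e = (x - y) /\<^sub>R s"
    have e: "norm e = 1" using s by (simp add: e_def s_def dist_norm)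
    \<comment> \<open>\<open>P\<close> is the slope of \<open>M * \<omega>\<close> at
      \<open>s\<close>, \<open>- Q\<close> its second derivative in the direction \<open>e\<close>,
      and \<open>z0\<close> its curvature in the directions orthogonal to \<open>e\<close>. Thus
      \<kappa> is the ratio of the radial concavity to the tangential curvature.\<close>
    define P where "P = M * \<omega>1 s"
    define Q where "Q = M * (- \<omega>2 s)"
    define z0 where "z0 = P / s"
    define \<kappa> where "\<kappa> = - \<omega>2 s * s / \<omega>1 s"
    have PQ: "P > 0" "Q > 0" "z0 > 0" using mult_pos_neg[OF M \<omega>2[OF s(3)]] M \<omega>1[OF s(3)] \<omega>2[OF s(3)] s by (auto simp: P_def Q_def z0_def)
    have \<kappa>: "\<kappa> > 0" "\<kappa> \<le> 1" "\<kappa> * z0 = Q"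
    proof -
      show "\<kappa> > 0" unfolding \<kappa>_def using \<omega>1[OF s(3)] \<omega>2[OF s(3)] s by (intro divide_pos_pos mult_pos_pos) auto
      show "\<kappa> \<le> 1" unfolding \<kappa>_def using \<omega>1[OF s(3)] \<omega>12[OF s(3)] by (subst pos_divide_le_eq) auto
      show "\<kappa> * z0 = Q" using \<omega>1[OF s(3)] s by (simp add: \<kappa>_def z0_def P_def Q_def)
    qed
    have Qz: "Q \<le> z0"
    proof -
      have "\<kappa> * z0 \<le> 1 * z0" using \<kappa> PQ by (intro mult_right_mono) auto
      then show ?thesis using \<kappa> by simp
    qed
    have s_eq: "s = norm (x - y)" by (simp add: s_def dist_norm)
    have "isCont \<omega>2 s" using \<omega>2c s by (simp add: continuous_on_eq_continuous_at)
    then obtain \<rho>0 where \<rho>0: "\<rho>0 > 0" "\<And>h. norm h \<le> \<rho>0 \<Longrightarrow> \<omega> (norm (x - y + h)) \<le> \<omega> s + \<omega>1 s * (h \<bullet> e)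
      + 3 / 8 * \<omega>2 s * (h \<bullet> e)\<^sup>2 + 3 / 4 * (\<omega>1 s / s) * ((norm h)\<^sup>2 - (h \<bullet> e)\<^sup>2)"
      using radial_second_order[OF D1 D2 \<omega>1 \<omega>2, of "x - y"] ne s unfolding e_def s_eq by auto
    define l1 l2 where "l1 = (2 * L) *\<^sub>R (x - x0)" and "l2 = (2 * L) *\<^sub>R (y - x0)"
    define \<rho> where "\<rho> = min (\<rho>0 / 2) (min (d - norm (x - x0)) (d - norm (y - x0)))"
    have \<rho>: "\<rho> > 0" "\<rho> \<le> \<rho>0 / 2" "\<rho> \<le> d - norm (x - x0)" "\<rho> \<le> d - norm (y - x0)"
      using intr \<rho>0(1) by (auto simp: \<rho>_def min_def)
    have max: "u (x + a) - v (y + b) \<le> u x - v y + (P *\<^sub>R e + l1) \<bullet> a - (P *\<^sub>R e - l2) \<bullet> b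
        + (- (3 / 4 * Q) * ((a - b) \<bullet> e)\<^sup>2 + 3 / 2 * z0 * ((norm (a - b))\<^sup>2 - ((a - b) \<bullet> e)\<^sup>2)
           + 2 * L * ((norm a)\<^sup>2 + (norm b)\<^sup>2)) / 2"
      if ab: "norm a \<le> \<rho>" "norm b \<le> \<rho>" for a b
    proof -
      define h where "h = a - b"
      have "norm h \<le> \<rho>0" using norm_triangle_ineq4[of a b] ab \<rho> by (simp add: h_def)
      then have "M * \<omega> (norm (x - y + h)) \<le> M * (\<omega> s + \<omega>1 s * (h \<bullet> e)
        + 3 / 8 * \<omega>2 s * (h \<bullet> e)\<^sup>2 + 3 / 4 * (\<omega>1 s / s) * ((norm h)\<^sup>2 - (h \<bullet> e)\<^sup>2))"
        using M by (intro mult_left_mono \<rho>0) auto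
      also have "\<dots> = M * \<omega> s + P * (h \<bullet> e) - 3 / 8 * Q * (h \<bullet> e)\<^sup>2 + 3 / 4 * z0 * ((norm h)\<^sup>2 - (h \<bullet> e)\<^sup>2)"
      proof -
        have "M * (w + w1 * t + 3 / 8 * w2 * t2 + 3 / 4 * (w1 / s) * k) =
          M * w + M * w1 * t - 3 / 8 * (M * - w2) * t2 + 3 / 4 * (M * w1 / s) * k" for w w1 w2 t t2 k :: real
          by (simp add: algebra_simps)
        then show ?thesis unfolding P_def Q_def z0_def .
      qed
      finally have 1: "M * \<omega> (dist (x + a) (y + b)) \<le> \<dots>"
        by (simp add: dist_norm h_def algebra_simps)
      have sq: "L * (norm (c + k - x0))\<^sup>2 = L * (norm (c - x0))\<^sup>2 + ((2 * L) *\<^sub>R (c - x0)) \<bullet> k + L * (norm k)\<^sup>2" for c k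
        unfolding power2_norm_eq_inner by (simp add: inner_commute algebra_simps)
      have "x + a \<in> cball x0 d" "y + b \<in> cball x0 d"
        using norm_triangle_ineq[of "x - x0" a] norm_triangle_ineq[of "y - x0" b] ab \<rho>
        by (auto simp: dist_norm norm_minus_commute algebra_simps)
      from mx[OF this] have "u (x + a) - v (y + b) \<le> u x - v y + (M * \<omega> (dist (x + a) (y + b)) - M * \<omega> s)
        + l1 \<bullet> a + L * (norm a)\<^sup>2 + l2 \<bullet> b + L * (norm b)\<^sup>2"
        unfolding \<phi>_def fst_conv snd_conv sq l1_def[symmetric] l2_def[symmetric] s_def[symmetric] by linarith
      also have "\<dots> \<le> u x - v y + (P * (h \<bullet> e) - 3 / 8 * Q * (h \<bullet> e)\<^sup>2 + 3 / 4 * z0 * ((norm h)\<^sup>2 - (h \<bullet> e)\<^sup>2))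
        + l1 \<bullet> a + L * (norm a)\<^sup>2 + l2 \<bullet> b + L * (norm b)\<^sup>2"
        using 1 by linarith
      also have "P * (h \<bullet> e) = (P *\<^sub>R e) \<bullet> a - (P *\<^sub>R e) \<bullet> b"
        by (simp add: h_def inner_diff_left inner_diff_right inner_commute algebra_simps)
      moreover have half: "(- (3 / 4 * Q) * t + 3 / 2 * z0 * k + 2 * L * (n1 + n2)) / 2
          = - (3 / 8 * Q * t) + 3 / 4 * z0 * k + L * n1 + L * n2" for t k n1 n2
        by (simp add: field_simps)
      ultimately show ?thesis
        unfolding h_def[symmetric] inner_add_left inner_diff_left half by linarith
    qed
    have main: "\<exists>x'\<in>ball 0 1. \<exists>y'\<in>ball 0 1. norm (x' - x) \<le> \<mu> \<and> norm (y' - y) \<le> \<mu> \<and>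
          c1 * \<kappa> powr (1 + \<alpha> / 2) \<le> C2 * ((\<delta> / P) powr (2 * m) + \<bar>b x' - b y'\<bar> * s * P powr (\<beta> - \<alpha> - 1) + s * (L + \<delta> + 1))"
      if P1: "1 \<le> P" and \<delta>: "2 * L * norm (x - x0) < \<delta>" "2 * L * norm (y - x0) < \<delta>"
        "\<delta> \<le> P * sqrt (\<kappa> / (64 * CARD('n)))" and \<mu>: "\<mu> > 0" for \<delta> \<mu>
    proof -
      have nl: "norm l1 < \<delta>" "norm l2 < \<delta>" using \<delta> L by (auto simp: l1_def l2_def)
      then have \<delta>0: "\<delta> > 0" using norm_ge_zero[of l1] by linarith
      \<comment> \<open>The strict inequalities for the localising gradients leave room for the
        error of the jets, so \<open>p\<close> and \<open>q\<close> still lie within \<delta> of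
        \<open>P *\<^sub>R e\<close>.\<close>
      define \<mu>' where "\<mu>' = min (min \<mu> (r' - r)) (min (\<delta> - norm l1) (\<delta> - norm l2))"
      have \<mu>': "\<mu>' > 0" "\<mu>' \<le> \<mu>" "\<mu>' \<le> r' - r" "\<mu>' \<le> \<delta> - norm l1" "\<mu>' \<le> \<delta> - norm l2"
        using \<mu> r' nl by (auto simp: \<mu>'_def)
      obtain x' y' p q X Y where x': "x' \<in> ball 0 1" "norm (x' - x) \<le> \<mu>'" and y': "y' \<in> ball 0 1" "norm (y' - y) \<le> \<mu>'"
        and p: "norm (p - (P *\<^sub>R e + l1)) \<le> \<mu>'" and q: "norm (q - (P *\<^sub>R e - l2)) \<le> \<mu>'" and XY: "sym_mat X" "sym_mat Y"
        and eqs: "- Fp F \<alpha> p X + b x' * norm p powr \<beta> \<le> g x'" "- Fp F \<alpha> q Y + b y' * norm q powr \<beta> \<ge> f y'"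
        and form: "\<forall>a b. a \<bullet> (X *v a) - b \<bullet> (Y *v b) \<le> - (Q / 2) * ((a - b) \<bullet> e)\<^sup>2
          + 2 * z0 * ((norm (a - b))\<^sup>2 - ((a - b) \<bullet> e)\<^sup>2) + 5 * L * ((norm a)\<^sup>2 + (norm b)\<^sup>2)"
        using doubling_jets[OF u(3) v(3) u(1) v(1) open_ball in1[OF xy(1)] in1[OF xy(2)] e less_imp_le[OF PQ(2)] Qz L \<rho>(1) \<mu>'(1) max]
        by blast
      have pn: "norm (p - P *\<^sub>R e) \<le> \<delta>"
        using norm_triangle_ineq[of "p - (P *\<^sub>R e + l1)" l1] p \<mu>' by (simp add: algebra_simps)
      have qn: "norm (q - P *\<^sub>R e) \<le> \<delta>"
        using norm_triangle_ineq4[of "q - (P *\<^sub>R e - l2)" l2] q \<mu>' by (simp add: algebra_simps)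
      have "\<delta> \<le> P * 1"
      proof -
        have "\<kappa> / (64 * CARD('n)) \<le> 1"
        proof -
          have "real CARD('n) \<ge> 1" using zero_less_card_finite[where 'a='n] by linarith
          then have "\<kappa> \<le> 64 * real CARD('n)" using \<kappa> by linarith
          then show ?thesis by (simp add: divide_le_eq)
        qed
        then have "sqrt (\<kappa> / (64 * CARD('n))) \<le> 1" by simp
        then have "P * sqrt (\<kappa> / (64 * CARD('n))) \<le> P * 1" using PQ by (intro mult_left_mono) auto
        then show ?thesis using \<delta>(3) by linarith
      qed
      then have pq: "norm p \<le> 2 * P" "norm q \<le> 2 * P"
        using norm_triangle_ineq[of "p - P *\<^sub>R e" "P *\<^sub>R e"] norm_triangle_ineq[of "q - P *\<^sub>R e" "P *\<^sub>R e"] pn qn e PQ by auto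
      have pqd: "\<bar>norm p - norm q\<bar> \<le> 2 * \<delta>"
        using norm_triangle_ineq3[of p q] norm_triangle_ineq4[of "p - P *\<^sub>R e" "q - P *\<^sub>R e"] pn qn by simp
      have y'B: "y' \<in> cball 0 r'"
        using norm_triangle_ineq[of "y' - y" y] y'(2) \<mu>'(3) xy(2) sub by (auto simp: subset_iff)
      have bd: "b x' * norm p powr \<beta> - b y' * norm q powr \<beta> \<ge>
        - (\<bar>b x' - b y'\<bar> * (2 * P) powr \<beta> + B * (\<beta> * (2 * P) powr (\<beta> - 1) * (2 * \<delta>)))"
      proof -
        have \<beta>1: "1 \<le> \<beta>" using \<alpha> \<beta> by simp
        have "\<bar>norm p powr \<beta> - norm q powr \<beta>\<bar> \<le> \<beta> * (2 * P) powr (\<beta> - 1) * \<bar>norm p - norm q\<bar>"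
          by (rule powr_diff_le_mvt) (use pq \<beta>1 in auto)
        also have "\<dots> \<le> \<beta> * (2 * P) powr (\<beta> - 1) * (2 * \<delta>)" using pqd \<beta>1 by (intro mult_left_mono) auto
        finally have "\<bar>b y' * (norm p powr \<beta> - norm q powr \<beta>)\<bar> \<le> B * (\<beta> * (2 * P) powr (\<beta> - 1) * (2 * \<delta>))"
          unfolding abs_mult using B y'B by (intro mult_mono) auto
        moreover have "\<bar>(b x' - b y') * norm p powr \<beta>\<bar> \<le> \<bar>b x' - b y'\<bar> * (2 * P) powr \<beta>"
          unfolding abs_mult using pq \<beta>1 by (intro mult_left_mono) (auto intro!: powr_mono2)
        moreover have "b x' * norm p powr \<beta> - b y' * norm q powr \<beta> =
          (b x' - b y') * norm p powr \<beta> + b y' * (norm p powr \<beta> - norm q powr \<beta>)" by (simp add: algebra_simps)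
        ultimately show ?thesis by linarith
      qed
      have "Fp F \<alpha> p X - Fp F \<alpha> q Y \<le> P powr \<alpha> *
        (C1 * (z0 * (\<delta> / P) powr (2 * m) + 5 * L) - c1 * (z0 * \<kappa> powr (1 + \<alpha> / 2)))"
        by (rule Fp[OF e PQ(1) PQ(3) \<kappa>(1,2) _ \<delta>0 \<delta>(3) pn qn XY]) (use form L \<kappa>(3) in auto)
      then have "- (\<bar>b x' - b y'\<bar> * (2 * P) powr \<beta> + B * (\<beta> * (2 * P) powr (\<beta> - 1) * (2 * \<delta>)) + (Bf + Bg)) \<le> P powr \<alpha> *
        (C1 * (P / s * (\<delta> / P) powr (2 * m) + 5 * L) - c1 * (P / s * \<kappa> powr (1 + \<alpha> / 2)))"
        unfolding z0_def[symmetric] using bd eqs Bf(2)[OF y'(1)] Bg(2)[OF x'(1)] by linarith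
      then have "c1 * \<kappa> powr (1 + \<alpha> / 2) \<le> C2 * ((\<delta> / P) powr (2 * m) + \<bar>b x' - b y'\<bar> * s * P powr (\<beta> - \<alpha> - 1) + s * (L + \<delta> + 1))"
        unfolding C2_def
        by (intro normalised_doubling_inequality[OF P1 s(1) \<beta> \<alpha> c1(2)]) (use L \<delta>0 B Bf Bg in auto)
      then show ?thesis using x' y' \<mu>'(2) by (intro bexI[of _ x'] bexI[of _ y']) auto
    qed
    show ?thesis
    proof (rule bexI[of _ x], rule bexI[of _ y], intro conjI)
      show "M * \<omega> (dist x y) + L * (norm (x - x0))\<^sup>2 + L * (norm (y - x0))\<^sup>2 < u x - v y - \<sigma>"
        using pos by (simp add: \<phi>_def)
      show "\<forall>s P \<kappa> \<delta> \<mu>. s = dist x y \<longrightarrow> P = M * \<omega>1 s \<longrightarrow> \<kappa> = - \<omega>2 s * s / \<omega>1 s \<longrightarrow> 1 \<le> P \<longrightarrow>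
        2 * L * norm (x - x0) < \<delta> \<longrightarrow> 2 * L * norm (y - x0) < \<delta> \<longrightarrow> \<delta> \<le> P * sqrt (\<kappa> / (64 * CARD('n))) \<longrightarrow> \<mu> > 0 \<longrightarrow>
        (\<exists>x'\<in>ball 0 1. \<exists>y'\<in>ball 0 1. norm (x' - x) \<le> \<mu> \<and> norm (y' - y) \<le> \<mu> \<and>
          c1 * \<kappa> powr (1 + \<alpha> / 2) \<le> C2 * ((\<delta> / P) powr (2 * m) + \<bar>b x' - b y'\<bar> * s * P powr (\<beta> - \<alpha> - 1) + s * (L + \<delta> + 1)))"
        using main unfolding s_def[symmetric] by (auto simp: P_def \<kappa>_def)
    qed (use ne xy s in \<open>auto simp: s_def\<close>)
  qed
  then have "doubling_property r c1 C2" unfolding doubling_property_def by (intro allI impI) auto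
  then show ?thesis using c1(1) C2 by blast
qed

end

section \<open>Hoelder and Lipschitz estimates\<close>

lemma eventually_const_over_powr_less:
  fixes c q \<epsilon> :: real
  assumes "c \<ge> 0" "q > 0" "\<epsilon> > 0"
  shows "\<forall>\<^sub>F M in at_top. (c / M) powr q < \<epsilon>"
proof -
  have "((\<lambda>M. c / M) \<longlongrightarrow> 0) at_top"
    by (intro tendsto_divide_0[OF tendsto_const] filterlim_at_top_imp_at_infinity filterlim_ident)
  moreover have "\<forall>\<^sub>F M in at_top. 0 \<le> c / M"
    using eventually_gt_at_top[of 0] by eventually_elim (use assms in simp)
  ultimately have "((\<lambda>M. (c / M) powr q) \<longlongrightarrow> 0) at_top"
    using assms by (intro tendsto_zero_powrI[OF _ tendsto_const]) auto
  then show ?thesis by (rule order_tendstoD) (use assms in simp)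
qed

lemma eventually_mult_const_over_powr_less:
  fixes c k q \<epsilon> :: real
  assumes "c \<ge> 0" "k > 0" "q > 0" "\<epsilon> > 0"
  shows "\<forall>\<^sub>F M in at_top. k * (c / M) powr q < \<epsilon>"
  using eventually_const_over_powr_less[of c q "\<epsilon> / k"] assms by (simp add: field_simps)

context visc_pair
begin

text \<open>For the square root \<kappa> is exactly 1/2 and \<open>P * s = M * sqrt s / 2\<close>,
  while positivity at the maximum gives \<open>M * sqrt s \<le> C0\<close>. So \<open>s\<close> is
  small and \<open>s * P\<close> bounded; the error from \<open>b\<close> is small because nearby
  values of \<open>b\<close> are close, and the two others are small because \<open>M\<close> is
  large.\<close>

lemma holder_estimate:
  assumes r: "r < 1"
  shows "\<exists>c>0. \<forall>x\<in>cball 0 r. \<forall>y\<in>cball 0 r. u x - v y \<le> \<sigma> + c * sqrt (dist x y)"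
proof -
  define r1 where "r1 = (1 + r) / 2"
  define r2 where "r2 = (1 + r1) / 2"
  have rr: "r < r1" "r1 < r2" "r2 < 1" using r by (auto simp: r1_def r2_def)
  define d where "d = min (1 / 4) (r1 - r)"
  have d: "0 < d" "d \<le> 1 / 4" "d \<le> r1 - r" using rr by (auto simp: d_def min_def)
  obtain C0 where C0: "C0 > 0" "\<And>x y. x \<in> ball 0 1 \<Longrightarrow> y \<in> ball 0 1 \<Longrightarrow> u x - v y - \<sigma> \<le> C0"
    using diff_bound by blast
  \<comment> \<open>Twice the value at which the localising term alone exceeds every possible excess
    on the boundary of the ball.\<close>
  define L where "L = 2 * C0 / d\<^sup>2"
  have L: "L > 0" "L * d\<^sup>2 = 2 * C0" using C0 d by (auto simp: L_def)
  define \<delta> where "\<delta> = 2 * L * d + 1"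
  have \<delta>: "\<delta> > 0" using L d by (simp add: \<delta>_def add_pos_pos)
  define n where "n = real CARD('n)"
  have n: "n > 0" by (simp add: n_def)
  have m: "m > 0" using \<alpha> by (simp add: m_def)
  have "r1 < 1" using rr by simp
  from doubling_maximum[OF this] obtain c1 C2 where c1: "c1 > 0" "C2 > 0" and dp: "doubling_property r1 c1 C2"
    by blast
  define K0 where "K0 = c1 * (1 / 2) powr (1 + \<alpha> / 2)"
  have K0: "K0 > 0" using c1 by (simp add: K0_def)
  \<comment> \<open>The oscillation of \<open>b\<close> that keeps its error, at most
    \<open>C2 * \<epsilon>0 * C0\<close>, to a third of \<open>K0\<close>.\<close>
  define \<epsilon>0 where "\<epsilon>0 = K0 / (3 * C2 * C0)"
  have \<epsilon>0: "\<epsilon>0 > 0" using K0 c1 C0 by (simp add: \<epsilon>0_def)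
  have "uniformly_continuous_on (cball 0 r2) b"
    by (intro compact_uniformly_continuous continuous_on_subset[OF b_cont]) (use rr in auto)
  then obtain \<eta> where \<eta>: "\<eta> > 0" "\<And>x y. x \<in> cball 0 r2 \<Longrightarrow> y \<in> cball 0 r2 \<Longrightarrow> dist x y < \<eta> \<Longrightarrow> \<bar>b x - b y\<bar> < \<epsilon>0"
    using \<epsilon>0 unfolding uniformly_continuous_on_def dist_real_def by metis
  define q where "q = sqrt (1 / 2 / (64 * n))"
  have q: "q > 0" using n by (simp add: q_def)
  \<comment> \<open>In order: \<open>P\<close> is at least 1; the perturbation \<delta> is
    admissible; the error from the weights is below \<open>K0 / 3\<close>; the points are close
    enough for the uniform continuity of \<open>b\<close>; the error proportional to
    \<open>s\<close> is below \<open>K0 / 3\<close>.\<close>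
  have "\<forall>\<^sub>F M in at_top. 2 \<le> M \<and> 2 * \<delta> / q \<le> M \<and> C2 * (2 * \<delta> / M) powr (2 * m) < K0 / 3
    \<and> 3 * (C0 / M) powr 2 < \<eta> \<and> (C2 * (L + \<delta> + 1)) * (C0 / M) powr 2 < K0 / 3"
    by (intro eventually_conj eventually_ge_at_top eventually_mult_const_over_powr_less)
       (use \<delta> c1 m K0 \<eta> C0 L in auto)
  then obtain M where M: "2 \<le> M" "2 * \<delta> / q \<le> M" "C2 * (2 * \<delta> / M) powr (2 * m) < K0 / 3"
    "3 * (C0 / M) powr 2 < \<eta>" "(C2 * (L + \<delta> + 1)) * (C0 / M) powr 2 < K0 / 3"
    using eventually_happens'[OF trivial_limit_at_top_linorder] by blast
  have M0: "M > 0" using M by simp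
  define \<omega>1 \<omega>2 :: "real \<Rightarrow> real" where "\<omega>1 t = 1 / (2 * sqrt t)" and "\<omega>2 t = - (1 / (4 * t * sqrt t))" for t
  have no: "\<not> (\<exists>x\<in>cball x0 d. \<exists>y\<in>cball x0 d.
    u x - v y - \<sigma> - M * sqrt (dist x y) - L * (norm (x - x0))\<^sup>2 - L * (norm (y - x0))\<^sup>2 > 0)"
    if x0: "x0 \<in> cball 0 r" for x0
  proof
    assume ex: "\<exists>x\<in>cball x0 d. \<exists>y\<in>cball x0 d.
      u x - v y - \<sigma> - M * sqrt (dist x y) - L * (norm (x - x0))\<^sup>2 - L * (norm (y - x0))\<^sup>2 > 0"
    have sub: "cball x0 d \<subseteq> cball 0 r1" using x0 d by (intro cball_subset_cball_iff[THEN iffD2]) auto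
    have D1: "\<forall>t\<in>{0<..<1}. (sqrt has_real_derivative \<omega>1 t) (at t)"
      by (auto simp: \<omega>1_def field_simps intro!: derivative_eq_intros)
    have D2: "\<forall>t\<in>{0<..<1}. (\<omega>1 has_real_derivative \<omega>2 t) (at t)"
      unfolding \<omega>1_def \<omega>2_def
      by (auto simp: field_simps power2_eq_square intro!: derivative_eq_intros)
    have sg: "\<forall>t\<in>{0<..<1}. \<omega>1 t > 0 \<and> \<omega>2 t < 0 \<and> - \<omega>2 t * t \<le> \<omega>1 t"
      by (auto simp: \<omega>1_def \<omega>2_def field_simps)
    have c2: "continuous_on {0<..<1} \<omega>2"
      unfolding \<omega>2_def by (intro continuous_intros) auto
    have lt: "\<forall>x\<in>ball 0 1. \<forall>y\<in>ball 0 1. u x - v y - \<sigma> < L * d\<^sup>2"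
      using C0 unfolding L(2) by fastforce
    have sq: "continuous_on {0..1/2} sqrt" "\<forall>t\<in>{0..1/2}. sqrt t \<ge> 0"
      by (auto intro!: continuous_intros)
    from doubling_propertyD[OF dp M0 L(1) d(1,2) sub real_sqrt_zero sq D1 D2 sg c2 lt ex]
    obtain x y where xy: "x \<in> cball x0 d" "y \<in> cball x0 d" "x \<noteq> y" "dist x y \<le> 1/2"
      "M * sqrt (dist x y) + L * (norm (x - x0))\<^sup>2 + L * (norm (y - x0))\<^sup>2 < u x - v y - \<sigma>"
      and main: "\<forall>s P \<kappa> \<delta> \<mu>. s = dist x y \<longrightarrow> P = M * \<omega>1 s \<longrightarrow> \<kappa> = - \<omega>2 s * s / \<omega>1 s \<longrightarrow> 1 \<le> P \<longrightarrow>
        2 * L * norm (x - x0) < \<delta> \<longrightarrow> 2 * L * norm (y - x0) < \<delta> \<longrightarrow> \<delta> \<le> P * sqrt (\<kappa> / (64 * CARD('n))) \<longrightarrow> \<mu> > 0 \<longrightarrow>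
        (\<exists>x'\<in>ball 0 1. \<exists>y'\<in>ball 0 1. norm (x' - x) \<le> \<mu> \<and> norm (y' - y) \<le> \<mu> \<and>
          c1 * \<kappa> powr (1 + \<alpha> / 2) \<le> C2 * ((\<delta> / P) powr (2 * m) + \<bar>b x' - b y'\<bar> * s * P powr (\<beta> - \<alpha> - 1) + s * (L + \<delta> + 1)))"
      by (elim bexE conjE)
    define s where "s = dist x y"
    have s: "s > 0" "s \<le> 1 / 2" using xy by (auto simp: s_def)
    define P where "P = M * \<omega>1 s"
    have Ps: "P * s = M * sqrt s / 2" using s by (simp add: P_def \<omega>1_def field_simps)
    have in1: "x \<in> ball 0 1" "y \<in> ball 0 1" using xy sub rr by (auto simp: subset_iff)
    have nn: "L * (norm (x - x0))\<^sup>2 \<ge> 0" "L * (norm (y - x0))\<^sup>2 \<ge> 0" using L by auto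
    have Ms: "M * sqrt s \<le> C0" using C0(2)[OF in1] xy(5) nn unfolding s_def by linarith
    have s_le: "s \<le> (C0 / M) powr 2"
    proof -
      have "sqrt s \<le> C0 / M" using Ms M0 by (simp add: field_simps)
      then have "(sqrt s)\<^sup>2 \<le> (C0 / M)\<^sup>2" by (rule power_mono) (use s in simp)
      then show ?thesis using s C0 M0 by simp
    qed
    have sqs: "sqrt s \<le> 1" using s by simp
    have PM: "M / 2 \<le> P"
    proof -
      have "1 / 2 \<le> \<omega>1 s" using s sqs by (simp add: \<omega>1_def field_simps)
      then have "M * (1 / 2) \<le> M * \<omega>1 s" using M0 by (intro mult_left_mono) auto
      then show ?thesis by (simp add: P_def)
    qed
    have P1: "1 \<le> P" using PM M by simp
    have \<kappa>: "1 / 2 = - \<omega>2 s * s / \<omega>1 s" using s by (simp add: \<omega>1_def \<omega>2_def field_simps)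
    have \<delta>x: "2 * L * norm (x - x0) < \<delta>" "2 * L * norm (y - x0) < \<delta>"
    proof -
      have "norm (x - x0) \<le> d" "norm (y - x0) \<le> d" using xy by (auto simp: dist_norm norm_minus_commute)
      then have "2 * L * norm (x - x0) \<le> 2 * L * d" "2 * L * norm (y - x0) \<le> 2 * L * d"
        using L by (auto intro!: mult_left_mono)
      then show "2 * L * norm (x - x0) < \<delta>" "2 * L * norm (y - x0) < \<delta>" by (auto simp: \<delta>_def)
    qed
    have "2 * \<delta> \<le> M * q" using M(2) q by (simp add: field_simps)
    also have "\<dots> \<le> (2 * P) * q" using PM q by (intro mult_right_mono) auto
    finally have \<delta>P: "\<delta> \<le> P * sqrt (1 / 2 / (64 * CARD('n)))" by (simp add: q_def n_def)
    define \<mu> where "\<mu> = min s (r2 - r1)"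
    have \<mu>: "\<mu> > 0" "\<mu> \<le> s" "\<mu> \<le> r2 - r1" using s rr by (auto simp: \<mu>_def)
    obtain x' y' where x': "x' \<in> ball 0 1" "norm (x' - x) \<le> \<mu>" and y': "y' \<in> ball 0 1" "norm (y' - y) \<le> \<mu>"
      and fin: "c1 * (1 / 2) powr (1 + \<alpha> / 2) \<le> C2 * ((\<delta> / P) powr (2 * m) + \<bar>b x' - b y'\<bar> * s * P powr (\<beta> - \<alpha> - 1) + s * (L + \<delta> + 1))"
      using main[rule_format, OF s_def P_def \<kappa> P1 \<delta>x \<delta>P \<mu>(1)] by blast
    have "x' \<in> cball 0 r2" "y' \<in> cball 0 r2"
      using norm_triangle_ineq[of "x' - x" x] norm_triangle_ineq[of "y' - y" y] x' y' \<mu> xy(1,2) sub by (auto simp: subset_iff)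
    moreover have "dist x' y' < \<eta>"
    proof -
      have "dist x' y' \<le> norm (x' - x) + dist x y + norm (y' - y)"
        using norm_triangle_ineq[of "x' - x" "x - y'"] norm_triangle_ineq4[of "x - y" "y' - y"] by (simp add: dist_norm)
      also have "\<dots> \<le> 3 * s" using x' y' \<mu> by (simp add: s_def)
      also have "\<dots> < \<eta>" using s_le M(4) by simp
      finally show ?thesis .
    qed
    ultimately have bb: "\<bar>b x' - b y'\<bar> < \<epsilon>0" by (rule \<eta>(2))
    have A1: "C2 * (\<delta> / P) powr (2 * m) \<le> C2 * (2 * \<delta> / M) powr (2 * m)"
    proof -
      have "\<delta> / P \<le> \<delta> / (M / 2)" using PM M0 \<delta> P1 by (intro divide_left_mono) auto
      then have "\<delta> / P \<le> 2 * \<delta> / M" by (simp add: mult.commute)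
      then show ?thesis using c1 m \<delta> P1 by (intro mult_left_mono powr_mono2) auto
    qed
    have A2: "C2 * (\<bar>b x' - b y'\<bar> * s * P powr (\<beta> - \<alpha> - 1)) \<le> K0 / 3"
    proof -
      have "P powr (\<beta> - \<alpha> - 1) \<le> P powr 1" using P1 \<beta> by (intro powr_mono) auto
      then have "s * P powr (\<beta> - \<alpha> - 1) \<le> s * P" using s P1 by (intro mult_left_mono) auto
      also have "s * P \<le> C0" using Ps Ms C0 by (simp add: mult.commute)
      finally have "\<bar>b x' - b y'\<bar> * (s * P powr (\<beta> - \<alpha> - 1)) \<le> \<epsilon>0 * C0"
        using bb s \<epsilon>0 by (intro mult_mono) auto
      then have "C2 * (\<bar>b x' - b y'\<bar> * (s * P powr (\<beta> - \<alpha> - 1))) \<le> C2 * (\<epsilon>0 * C0)" using c1 by (intro mult_left_mono) auto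
      also have "C2 * (\<epsilon>0 * C0) = K0 / 3" using c1 C0 by (simp add: \<epsilon>0_def)
      finally show ?thesis by (simp add: mult.assoc)
    qed
    have A3: "C2 * (s * (L + \<delta> + 1)) \<le> (C2 * (L + \<delta> + 1)) * (C0 / M) powr 2"
    proof -
      have "(C2 * (L + \<delta> + 1)) * s \<le> (C2 * (L + \<delta> + 1)) * (C0 / M) powr 2"
        using s_le c1 L \<delta> by (intro mult_left_mono) auto
      then show ?thesis by (simp add: mult_ac)
    qed
    have "K0 < K0" using fin A1 A2 A3 M(3,5) unfolding K0_def[symmetric] distrib_left by linarith
    then show False by simp
  qed
  \<comment> \<open>For points at distance at most \<open>d\<close> the centre is
    \<open>x0 = x\<close>, so only the localising term of \<open>y\<close> survives. For the others
    \<open>C0\<close> is already a multiple of the square root of the distance.\<close>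
  define c where "c = M + L + C0 / sqrt d"
  have c: "c > 0" "C0 / sqrt d > 0" using M0 L C0 d by (auto simp: c_def add_pos_pos)
  have "u x - v y \<le> \<sigma> + c * sqrt (dist x y)" if xy: "x \<in> cball 0 r" "y \<in> cball 0 r" for x y
  proof (cases "dist x y \<le> d")
    case True
    then have "x \<in> cball x d" "y \<in> cball x d" using d by auto
    then have "\<not> (u x - v y - \<sigma> - M * sqrt (dist x y) - L * (norm (x - x))\<^sup>2 - L * (norm (y - x))\<^sup>2 > 0)"
      using no[OF xy(1)] by blast
    then have 1: "u x - v y \<le> \<sigma> + M * sqrt (dist x y) + L * (dist x y)\<^sup>2"
      by (simp add: dist_norm norm_minus_commute)
    have "(dist x y)\<^sup>2 \<le> dist x y" using True d by (simp add: power2_eq_square mult_left_le)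
    also have "dist x y \<le> sqrt (dist x y)"
      by (rule real_le_rsqrt) (use \<open>(dist x y)\<^sup>2 \<le> dist x y\<close> in simp)
    finally have "L * (dist x y)\<^sup>2 \<le> L * sqrt (dist x y)" using L by (intro mult_left_mono) auto
    moreover have "C0 / sqrt d * sqrt (dist x y) \<ge> 0" using c by (intro mult_nonneg_nonneg) auto
    ultimately show ?thesis using 1 by (simp add: c_def distrib_right)
  next
    case False
    then have "sqrt d \<le> sqrt (dist x y)" by simp
    then have "C0 / sqrt d * sqrt d \<le> C0 / sqrt d * sqrt (dist x y)" using c by (intro mult_left_mono) auto
    then have "C0 \<le> C0 / sqrt d * sqrt (dist x y)" using d by simp
    moreover have "u x - v y - \<sigma> \<le> C0" using xy r by (intro C0) auto
    moreover have "M * sqrt (dist x y) \<ge> 0" "L * sqrt (dist x y) \<ge> 0" using M0 L by auto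
    ultimately show ?thesis unfolding c_def distrib_right by linarith
  qed
  with c show ?thesis by blast
qed

text \<open>In the borderline case \<open>P\<close> has exponent 1, so \<open>s * P\<close> is
  bounded and the Hoelder continuity of \<open>b\<close> yields the power. Otherwise the exponent
  \<open>e\<close> is below 1 and \<open>s * P powr e = s powr (1 - e) * (s * P) powr e\<close>
  does, with \<open>b\<close> merely bounded. The factor 3 allows for displacing both points of a
  pair at distance \<open>s\<close> by at most \<open>s\<close>.\<close>

lemma modulus_b:
  assumes r: "r < 1" and K: "K \<ge> 1"
  shows "\<exists>\<theta>>0. \<exists>C>0. \<theta> \<le> 1 \<and> (\<forall>x\<in>cball 0 r. \<forall>y\<in>cball 0 r. \<forall>s P. 0 < s \<longrightarrow> 1 \<le> P \<longrightarrow> s * P \<le> K \<longrightarrow> dist x y \<le> 3 * s \<longrightarrow>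
    \<bar>b x - b y\<bar> * s * P powr (\<beta> - \<alpha> - 1) \<le> C * s powr \<theta>)"
proof (cases "\<beta> = \<alpha> + 2")
  case True
  obtain \<gamma> C where \<gamma>: "0 < \<gamma>" "\<gamma> \<le> 1" and C: "\<And>x y. x \<in> ball 0 1 \<Longrightarrow> y \<in> ball 0 1 \<Longrightarrow> \<bar>b x - b y\<bar> \<le> C * dist x y powr \<gamma>"
    using b_hold[OF True] unfolding holder_on_def by blast
  define C' where "C' = (\<bar>C\<bar> + 1) * 3 powr \<gamma> * K"
  have "\<bar>b x - b y\<bar> * s * P powr (\<beta> - \<alpha> - 1) \<le> C' * s powr \<gamma>"
    if "x \<in> cball 0 r" "y \<in> cball 0 r" and s: "0 < s" and P: "1 \<le> P" "s * P \<le> K" and xy: "dist x y \<le> 3 * s" for x y s P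
  proof -
    have "\<bar>b x - b y\<bar> \<le> C * dist x y powr \<gamma>" using that r by (intro C) auto
    also have "\<dots> \<le> (\<bar>C\<bar> + 1) * (3 * s) powr \<gamma>" using xy \<gamma> by (intro mult_mono powr_mono2) auto
    finally have "\<bar>b x - b y\<bar> * (s * P) \<le> (\<bar>C\<bar> + 1) * (3 * s) powr \<gamma> * K"
      using P s by (intro mult_mono) auto
    then show ?thesis using True P s by (simp add: C'_def powr_mult mult_ac)
  qed
  moreover have "C' > 0" using K by (simp add: C'_def)
  ultimately show ?thesis using \<gamma> by blast
next
  case False
  define e where "e = \<beta> - \<alpha> - 1"
  have e: "0 \<le> e" "e < 1" using \<beta> False by (auto simp: e_def)
  have "compact (b ` cball 0 r)"
    by (intro compact_continuous_image continuous_on_subset[OF b_cont]) (use r in auto)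
  then obtain B where B: "B > 0" "\<And>x. x \<in> cball 0 r \<Longrightarrow> \<bar>b x\<bar> \<le> B"
    using compact_imp_bounded bounded_pos by (metis imageI real_norm_def)
  have "\<bar>b x - b y\<bar> * s * P powr (\<beta> - \<alpha> - 1) \<le> (2 * B * K) * s powr (1 - e)"
    if xy: "x \<in> cball 0 r" "y \<in> cball 0 r" and s: "0 < s" and P: "1 \<le> P" "s * P \<le> K" for x y s P
  proof -
    have "\<bar>b x - b y\<bar> \<le> 2 * B" using B(2)[OF xy(1)] B(2)[OF xy(2)] by linarith
    moreover have "s * P powr e \<le> s powr (1 - e) * K"
    proof -
      have "s * P powr e = s powr (1 - e) * (s * P) powr e"
        using s P by (simp add: powr_mult powr_add[symmetric] flip: mult.assoc)
      also have "(s * P) powr e \<le> K powr e" using s P e by (intro powr_mono2) auto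
      also have "K powr e \<le> K powr 1" using K e by (intro powr_mono) auto
      finally show ?thesis using K by (simp add: mult_left_mono)
    qed
    ultimately have "\<bar>b x - b y\<bar> * (s * P powr e) \<le> 2 * B * (s powr (1 - e) * K)"
      by (rule mult_mono) (use s B in auto)
    then show ?thesis by (simp add: e_def mult_ac)
  qed
  moreover have "2 * B * K > 0" "1 - e > 0" "1 - e \<le> 1" using B K e by auto
  ultimately show ?thesis by blast
qed

text \<open>The Hoelder estimate bounds the distance of the maximum from \<open>x0\<close> by a multiple of \<open>s\<^sup>1\<^sup>/\<^sup>4\<close>,
  which makes the perturbation \<open>\<delta>\<close> of the gradients small enough for a nearly linear \<open>\<omega>\<close>.\<close>

lemma lipschitz_estimate:
  assumes r: "r < 1"
  shows "\<exists>c>0. \<forall>x\<in>cball 0 r. \<forall>y\<in>cball 0 r. u x - v y \<le> \<sigma> + c * dist x y"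
proof -
  define r1 where "r1 = (1 + r) / 2"
  define r2 where "r2 = (1 + r1) / 2"
  have rr: "r < r1" "r1 < r2" "r2 < 1" using r by (auto simp: r1_def r2_def)
  define d where "d = min (1 / 4) (r1 - r)"
  have d: "0 < d" "d \<le> 1 / 4" "d \<le> r1 - r" using rr by (auto simp: d_def min_def)
  obtain C0 where C0: "C0 > 0" "\<And>x y. x \<in> ball 0 1 \<Longrightarrow> y \<in> ball 0 1 \<Longrightarrow> u x - v y - \<sigma> \<le> C0"
    using diff_bound by blast
  define L where "L = 2 * C0 / d\<^sup>2"
  have L: "L > 0" "L * d\<^sup>2 = 2 * C0" using C0 d by (auto simp: L_def)
  have r1: "r1 < 1" using rr by simp
  obtain cH where cH: "cH > 0" "\<And>x y. x \<in> cball 0 r1 \<Longrightarrow> y \<in> cball 0 r1 \<Longrightarrow> u x - v y \<le> \<sigma> + cH * sqrt (dist x y)"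
    using holder_estimate[OF r1] by blast
  define n where "n = real CARD('n)"
  have n: "n > 0" by (simp add: n_def)
  have m: "m > 0" using \<alpha> by (simp add: m_def)
  from doubling_maximum[OF r1] obtain c1 C2 where c1: "c1 > 0" "C2 > 0" and dp: "doubling_property r1 c1 C2"
    by blast
  have "max 1 (2 * C0) \<ge> 1" by simp
  from modulus_b[OF rr(3) this] obtain \<theta> C3 where \<theta>: "\<theta> > 0" "\<theta> \<le> 1" and C3: "C3 > 0" and
    mb: "\<forall>x\<in>cball 0 r2. \<forall>y\<in>cball 0 r2. \<forall>s P. 0 < s \<longrightarrow> 1 \<le> P \<longrightarrow> s * P \<le> max 1 (2 * C0) \<longrightarrow> dist x y \<le> 3 * s \<longrightarrow>
    \<bar>b x - b y\<bar> * s * P powr (\<beta> - \<alpha> - 1) \<le> C3 * s powr \<theta>" by blast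
  \<comment> \<open>The power of \<open>s\<close> that the concavity term will retain. It must not
    exceed the powers in the errors: \<open>m / 2\<close> from the weights, \<theta> from
    \<open>b\<close>, and 1 from the remaining terms. Taking only half of the last two leaves a
    positive power of \<open>s\<close> that is small for large \<open>M\<close>; the first error is
    small through \<open>M\<close> itself.\<close>
  define \<tau>h where "\<tau>h = min (1 / 2) (min (m / 2) (\<theta> / 2))"
  have \<tau>h: "\<tau>h > 0" "\<tau>h \<le> 1 / 2" "\<tau>h \<le> m / 2" "\<tau>h \<le> \<theta> / 2" using m \<theta> by (auto simp: \<tau>h_def)
  \<comment> \<open>Chosen so that \<open>(s powr \<tau>) powr (1 + \<alpha> / 2)\<close> is
    \<open>s powr \<tau>h\<close>.\<close>
  define \<tau> where "\<tau> = \<tau>h / (1 + \<alpha> / 2)"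
  have \<tau>: "\<tau> > 0" "\<tau> * (1 + \<alpha> / 2) = \<tau>h" "\<tau> \<le> 1 / 2"
  proof -
    show "\<tau> > 0" "\<tau> * (1 + \<alpha> / 2) = \<tau>h" using \<alpha> \<tau>h by (auto simp: \<tau>_def)
    have "\<tau> \<le> \<tau>h / 1" unfolding \<tau>_def using \<alpha> \<tau>h by (intro divide_left_mono) auto
    then show "\<tau> \<le> 1 / 2" using \<tau>h by simp
  qed
  define k where "k = (1 + \<tau>) / 4"
  have k: "k > 0" "k \<le> 1 / 2" using \<tau> by (auto simp: k_def)
  define c\<tau> where "c\<tau> = k * \<tau>"
  have c\<tau>: "c\<tau> > 0" "c\<tau> \<le> 1 / 2"
  proof -
    show "c\<tau> > 0" using k \<tau> by (simp add: c\<tau>_def)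
    have "k * \<tau> \<le> 1 / 2 * 1" using k \<tau> by (intro mult_mono) auto
    then show "c\<tau> \<le> 1 / 2" by (simp add: c\<tau>_def)
  qed
  define \<omega> \<omega>1 \<omega>2 :: "real \<Rightarrow> real" where "\<omega> t = t - t powr (1 + \<tau>) / 4"
    and "\<omega>1 t = 1 - k * t powr \<tau>" and "\<omega>2 t = - (c\<tau> * t powr (\<tau> - 1))" for t
  \<comment> \<open>From \<open>L * (norm (x - x0))^2 \<le> cH * sqrt s\<close> the gradient of the
    localising term is at most \<open>2 * sqrt (L * cH) * s powr (1 / 4)\<close>; the summand 1
    makes the bound strict.\<close>
  define c\<delta> where "c\<delta> = 2 * sqrt (L * cH) + 1"
  have c\<delta>: "c\<delta> > 0" using L cH by (simp add: c\<delta>_def add_nonneg_pos)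
  define K0 where "K0 = c1 * c\<tau> powr (1 + \<alpha> / 2)"
  have K0: "K0 > 0" using c1 c\<tau> by (simp add: K0_def)
  define q where "q = sqrt (c\<tau> / (64 * n))"
  have q: "q > 0" using n c\<tau> by (simp add: q_def)
  have "\<forall>\<^sub>F M in at_top. 2 \<le> M \<and> 2 * c\<delta> / q \<le> M \<and> C2 * (2 * c\<delta> / M) powr (2 * m) < K0 / 3
    \<and> (C2 * C3) * (2 * C0 / M) powr (\<theta> / 2) < K0 / 3 \<and> (C2 * (L + c\<delta> + 1)) * (2 * C0 / M) powr (1 / 2) < K0 / 3"
    by (intro eventually_conj eventually_ge_at_top eventually_mult_const_over_powr_less)
       (use c\<delta> c1 m K0 \<theta> C0 C3 L in auto)
  then obtain M where M: "2 \<le> M" "2 * c\<delta> / q \<le> M" "C2 * (2 * c\<delta> / M) powr (2 * m) < K0 / 3"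
    "(C2 * C3) * (2 * C0 / M) powr (\<theta> / 2) < K0 / 3" "(C2 * (L + c\<delta> + 1)) * (2 * C0 / M) powr (1 / 2) < K0 / 3"
    using eventually_happens'[OF trivial_limit_at_top_linorder] by blast
  have M0: "M > 0" using M by simp
  \<comment> \<open>The linear lower bound that gives \<open>M * s \<le> 2 * C0\<close> at the
    maximum, the counterpart of the bound on \<open>M * sqrt s\<close> in the first round.\<close>
  have \<omega>low: "3 / 4 * t \<le> \<omega> t" if "0 \<le> t" "t \<le> 1" for t
  proof (cases "t = 0")
    case False
    then have "t powr (1 + \<tau>) \<le> t powr 1" using that \<tau> by (intro powr_mono') auto
    then show ?thesis using that False by (simp add: \<omega>_def)
  qed (simp add: \<omega>_def)
  have t1: "t powr \<tau> \<le> 1" if "0 < t" "t \<le> 1" for t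
    using powr_mono2[of \<tau> t 1] that \<tau> by simp
  have \<omega>1b: "1 / 2 \<le> \<omega>1 t" "\<omega>1 t \<le> 1" if "0 < t" "t \<le> 1" for t
  proof -
    have "k * t powr \<tau> \<le> 1 / 2 * 1" using t1[OF that] k by (intro mult_mono) auto
    then show "1 / 2 \<le> \<omega>1 t" by (simp add: \<omega>1_def)
    show "\<omega>1 t \<le> 1" using k by (simp add: \<omega>1_def)
  qed
  have \<omega>2t: "- \<omega>2 t * t = c\<tau> * t powr \<tau>" if "0 < t" for t
    using that by (simp add: \<omega>2_def powr_diff)
  have D1: "\<forall>t\<in>{0<..<1}. (\<omega> has_real_derivative \<omega>1 t) (at t)"
  proof
    fix t :: real assume "t \<in> {0<..<1}"
    then have "((\<lambda>t. t powr (1 + \<tau>)) has_real_derivative (1 + \<tau>) * t powr (1 + \<tau> - 1)) (at t)"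
      by (intro has_real_derivative_powr) auto
    from DERIV_diff[OF DERIV_ident DERIV_cdivide[OF this, of 4]]
    show "(\<omega> has_real_derivative \<omega>1 t) (at t)" by (simp add: \<omega>_def[abs_def] \<omega>1_def k_def)
  qed
  have D2: "\<forall>t\<in>{0<..<1}. (\<omega>1 has_real_derivative \<omega>2 t) (at t)"
  proof
    fix t :: real assume "t \<in> {0<..<1}"
    then have "((\<lambda>t. t powr \<tau>) has_real_derivative \<tau> * t powr (\<tau> - 1)) (at t)"
      by (intro has_real_derivative_powr) auto
    from DERIV_diff[OF DERIV_const[of 1] DERIV_cmult[OF this, of k]]
    show "(\<omega>1 has_real_derivative \<omega>2 t) (at t)" by (simp add: \<omega>1_def[abs_def] \<omega>2_def c\<tau>_def mult.assoc)
  qed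
  have sg: "\<forall>t\<in>{0<..<1}. \<omega>1 t > 0 \<and> \<omega>2 t < 0 \<and> - \<omega>2 t * t \<le> \<omega>1 t"
  proof
    fix t :: real assume t: "t \<in> {0<..<1}"
    have "c\<tau> * t powr \<tau> \<le> 1 / 2 * 1" using t1[of t] t c\<tau> by (intro mult_mono) auto
    then have "- \<omega>2 t * t \<le> \<omega>1 t" using \<omega>2t[of t] \<omega>1b(1)[of t] t by simp
    moreover have "\<omega>2 t < 0" using t c\<tau> by (simp add: \<omega>2_def)
    ultimately show "\<omega>1 t > 0 \<and> \<omega>2 t < 0 \<and> - \<omega>2 t * t \<le> \<omega>1 t" using \<omega>1b(1)[of t] t by simp
  qed
  have c2: "continuous_on {0<..<1} \<omega>2"
    unfolding \<omega>2_def by (intro continuous_intros) auto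
  have \<omega>c: "continuous_on {0..1/2} \<omega>"
    unfolding \<omega>_def using \<tau> by (intro continuous_intros continuous_on_powr') auto
  have \<omega>nn: "\<forall>t\<in>{0..1/2}. \<omega> t \<ge> 0" using \<omega>low by force
  have \<omega>0: "\<omega> 0 = 0" by (simp add: \<omega>_def)
  have lt: "\<forall>x\<in>ball 0 1. \<forall>y\<in>ball 0 1. u x - v y - \<sigma> < L * d\<^sup>2"
    using C0 unfolding L(2) by fastforce
  have no: "\<not> (\<exists>x\<in>cball x0 d. \<exists>y\<in>cball x0 d.
    u x - v y - \<sigma> - M * \<omega> (dist x y) - L * (norm (x - x0))\<^sup>2 - L * (norm (y - x0))\<^sup>2 > 0)"
    if x0: "x0 \<in> cball 0 r" for x0
  proof
    assume ex: "\<exists>x\<in>cball x0 d. \<exists>y\<in>cball x0 d.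
      u x - v y - \<sigma> - M * \<omega> (dist x y) - L * (norm (x - x0))\<^sup>2 - L * (norm (y - x0))\<^sup>2 > 0"
    have sub: "cball x0 d \<subseteq> cball 0 r1" using x0 d by (intro cball_subset_cball_iff[THEN iffD2]) auto
    from doubling_propertyD[OF dp M0 L(1) d(1,2) sub \<omega>0 \<omega>c \<omega>nn D1 D2 sg c2 lt ex]
    obtain x y where xy: "x \<in> cball x0 d" "y \<in> cball x0 d" "x \<noteq> y" "dist x y \<le> 1/2"
      "M * \<omega> (dist x y) + L * (norm (x - x0))\<^sup>2 + L * (norm (y - x0))\<^sup>2 < u x - v y - \<sigma>"
      and main: "\<forall>s P \<kappa> \<delta> \<mu>. s = dist x y \<longrightarrow> P = M * \<omega>1 s \<longrightarrow> \<kappa> = - \<omega>2 s * s / \<omega>1 s \<longrightarrow> 1 \<le> P \<longrightarrow>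
        2 * L * norm (x - x0) < \<delta> \<longrightarrow> 2 * L * norm (y - x0) < \<delta> \<longrightarrow> \<delta> \<le> P * sqrt (\<kappa> / (64 * CARD('n))) \<longrightarrow> \<mu> > 0 \<longrightarrow>
        (\<exists>x'\<in>ball 0 1. \<exists>y'\<in>ball 0 1. norm (x' - x) \<le> \<mu> \<and> norm (y' - y) \<le> \<mu> \<and>
          c1 * \<kappa> powr (1 + \<alpha> / 2) \<le> C2 * ((\<delta> / P) powr (2 * m) + \<bar>b x' - b y'\<bar> * s * P powr (\<beta> - \<alpha> - 1) + s * (L + \<delta> + 1)))"
      by (elim bexE conjE)
    define s where "s = dist x y"
    have s: "s > 0" "s \<le> 1 / 2" "s \<le> 1" using xy by (auto simp: s_def)
    define P where "P = M * \<omega>1 s"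
    define \<kappa> where "\<kappa> = - \<omega>2 s * s / \<omega>1 s"
    have in1: "x \<in> ball 0 1" "y \<in> ball 0 1" using xy sub rr by (auto simp: subset_iff)
    have inr: "x \<in> cball 0 r1" "y \<in> cball 0 r1" using xy sub by auto
    have nn: "L * (norm (x - x0))\<^sup>2 \<ge> 0" "L * (norm (y - x0))\<^sup>2 \<ge> 0" "M * \<omega> s \<ge> 0"
      using L M0 \<omega>nn s by auto
    have "M * (3 / 4 * s) \<le> M * \<omega> s" using M0 s by (intro mult_left_mono \<omega>low) auto
    also have "\<dots> \<le> C0" using C0(2)[OF in1] xy(5) nn unfolding s_def by linarith
    finally have Ms: "M * s \<le> 2 * C0" using C0(1) by simp
    then have s_le: "s \<le> 2 * C0 / M" using M0 by (simp add: field_simps)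
    have PM: "M / 2 \<le> P" "P \<le> M"
    proof -
      have "M * (1 / 2) \<le> M * \<omega>1 s" "M * \<omega>1 s \<le> M * 1" using M0 \<omega>1b[of s] s by (auto intro!: mult_left_mono)
      then show "M / 2 \<le> P" "P \<le> M" by (auto simp: P_def)
    qed
    have P1: "1 \<le> P" using PM M by simp
    have \<kappa>low: "c\<tau> * s powr \<tau> \<le> \<kappa>"
    proof -
      have "c\<tau> * s powr \<tau> * \<omega>1 s \<le> c\<tau> * s powr \<tau> * 1" using c\<tau> \<omega>1b[of s] s by (intro mult_left_mono) auto
      then show ?thesis unfolding \<kappa>_def \<omega>2t[OF s(1)] using \<omega>1b[of s] s by (simp add: pos_le_divide_eq)
    qed
    define \<delta> where "\<delta> = c\<delta> * s powr (1 / 4)"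
    have s4: "s powr (1 / 4) > 0" "(s powr (1 / 4))\<^sup>2 = sqrt s" "s powr (1 / 4) \<le> 1"
    proof -
      show "s powr (1 / 4) > 0" using s by simp
      show "(s powr (1 / 4))\<^sup>2 = sqrt s"
        using s by (simp add: power2_eq_square powr_add[symmetric] powr_half_sqrt)
      show "s powr (1 / 4) \<le> 1" using powr_mono2[of "1 / 4" s 1] s by simp
    qed
    have \<delta>: "\<delta> > 0" "\<delta> \<le> c\<delta>"
      using c\<delta> s4 by (auto simp: \<delta>_def mult_le_cancel_left2)
    have \<delta>x: "2 * L * norm (z - x0) < \<delta>" if z: "z = x \<or> z = y" for z
    proof -
      have "L * (norm (z - x0))\<^sup>2 \<le> cH * sqrt s"
        using cH(2)[OF inr] xy(5) nn z unfolding s_def by auto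
      then have "4 * L * (L * (norm (z - x0))\<^sup>2) \<le> 4 * L * (cH * sqrt s)" using L by (intro mult_left_mono) auto
      also have "\<dots> = (2 * sqrt (L * cH) * s powr (1 / 4))\<^sup>2"
        using L cH by (simp add: power_mult_distrib s4(2))
      finally have "(2 * L * norm (z - x0))\<^sup>2 \<le> (2 * sqrt (L * cH) * s powr (1 / 4))\<^sup>2"
        by (simp add: power_mult_distrib power2_eq_square[of L])
      then have "2 * L * norm (z - x0) \<le> 2 * sqrt (L * cH) * s powr (1 / 4)"
        by (rule power2_le_imp_le) (use L cH in simp)
      also have "\<dots> < \<delta>" using s4(1) by (simp add: \<delta>_def c\<delta>_def distrib_right)
      finally show ?thesis .
    qed
    have \<delta>P: "\<delta> \<le> P * sqrt (\<kappa> / (64 * CARD('n)))"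
    proof -
      \<comment> \<open>Admissibility compares \<delta>, of order \<open>s powr (1 / 4)\<close>,
        with the square root of \<kappa>, of order \<open>s powr (\<tau> / 2)\<close>; this is why
        \<tau> is at most 1/2.\<close>
      have "s powr (1 / 4) \<le> s powr (\<tau> / 2)" using s \<tau> by (intro powr_mono') auto
      also have "s powr (\<tau> / 2) = sqrt (s powr \<tau>)"
        using s by (simp add: powr_half_sqrt[symmetric] powr_powr)
      finally have "\<delta> \<le> c\<delta> * sqrt (s powr \<tau>)" using c\<delta> unfolding \<delta>_def by (intro mult_left_mono) auto
      also have "c\<delta> \<le> (M / 2) * q" using M(2) q by (simp add: field_simps)
      then have "c\<delta> * sqrt (s powr \<tau>) \<le> (M / 2) * q * sqrt (s powr \<tau>)" by (intro mult_right_mono) auto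
      also have "\<dots> = (M / 2) * sqrt (c\<tau> * s powr \<tau> / (64 * n))"
        by (simp add: q_def real_sqrt_mult[symmetric])
      also have "\<dots> \<le> P * sqrt (\<kappa> / (64 * n))"
        using PM M0 \<kappa>low n c\<tau> by (intro mult_mono real_sqrt_le_mono divide_right_mono) auto
      finally show ?thesis by (simp add: n_def)
    qed
    define \<mu> where "\<mu> = min s (r2 - r1)"
    have \<mu>: "\<mu> > 0" "\<mu> \<le> s" "\<mu> \<le> r2 - r1" using s rr by (auto simp: \<mu>_def)
    obtain x' y' where x': "x' \<in> ball 0 1" "norm (x' - x) \<le> \<mu>" and y': "y' \<in> ball 0 1" "norm (y' - y) \<le> \<mu>"
      and fin: "c1 * \<kappa> powr (1 + \<alpha> / 2) \<le> C2 * ((\<delta> / P) powr (2 * m) + \<bar>b x' - b y'\<bar> * s * P powr (\<beta> - \<alpha> - 1) + s * (L + \<delta> + 1))"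
      using main[rule_format, OF s_def P_def \<kappa>_def P1 \<delta>x \<delta>x \<delta>P \<mu>(1)] by blast
    have in2: "x' \<in> cball 0 r2" "y' \<in> cball 0 r2"
      using norm_triangle_ineq[of "x' - x" x] norm_triangle_ineq[of "y' - y" y] x' y' \<mu> inr by auto
    have d3: "dist x' y' \<le> 3 * s"
    proof -
      have "dist x' y' \<le> norm (x' - x) + dist x y + norm (y' - y)"
        using norm_triangle_ineq[of "x' - x" "x - y'"] norm_triangle_ineq4[of "x - y" "y' - y"] by (simp add: dist_norm)
      also have "\<dots> \<le> 3 * s" using x' y' \<mu> by (simp add: s_def)
      finally show ?thesis .
    qed
    have sP: "s * P \<le> max 1 (2 * C0)"
    proof -
      have "s * P \<le> s * M" using PM s by (intro mult_left_mono) auto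
      then show ?thesis using Ms by (simp add: mult.commute)
    qed
    \<comment> \<open>The common factor of the concavity term and of all three error bounds.
      Cancelling it leaves an inequality between \<open>K0\<close> and quantities that each lie
      below \<open>K0 / 3\<close>.\<close>
    define S where "S = s powr \<tau>h"
    have S: "S > 0" using s by (simp add: S_def)
    have A1: "C2 * (\<delta> / P) powr (2 * m) \<le> C2 * (2 * c\<delta> / M) powr (2 * m) * S"
    proof -
      have "\<delta> / P \<le> \<delta> / (M / 2)" using PM M0 \<delta> P1 by (intro divide_left_mono) auto
      also have "\<dots> = (2 * c\<delta> / M) * s powr (1 / 4)" by (simp add: \<delta>_def)
      finally have "(\<delta> / P) powr (2 * m) \<le> ((2 * c\<delta> / M) * s powr (1 / 4)) powr (2 * m)"
        using m \<delta> P1 by (intro powr_mono2) auto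
      also have "\<dots> = (2 * c\<delta> / M) powr (2 * m) * s powr (m / 2)"
        using c\<delta> M0 s by (subst powr_mult) (simp_all add: powr_powr)
      also have "\<dots> \<le> (2 * c\<delta> / M) powr (2 * m) * S"
        unfolding S_def using s \<tau>h by (intro mult_left_mono powr_mono') auto
      finally show ?thesis using c1 by (simp add: mult.assoc)
    qed
    have A2: "C2 * (\<bar>b x' - b y'\<bar> * s * P powr (\<beta> - \<alpha> - 1)) \<le> (C2 * C3) * (2 * C0 / M) powr (\<theta> / 2) * S"
    proof -
      have "\<bar>b x' - b y'\<bar> * s * P powr (\<beta> - \<alpha> - 1) \<le> C3 * s powr \<theta>"
        using mb in2 s(1) P1 sP d3 by blast
      also have "s powr \<theta> = s powr (\<theta> - \<tau>h) * S" by (simp add: S_def flip: powr_add)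
      also have "s powr (\<theta> - \<tau>h) \<le> s powr (\<theta> / 2)" using s \<tau>h by (intro powr_mono') auto
      also have "s powr (\<theta> / 2) \<le> (2 * C0 / M) powr (\<theta> / 2)" using s s_le \<theta> by (intro powr_mono2) auto
      finally have "\<bar>b x' - b y'\<bar> * s * P powr (\<beta> - \<alpha> - 1) \<le> C3 * ((2 * C0 / M) powr (\<theta> / 2) * S)"
        using C3 S by simp
      then show ?thesis using c1 by (simp add: mult.assoc)
    qed
    have A3: "C2 * (s * (L + \<delta> + 1)) \<le> (C2 * (L + c\<delta> + 1)) * (2 * C0 / M) powr (1 / 2) * S"
    proof -
      have "s = s powr (1 - \<tau>h) * S" using s by (simp add: S_def flip: powr_add)
      also have "s powr (1 - \<tau>h) \<le> s powr (1 / 2)" using s \<tau>h by (intro powr_mono') auto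
      also have "s powr (1 / 2) \<le> (2 * C0 / M) powr (1 / 2)" using s s_le by (intro powr_mono2) auto
      finally have "s \<le> (2 * C0 / M) powr (1 / 2) * S" using S by simp
      then have "s * (L + \<delta> + 1) \<le> ((2 * C0 / M) powr (1 / 2) * S) * (L + c\<delta> + 1)"
        using \<delta> L s by (intro mult_mono) auto
      then have "C2 * (s * (L + \<delta> + 1)) \<le> C2 * (((2 * C0 / M) powr (1 / 2) * S) * (L + c\<delta> + 1))"
        using c1 by (intro mult_left_mono) auto
      then show ?thesis by (simp add: mult_ac)
    qed
    have "K0 * S = c1 * (c\<tau> * s powr \<tau>) powr (1 + \<alpha> / 2)"
      using c\<tau> s by (simp add: K0_def S_def powr_mult powr_powr \<tau>(2))
    also have "\<dots> \<le> c1 * \<kappa> powr (1 + \<alpha> / 2)"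
      using c1 \<kappa>low c\<tau> \<alpha> by (intro mult_left_mono powr_mono2) auto
    finally have "K0 * S \<le> C2 * (2 * c\<delta> / M) powr (2 * m) * S + (C2 * C3) * (2 * C0 / M) powr (\<theta> / 2) * S
      + (C2 * (L + c\<delta> + 1)) * (2 * C0 / M) powr (1 / 2) * S"
      using fin A1 A2 A3 unfolding distrib_left[of C2] by linarith
    then have "K0 * S \<le> (C2 * (2 * c\<delta> / M) powr (2 * m) + (C2 * C3) * (2 * C0 / M) powr (\<theta> / 2)
      + (C2 * (L + c\<delta> + 1)) * (2 * C0 / M) powr (1 / 2)) * S" by (simp only: distrib_right)
    then have "K0 \<le> C2 * (2 * c\<delta> / M) powr (2 * m) + (C2 * C3) * (2 * C0 / M) powr (\<theta> / 2)
      + (C2 * (L + c\<delta> + 1)) * (2 * C0 / M) powr (1 / 2)" using S by (rule mult_right_le_imp_le)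
    then show False using M(3,4,5) by linarith
  qed
  define c where "c = M + L + C0 / d"
  have c: "c > 0" "C0 / d > 0" using M0 L C0 d by (auto simp: c_def add_pos_pos)
  have "u x - v y \<le> \<sigma> + c * dist x y" if xy: "x \<in> cball 0 r" "y \<in> cball 0 r" for x y
  proof (cases "dist x y \<le> d")
    case True
    then have "x \<in> cball x d" "y \<in> cball x d" using d by auto
    then have "\<not> (u x - v y - \<sigma> - M * \<omega> (dist x y) - L * (norm (x - x))\<^sup>2 - L * (norm (y - x))\<^sup>2 > 0)"
      using no[OF xy(1)] by blast
    then have 1: "u x - v y \<le> \<sigma> + M * \<omega> (dist x y) + L * (dist x y)\<^sup>2"
      by (simp add: dist_norm norm_minus_commute)
    have "(dist x y)\<^sup>2 \<le> dist x y" using True d by (simp add: power2_eq_square mult_left_le)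
    then have "L * (dist x y)\<^sup>2 \<le> L * dist x y" using L by (intro mult_left_mono) auto
    moreover have "M * \<omega> (dist x y) \<le> M * dist x y" using M0 by (intro mult_left_mono) (auto simp: \<omega>_def)
    moreover have "C0 / d * dist x y \<ge> 0" using c by (intro mult_nonneg_nonneg) auto
    ultimately show ?thesis using 1 unfolding c_def distrib_right by linarith
  next
    case False
    then have "C0 / d * d \<le> C0 / d * dist x y" using c by (intro mult_left_mono) auto
    then have "C0 \<le> C0 / d * dist x y" using d by simp
    moreover have "u x - v y - \<sigma> \<le> C0" using xy r by (intro C0) auto
    moreover have "M * dist x y \<ge> 0" "L * dist x y \<ge> 0" using M0 L by auto
    ultimately show ?thesis unfolding c_def distrib_right by linarith
  qed
  with c show ?thesis by blast
qed

end

theorem theorem2p2: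
  fixes F :: "real^'n^'n \<Rightarrow> real"
    and a A \<alpha> \<beta> :: real
    and b f g u v :: "real^'n \<Rightarrow> real"
  assumes F: "structural_F F a A"
    and \<alpha>: "\<alpha> > 0"
    and \<beta>: "\<alpha> + 1 \<le> \<beta>" "\<beta> \<le> \<alpha> + 2"
    and b_cont: "continuous_on (ball 0 1) b"
    and b_hold: "\<beta> = \<alpha> + 2 \<Longrightarrow> holder_on (ball 0 1) b"
    and f: "continuous_on (ball 0 1) f" "bounded (f ` ball 0 1)"
    and g: "continuous_on (ball 0 1) g" "bounded (g ` ball 0 1)"
    and u: "usc_on (ball 0 1) u" "bdd_above (u ` ball 0 1)"
           "visc_sub F \<alpha> \<beta> b g (ball 0 1) u"
    and v: "lsc_on (ball 0 1) v" "bdd_below (v ` ball 0 1)"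
           "visc_super F \<alpha> \<beta> b f (ball 0 1) v"
  shows "\<forall>r<1. \<exists>c. \<forall>x\<in>ball 0 r. \<forall>y\<in>ball 0 r.
           u x - v y \<le> (SUP z\<in>ball 0 1. u z - v z) + c * dist x y"
proof (intro allI impI)
  fix r :: real assume r: "r < 1"
  interpret visc_pair F a A \<alpha> \<beta> b f g u v
    by (rule visc_pair.intro) (fact F \<alpha> \<beta> b_cont b_hold f g u v)+
  obtain c where "\<forall>x\<in>cball 0 r. \<forall>y\<in>cball 0 r. u x - v y \<le> \<sigma> + c * dist x y"
    using lipschitz_estimate[OF r] by blast
  then have "\<forall>x\<in>ball 0 r. \<forall>y\<in>ball 0 r. u x - v y \<le> \<sigma> + c * dist x y"
    using ball_subset_cball by blast
  then show "\<exists>c. \<forall>x\<in>ball 0 r. \<forall>y\<in>ball 0 r.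
      u x - v y \<le> (SUP z\<in>ball 0 1. u z - v z) + c * dist x y"
    unfolding \<sigma>_def by blast
qed

end
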